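(* In the setting and notation described in the context, assume Assumptions (A1), (A2), (A3) and (A4) hold. Then for all sufficiently large $n$, $$\max_{\mathcal{A}\in\mathcal{U}_0}\mathrm{RSS}(\mathcal{A})<\min_{\mathcal{A}_1\in\mathcal{U}_1}\mathrm{RSS}(\mathcal{A}_1).$$
   Context: Setting. $n=1,2,\ldots$ indexes a sequence of problems. For each $n$ we are given integers $p=p_n$, $p_0$, $M$ with $1\le p_0\le M$ and $p_0<p$; a continuous function $f_n:[0,1]^p\to\mathbb{R}$; design points $\mathbf{x}_i=(x_{i1},\ldots,x_{ip})'\in[0,1)^p$, $i=1,\ldots,n$; and responses $y_i=f_n(\mathbf{x}_i)$. Let $\mathbf{X}$ be the $n\times p$ matrix with rows $\mathbf{x}_i'$, $\mathbf{y}=(y_1,\ldots,y_n)'$, $\mathbf{1}_n$ the $n$-vector of ones, $\|\cdot\|$ the Euclidean norm. Let $Z_d=\{1,\ldots,d\}$ and $\mathcal{A}_0=Z_{p_0}$. For $\mathcal{A}\subset Z_p$, $\mathbf{x}_{\mathcal{A}}$ is the subvector of $\mathbf{x}\in[0,1]^p$ with coordinates in $\mathcal{A}$, and $\mathbf{X}_{\mathcal{A}}$ is the submatrix of $\mathbf{X}$ with columns in $\mathcal{A}$. Subset best linear approximation: for $\mathcal{A}\subset Z_p$, $(\beta_0(\mathcal{A}),\boldsymbol{\beta}(\mathcal{A})')'\in\mathbb{R}\times\mathbb{R}^{|\mathcal{A}|}$ is the minimizer over $(\phi_0,\boldsymbol{\phi})$ of $\int_{[0,1]^p}[f_n(\mathbf{x})-\phi_0-\boldsymbol{\phi}'\mathbf{x}_{\mathcal{A}}]^2d\mathbf{x}$,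 and $\boldsymbol{\beta}_{Z_p}(\mathcal{A})\in\mathbb{R}^p$ is the vector whose coordinates indexed by $\mathcal{A}$ equal $\boldsymbol{\beta}(\mathcal{A})$ and whose other coordinates are $0$. Residual sum of squares: $\mathrm{RSS}(\mathcal{A})=\min_{b_0\in\mathbb{R},\mathbf{b}\in\mathbb{R}^{|\mathcal{A}|}}\|\mathbf{y}-\mathbf{1}_nb_0-\mathbf{X}_{\mathcal{A}}\mathbf{b}\|^2$, i.e. $\|\mathbf{y}-\mathbf{1}_n\widehat\beta_0(\mathcal{A})-\mathbf{X}\widehat{\boldsymbol{\beta}}_{Z_p}(\mathcal{A})\|^2$ for the least-squares estimates $(\widehat\beta_0(\mathcal{A}),\widehat{\boldsymbol\beta}(\mathcal{A})')'=\begin{pmatrix}n&\mathbf{1}_n'\mathbf{X}_{\mathcal{A}}\\ \mathbf{X}_{\mathcal{A}}'\mathbf{1}_n&\mathbf{X}_{\mathcal{A}}'\mathbf{X}_{\mathcal{A}}\end{pmatrix}^{-1}\begin{pmatrix}\mathbf{1}_n'\mathbf{y}\\ \mathbf{X}_{\mathcal{A}}'\mathbf{y}\end{pmatrix}$ (expanded to $\widehat{\boldsymbol\beta}_{Z_p}(\mathcal{A})\in\mathbb{R}^p$ by zeros). Hardy–Krause variation: for $g:[0,1]^d\to\mathbb{R}$ and a closed axis-parallel rectangle $J\subset[0,1]^d$, $\Delta_J(g)$ is the sum of the values of $g$ at the $2^d$ vertices of $J$ with alternating signs at nearest-neighbour vertices; the Vitali variation $V^{Vit}(g)$ is the supremum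 of $\sum_{J\in\Pi}|\Delta_J(g)|$ over all partitions $\Pi$ of $[0,1]^d$ into finitely many non-overlapping axis-parallel sub-rectangles; $V_{HK}(g)=\sum_{\emptyset\ne u\subset Z_d}V^{Vit}(g_u)$, where $g_u$ is the function of $\mathbf{x}_u\in[0,1]^{|u|}$ obtained from $g$ by setting $x_k=1$ for $k\notin u$. $g$ is BVHK if $V_{HK}(g)<\infty$. Functions depending only on some coordinates of $\mathbf{x}\in[0,1]^p$ are regarded as functions on $[0,1]^p$. Discrepancy: for an $m\times d$ matrix $\mathbf{A}$ with rows $\mathbf{a}_1',\ldots,\mathbf{a}_m'$, $\mathbf{a}_i\in[0,1]^d$, $\delta_{d,m}(\mathbf{A})=\sup_{\mathbf{x}\in[0,1]^d}|F_m(\mathbf{x})-\prod_{k=1}^dx_k|$, where $F_m(\mathbf{x})=\frac1m\#\{i:a_{ik}\le x_k\ \forall k\}$ is the empirical distribution function. Sets: $\mathcal{U}_0=\{\mathcal{A}\subset Z_p:|\mathcal{A}|=M,\mathcal{A}_0\subset\mathcal{A}\}$; $\mathcal{U}_1=\{\mathcal{A}\subset Z_p:|\mathcal{A}|=M,\mathcal{A}_0\setminus\mathcal{A}\ne\emptyset\}$; $\mathcal{U}_2=\{\mathcal{A}\subset Z_p:|\mathcal{A}|=2\}$; $\mathcal{U}_3=\{\mathcal{A}_0\cup I_1: I_1\subset Z_p\setminus\mathcal{A}_0,|I_1|=1\}$; $\mathcal{U}_4=\{\mathcal{A}_0\cup I_2: I_2\subset Z_p\setminus\mathcal{A}_0,|I_2|=M-1\}$.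 $\Delta_{p_0,n}=\delta_{p_0,n}(\mathbf{X}_{\mathcal{A}_0})$, $\Delta_{2,n}=\max_{\mathcal{A}\in\mathcal{U}_2}\delta_{2,n}(\mathbf{X}_{\mathcal{A}})$, $\Delta_{p_0+1,n}=\max_{\mathcal{A}\in\mathcal{U}_3}\delta_{p_0+1,n}(\mathbf{X}_{\mathcal{A}})$, $\Delta_{p_0+M-1,n}=\max_{\mathcal{A}\in\mathcal{U}_4}\delta_{p_0+M-1,n}(\mathbf{X}_{\mathcal{A}})$. (A1): there exist $\widetilde f_n\in C[0,1]^{p_0}$ and $\eta_n>0$ with $\sup_{\mathbf{x}\in[0,1]^p}|f_n(\mathbf{x})-\widetilde f_n(x_1,\ldots,x_{p_0})|<\eta_n$, and a positive constant $\tau$ (independent of $n$) with $|\int_{[0,1]^p}x_jf_n(\mathbf{x})d\mathbf{x}-\frac12\int_{[0,1]^p}f_n(\mathbf{x})d\mathbf{x}|>\tau$ for each $j=1,\ldots,p_0$. (A2): for each $n$, $\widetilde f_n$ is BVHK. Constants: $C_{1n}=\max_{j=1,\ldots,p}\max(V_{HK}(\widetilde f_n),V_{HK}(x_j\widetilde f_n))$; $C_{2n}=\max_{\mathbf{x}\in[0,1]^p}|f_n(\mathbf{x})|$; $C_{3n}=\max_{\mathbf{x}\in[0,1]^p}|\widetilde f_n(\mathbf{x}_{\mathcal{A}_0})-\mathbf{x}'\boldsymbol\beta_{Z_p}(\mathcal{A}_0)-\beta_0(\mathcal{A}_0)|$; $C_{4n}=\max_{\mathcal{A}\in\mathcal{U}_1}\max_{\mathbf{x}\in[0,1]^p}|\widetilde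 f_n(\mathbf{x}_{\mathcal{A}_0})-\mathbf{x}'\boldsymbol\beta_{Z_p}(\mathcal{A})-\beta_0(\mathcal{A})|$; $V_{1n}=V_{HK}(\widetilde f_n(\mathbf{x}_{\mathcal{A}_0})-\beta_0(\mathcal{A}_0)-\mathbf{x}'\boldsymbol\beta_{Z_p}(\mathcal{A}_0))$; $V_{2n}=\max_{\mathcal{A}\in\mathcal{U}_1}V_{HK}(\widetilde f_n(\mathbf{x}_{\mathcal{A}_0})-\beta_0(\mathcal{A})-\mathbf{x}'\boldsymbol\beta_{Z_p}(\mathcal{A}))$. (A3): there is a constant $\alpha\in(0,1)$ with $3(M+1)^2(9M+1)\Delta_{2,n}<\alpha$ for all sufficiently large $n$. With this $\alpha$: $\zeta_{1n}=C_{1n}(p_0+1)^2(9p_0+1)\Delta_{p_0,n}+2(p_0+1)^2(9p_0+1)\eta_n+\frac{3}{1-\alpha}C_{2n}(p_0+1)^4(9p_0+1)^2\Delta_{2,n}$; $\zeta_{2n}=C_{1n}(M+1)^2(9M+1)\Delta_{p_0+1,n}+2(M+1)^2(9M+1)\eta_n+\frac{3}{1-\alpha}C_{2n}(M+1)^4(9M+1)^2\Delta_{2,n}$; $\rho_{1n}=\zeta_{1n}^2+2(C_{3n}+\eta_n)\zeta_{1n}+2(p_0+1)^{-1/2}\zeta_{1n}^2$; $\rho_{2n}=\zeta_{2n}^2+2(C_{4n}+\eta_n)\zeta_{2n}+2(M+1)^{-1/2}\zeta_{2n}^2$. (A4): there is a constant $D>0$ such that for all sufficiently large $n$, $12\tau^2-12(M-p_0+1)\eta_n^2-4\eta_n^2-4\eta_n(C_{4n}+C_{3n})-\Delta_{p_0,n}V_{1n}-\Delta_{p_0+M-1,n}V_{2n}-\rho_{1n}-\rho_{2n}>D$.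 *)

theory Defs
  imports "HOL-Analysis.Analysis"
begin

text \<open>Conventions. Points of the cube [0,1]^P are extensional functions
  nat => real on the index set Z_P = {1..P} (value undefined elsewhere),
  i.e. elements of PiE {1..P} (%_. {0..1}). A design is a function
  X i j (row i in {1..n}, column j in {1..P}).\<close>

definition cube :: "nat \<Rightarrow> (nat \<Rightarrow> real) set" where
  "cube P = PiE {1..P} (\<lambda>_. {0..1})"

definition cubeM :: "nat \<Rightarrow> (nat \<Rightarrow> real) measure" where
  "cubeM P = PiM {1..P} (\<lambda>_. restrict_space lborel {0..1})"

definition cube_int :: "nat \<Rightarrow> ((nat \<Rightarrow> real) \<Rightarrow> real) \<Rightarrow> real" where
  "cube_int P g = integral\<^sup>L (cubeM P) g"

definition sq_err :: "nat \<Rightarrow> ((nat \<Rightarrow> real) \<Rightarrow> real) \<Rightarrow> nat set \<Rightarrow> real \<Rightarrow> (nat \<Rightarrow> real) \<Rightarrow> real" where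
  "sq_err P g A c \<phi> = cube_int P (\<lambda>x. (g x - c - (\<Sum>j\<in>A. \<phi> j * x j))\<^sup>2)"

definition is_blin :: "nat \<Rightarrow> ((nat \<Rightarrow> real) \<Rightarrow> real) \<Rightarrow> nat set \<Rightarrow> real \<Rightarrow> (nat \<Rightarrow> real) \<Rightarrow> bool" where
  "is_blin P g A c \<phi> \<longleftrightarrow> (\<forall>k. k \<notin> A \<longrightarrow> \<phi> k = 0) \<and>
     (\<forall>c' \<phi>'. (\<forall>k. k \<notin> A \<longrightarrow> \<phi>' k = 0) \<longrightarrow> sq_err P g A c \<phi> \<le> sq_err P g A c' \<phi>')"

text \<open>(beta_0(A), beta_{Z_p}(A)): the (unique) minimiser, beta extended by zeros.\<close>
definition blin :: "nat \<Rightarrow> ((nat \<Rightarrow> real) \<Rightarrow> real) \<Rightarrow> nat set \<Rightarrow> real \<times> (nat \<Rightarrow> real)" where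
  "blin P g A = (THE cp. is_blin P g A (fst cp) (snd cp))"

definition beta0 :: "nat \<Rightarrow> ((nat \<Rightarrow> real) \<Rightarrow> real) \<Rightarrow> nat set \<Rightarrow> real" where
  "beta0 P g A = fst (blin P g A)"

definition betaZ :: "nat \<Rightarrow> ((nat \<Rightarrow> real) \<Rightarrow> real) \<Rightarrow> nat set \<Rightarrow> nat \<Rightarrow> real" where
  "betaZ P g A = snd (blin P g A)"

definition RSS :: "nat \<Rightarrow> nat \<Rightarrow> (nat \<Rightarrow> nat \<Rightarrow> real) \<Rightarrow> ((nat \<Rightarrow> real) \<Rightarrow> real) \<Rightarrow> nat set \<Rightarrow> real" where
  "RSS n P X g A = Inf {(\<Sum>i=1..n. (g (restrict (X i) {1..P}) - b0 - (\<Sum>j\<in>A. b j * X i j))\<^sup>2) | b0 b. True}"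

definition delta_box :: "nat set \<Rightarrow> nat set \<Rightarrow> ((nat \<Rightarrow> real) \<Rightarrow> real) \<Rightarrow> (nat \<Rightarrow> real) \<Rightarrow> (nat \<Rightarrow> real) \<Rightarrow> real" where
  "delta_box I u g a b = (\<Sum>S\<in>Pow u. (-1) ^ card (u - S) *
      g (\<lambda>k. if k \<in> S then b k else if k \<in> u then a k else if k \<in> I then 1 else undefined))"

definition is_rect_partition :: "nat set \<Rightarrow> ((nat \<Rightarrow> real) \<times> (nat \<Rightarrow> real)) set \<Rightarrow> bool" where
  "is_rect_partition u Q \<longleftrightarrow> finite Q \<and>
     (\<forall>(a,b)\<in>Q. \<forall>k\<in>u. 0 \<le> a k \<and> a k \<le> b k \<and> b k \<le> 1) \<and>
     (\<forall>x. (\<forall>k\<in>u. 0 \<le> x k \<and> x k \<le> 1) \<longrightarrow> (\<exists>(a,b)\<in>Q. \<forall>k\<in>u. a k \<le> x k \<and> x k \<le> b k)) \<and>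
     (\<forall>(a,b)\<in>Q. \<forall>(a',b')\<in>Q. (a,b) \<noteq> (a',b') \<longrightarrow>
        \<not> (\<exists>x. \<forall>k\<in>u. max (a k) (a' k) < x k \<and> x k < min (b k) (b' k)))"

definition vitali :: "nat set \<Rightarrow> nat set \<Rightarrow> ((nat \<Rightarrow> real) \<Rightarrow> real) \<Rightarrow> ereal" where
  "vitali I u g = (SUP Q\<in>{Q. is_rect_partition u Q}. ereal (\<Sum>(a,b)\<in>Q. \<bar>delta_box I u g a b\<bar>))"

definition VHK :: "nat set \<Rightarrow> ((nat \<Rightarrow> real) \<Rightarrow> real) \<Rightarrow> ereal" where
  "VHK I g = (\<Sum>u\<in>{u. u \<subseteq> I \<and> u \<noteq> {}}. vitali I u g)"

definition BVHK :: "nat set \<Rightarrow> ((nat \<Rightarrow> real) \<Rightarrow> real) \<Rightarrow> bool" where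
  "BVHK I g \<longleftrightarrow> VHK I g < \<infinity>"

definition disc :: "nat \<Rightarrow> (nat \<Rightarrow> nat \<Rightarrow> real) \<Rightarrow> nat set \<Rightarrow> real" where
  "disc m X A = (SUP x\<in>{x. \<forall>k\<in>A. 0 \<le> x k \<and> x k \<le> 1}.
      \<bar>real (card {i\<in>{1..m}. \<forall>k\<in>A. X i k \<le> x k}) / real m - (\<Prod>k\<in>A. x k)\<bar>)"

definition U0 :: "nat \<Rightarrow> nat \<Rightarrow> nat \<Rightarrow> nat set set" where
  "U0 p0 M P = {A. A \<subseteq> {1..P} \<and> card A = M \<and> {1..p0} \<subseteq> A}"
definition U1 :: "nat \<Rightarrow> nat \<Rightarrow> nat \<Rightarrow> nat set set" where
  "U1 p0 M P = {A. A \<subseteq> {1..P} \<and> card A = M \<and> {1..p0} - A \<noteq> {}}"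
definition U2 :: "nat \<Rightarrow> nat set set" where
  "U2 P = {A. A \<subseteq> {1..P} \<and> card A = 2}"
definition U3 :: "nat \<Rightarrow> nat \<Rightarrow> nat set set" where
  "U3 p0 P = {{1..p0} \<union> I1 | I1. I1 \<subseteq> {1..P} - {1..p0} \<and> card I1 = 1}"
definition U4 :: "nat \<Rightarrow> nat \<Rightarrow> nat \<Rightarrow> nat set set" where
  "U4 p0 M P = {{1..p0} \<union> I2 | I2. I2 \<subseteq> {1..P} - {1..p0} \<and> card I2 = M - 1}"

text \<open>Maximum of a finite set of nonnegative reals (0 for the empty set).\<close>
definition maxz :: "real set \<Rightarrow> real" where
  "maxz S = Max (insert 0 S)"

definition Dp0 :: "nat \<Rightarrow> nat \<Rightarrow> (nat \<Rightarrow> nat \<Rightarrow> real) \<Rightarrow> real" where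
  "Dp0 p0 n X = disc n X {1..p0}"
definition D2 :: "nat \<Rightarrow> nat \<Rightarrow> (nat \<Rightarrow> nat \<Rightarrow> real) \<Rightarrow> real" where
  "D2 P n X = maxz ((\<lambda>A. disc n X A) ` U2 P)"
definition Dp01 :: "nat \<Rightarrow> nat \<Rightarrow> nat \<Rightarrow> (nat \<Rightarrow> nat \<Rightarrow> real) \<Rightarrow> real" where
  "Dp01 p0 P n X = maxz ((\<lambda>A. disc n X A) ` U3 p0 P)"
definition Dp0M :: "nat \<Rightarrow> nat \<Rightarrow> nat \<Rightarrow> nat \<Rightarrow> (nat \<Rightarrow> nat \<Rightarrow> real) \<Rightarrow> real" where
  "Dp0M p0 M P n X = maxz ((\<lambda>A. disc n X A) ` U4 p0 M P)"

text \<open>ft is the function tilde f_n of x_1..x_{p0}; as a function on [0,1]^P it is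
  x |-> ft (restrict x {1..p0}).\<close>
definition C1 :: "nat \<Rightarrow> nat \<Rightarrow> ((nat \<Rightarrow> real) \<Rightarrow> real) \<Rightarrow> real" where
  "C1 p0 P ft = Max ((\<lambda>j. max (real_of_ereal (VHK {1..P} (\<lambda>x. ft (restrict x {1..p0}))))
                              (real_of_ereal (VHK {1..P} (\<lambda>x. x j * ft (restrict x {1..p0}))))) ` {1..P})"
definition C2 :: "nat \<Rightarrow> ((nat \<Rightarrow> real) \<Rightarrow> real) \<Rightarrow> real" where
  "C2 P f = (SUP x\<in>cube P. \<bar>f x\<bar>)"

definition lin_res :: "nat \<Rightarrow> nat \<Rightarrow> ((nat \<Rightarrow> real) \<Rightarrow> real) \<Rightarrow> ((nat \<Rightarrow> real) \<Rightarrow> real) \<Rightarrow> nat set \<Rightarrow> (nat \<Rightarrow> real) \<Rightarrow> real" where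
  "lin_res p0 P f ft A x = ft (restrict x {1..p0}) - (\<Sum>j\<in>{1..P}. x j * betaZ P f A j) - beta0 P f A"

definition C3 :: "nat \<Rightarrow> nat \<Rightarrow> ((nat \<Rightarrow> real) \<Rightarrow> real) \<Rightarrow> ((nat \<Rightarrow> real) \<Rightarrow> real) \<Rightarrow> real" where
  "C3 p0 P f ft = (SUP x\<in>cube P. \<bar>lin_res p0 P f ft {1..p0} x\<bar>)"
definition C4 :: "nat \<Rightarrow> nat \<Rightarrow> nat \<Rightarrow> ((nat \<Rightarrow> real) \<Rightarrow> real) \<Rightarrow> ((nat \<Rightarrow> real) \<Rightarrow> real) \<Rightarrow> real" where
  "C4 p0 M P f ft = maxz ((\<lambda>A. SUP x\<in>cube P. \<bar>lin_res p0 P f ft A x\<bar>) ` U1 p0 M P)"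
definition V1 :: "nat \<Rightarrow> nat \<Rightarrow> ((nat \<Rightarrow> real) \<Rightarrow> real) \<Rightarrow> ((nat \<Rightarrow> real) \<Rightarrow> real) \<Rightarrow> real" where
  "V1 p0 P f ft = real_of_ereal (VHK {1..P} (lin_res p0 P f ft {1..p0}))"
definition V2 :: "nat \<Rightarrow> nat \<Rightarrow> nat \<Rightarrow> ((nat \<Rightarrow> real) \<Rightarrow> real) \<Rightarrow> ((nat \<Rightarrow> real) \<Rightarrow> real) \<Rightarrow> real" where
  "V2 p0 M P f ft = maxz ((\<lambda>A. real_of_ereal (VHK {1..P} (lin_res p0 P f ft A))) ` U1 p0 M P)"

text \<open>zeta with d = p0 (zeta_1) or d = M (zeta_2); Dd the corresponding discrepancy.\<close>
definition zeta :: "nat \<Rightarrow> real \<Rightarrow> real \<Rightarrow> real \<Rightarrow> real \<Rightarrow> real \<Rightarrow> real \<Rightarrow> real" where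
  "zeta d c1 eta c2 alpha Dd Dtwo =
     c1 * (real d + 1)^2 * (9 * real d + 1) * Dd + 2 * (real d + 1)^2 * (9 * real d + 1) * eta
     + 3 / (1 - alpha) * c2 * (real d + 1)^4 * (9 * real d + 1)^2 * Dtwo"

definition rho :: "nat \<Rightarrow> real \<Rightarrow> real \<Rightarrow> real \<Rightarrow> real" where
  "rho d c z eta = z^2 + 2 * (c + eta) * z + 2 * (1 / sqrt (real d + 1)) * z^2"

end

theory Submission
  imports Defs "HOL-Probability.Probability_Measure"
begin

text \<open>
  Write \<open>c\<^sub>j\<close> for the integral of \<open>f(x) (x\<^sub>j - 1/2)\<close> over the cube. The centred coordinates
  \<open>x\<^sub>j - 1/2\<close> are orthogonal with squared norm \<open>1/12\<close>, so the best linear approximation on \<open>A\<close>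
  has slopes \<open>12 c\<^sub>j\<close> for \<open>j \<in> A\<close>. For the residuals \<open>g\<^sub>0\<close>, \<open>g\<^sub>1\<close> of the approximations on
  \<open>A\<^sub>0\<close> and \<open>A\<^sub>1\<close> the difference \<open>w = g\<^sub>1 - g\<^sub>0\<close> is linear, and \<open>g\<^sub>1\<^sup>2 - g\<^sub>0\<^sup>2 = w (2 g\<^sub>1 - w)\<close>.
  Hence comparing empirical with exact integrals only involves products of \<open>f\<close> with polynomials of
  degree one and quadratic polynomials: the Koksma--Hlawka inequality is never applied to a squared
  residual, whose variation is not controlled by the hypotheses.
  A product \<open>x\<^sub>j h(x)\<close> is handled by writing \<open>x\<^sub>j\<close> as one minus an average of the
  indicators of \<open>x\<^sub>j \<le> s\<close>, since such an indicator times an anchored box is again an anchored box;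
  so the variation of \<open>h\<close> suffices and that of \<open>x\<^sub>j h(x)\<close>, which \<open>C1\<close> would send to 0
  if it were infinite, is never used. The loss in replacing \<open>g\<^sub>1\<close> by its least-squares
  residual on the design is quadratic in the errors of the first moments.
\<close>

section \<open>Integration over the cube\<close>

text \<open>Both families are measured against one number, \<open>n\<close> times the empirical mean
  square of \<open>g\<^sub>0\<close>. On a superset of \<open>A\<^sub>0\<close> the function
  \<open>g\<^sub>0\<close> is the residual of an admissible competitor, which gives the upper bound.
  For \<open>A\<^sub>1\<close> the exact gap is 12 times the following difference: the sum of
  \<open>c\<^sub>j\<close> squared over \<open>A\<^sub>0 - A\<^sub>1\<close> minus that over
  \<open>A\<^sub>1 - A\<^sub>0\<close>. Terms of the first sum exceed \<open>tau\<close> squared by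
  (A1). In the second, the approximating function does not depend on the coordinate, so
  \<open>c\<^sub>j\<close> is at most \<open>eta / 2\<close> in absolute value. The second set has
  \<open>M - p0\<close> more elements than the first, and (A4) itself forces
  \<open>eta \<le> tau\<close>, so the worst case is a single missed coordinate. The remaining
  obstacle is to fit the errors into the prescribed \<open>rho\<close>, where first-order errors
  carry the factor \<open>C4 + eta\<close>. Hence the slopes of \<open>w\<close> are bounded both
  through the supremum of \<open>g\<^sub>1\<close> and through that of \<open>f\<close>. Moreover
  bounded variation is assumed of the approximating function only: its distance to \<open>f\<close>
  is carried along in the supremum norm.\<close>

abbreviation unitM :: "real measure" where
  "unitM \<equiv> restrict_space lborel {0..1}"

lemma space_cubeM: "space (cubeM P) = cube P"
  by (simp add: cubeM_def cube_def space_PiM space_restrict_space)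

lemma prob_space_unitM: "prob_space unitM"
  by (rule prob_spaceI) (simp add: space_restrict_space emeasure_restrict_space)

lemma product_sigma_finite_unitM: "product_sigma_finite (\<lambda>_::nat. unitM)"
  by (simp add: product_sigma_finite_def prob_space.axioms(1)[THEN finite_measure.axioms(1)] prob_space_unitM)

lemma prob_space_cubeM: "prob_space (cubeM P)"
proof -
  interpret product_prob_space "\<lambda>_::nat. unitM"
    by (rule product_prob_spaceI) (rule prob_space_unitM)
  interpret finite_product_prob_space "\<lambda>_::nat. unitM" "{1..P}"
    by unfold_locales auto
  show ?thesis unfolding cubeM_def by (rule prob_space_axioms)
qed

lemma integrable_unitM:
  fixes g :: "real \<Rightarrow> real"
  assumes "g \<in> borel_measurable borel" "\<And>x. x \<in> {0..1} \<Longrightarrow> \<bar>g x\<bar> \<le> B"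
  shows "integrable unitM g"
proof -
  interpret prob_space unitM by (rule prob_space_unitM)
  show ?thesis
    by (rule integrable_const_bound[of _ B])
      (use assms in \<open>auto intro!: AE_I2 measurable_restrict_space1 simp: space_restrict_space\<close>)
qed

lemma integral_unitM_power: "integral\<^sup>L unitM (\<lambda>x. x ^ k) = 1 / real (Suc k)"
proof -
  have "integral\<^sup>L unitM (\<lambda>x. x ^ k) = (LINT x:{0..1}|lborel. x ^ k)"
    by (subst integral_restrict_space) (auto simp: set_lebesgue_integral_def)
  also have "\<dots> = 1 / real (Suc k)"
    using integral_power[of 0 1 k] by (simp add: set_lebesgue_integral_def mult.commute)
  finally show ?thesis .
qed

lemma measure_unitM [simp]: "Sigma_Algebra.measure unitM {0..1} = 1"
  by (simp add: measure_restrict_space)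

lemma integral_unitM_const [simp]: "integral\<^sup>L unitM (\<lambda>x. c) = (c::real)"
  by (simp add: space_restrict_space)

lemma integrable_unitM_const [simp]: "integrable unitM (\<lambda>x. c::real)"
  by (rule integrable_unitM[of _ "\<bar>c\<bar>"]) auto

lemma integral_unitM_le:
  assumes "0 \<le> t" "t \<le> 1"
  shows "integral\<^sup>L unitM (\<lambda>x. of_bool (x \<le> t)) = t"
proof -
  have "integral\<^sup>L unitM (\<lambda>x. of_bool (x \<le> t)) = (LINT x:{0..1}|lborel. (of_bool (x \<le> t) :: real))"
    by (subst integral_restrict_space) (simp_all add: set_lebesgue_integral_def)
  also have "\<dots> = integral\<^sup>L lborel (indicator {0..t})"
    unfolding set_lebesgue_integral_def
    by (rule Bochner_Integration.integral_cong) (use assms in \<open>auto simp: indicator_def\<close>)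
  also have "\<dots> = t" using assms by simp
  finally show ?thesis .
qed

lemma cube_int_prod:
  fixes g :: "nat \<Rightarrow> real \<Rightarrow> real"
  assumes "\<And>j. j \<in> {1..P} \<Longrightarrow> integrable unitM (g j)"
  shows "cube_int P (\<lambda>x. \<Prod>j\<in>{1..P}. g j (x j)) = (\<Prod>j\<in>{1..P}. integral\<^sup>L unitM (g j))"
  unfolding cube_int_def cubeM_def
  by (rule product_sigma_finite.product_integral_prod[OF product_sigma_finite_unitM]) (use assms in auto)

text \<open>Integrable functions are not closed under products. Adding boundedness gives an algebra
  on which the probability measure \<open>cubeM P\<close> is always defined, so integrability
  conditions reduce to closure rules.\<close>

definition bmf :: "nat \<Rightarrow> ((nat \<Rightarrow> real) \<Rightarrow> real) set" where
  "bmf P = {g \<in> borel_measurable (cubeM P). \<exists>B. \<forall>x\<in>cube P. \<bar>g x\<bar> \<le> B}"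

lemma bmfI:
  "g \<in> borel_measurable (cubeM P) \<Longrightarrow> (\<And>x. x \<in> cube P \<Longrightarrow> \<bar>g x\<bar> \<le> B) \<Longrightarrow> g \<in> bmf P"
  by (auto simp: bmf_def)

lemma bmf_measurable: "g \<in> bmf P \<Longrightarrow> g \<in> borel_measurable (cubeM P)"
  by (simp add: bmf_def)

lemma bmf_bounded:
  assumes "g \<in> bmf P"
  obtains B where "B \<ge> 0" "\<And>x. x \<in> cube P \<Longrightarrow> \<bar>g x\<bar> \<le> B"
proof -
  obtain B where "\<And>x. x \<in> cube P \<Longrightarrow> \<bar>g x\<bar> \<le> B" using assms by (auto simp: bmf_def)
  then have "\<And>x. x \<in> cube P \<Longrightarrow> \<bar>g x\<bar> \<le> max B 0" by (simp add: le_max_iff_disj)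
  then show thesis by (metis that max.cobounded2)
qed

lemma bmf_integrable:
  assumes "g \<in> bmf P" shows "integrable (cubeM P) g"
proof -
  interpret prob_space "cubeM P" by (rule prob_space_cubeM)
  obtain B where "\<And>x. x \<in> cube P \<Longrightarrow> \<bar>g x\<bar> \<le> B" using bmf_bounded[OF assms] by metis
  then show ?thesis
    by (intro integrable_const_bound[of _ B])
      (auto intro!: AE_I2 bmf_measurable[OF assms] simp: space_cubeM)
qed

lemma bmf_const [simp]: "(\<lambda>x. c) \<in> bmf P"
  by (rule bmfI[of _ _ "\<bar>c\<bar>"]) auto

lemma coord_measurable:
  assumes "j \<in> {1..P}" shows "(\<lambda>x. x j) \<in> borel_measurable (cubeM P)"
proof -
  have "(\<lambda>x. x j) \<in> measurable (cubeM P) unitM"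
    unfolding cubeM_def using assms by (rule measurable_component_singleton)
  then have "(\<lambda>x. x) \<circ> (\<lambda>x. x j) \<in> borel_measurable (cubeM P)"
    by (rule measurable_comp) (auto intro: measurable_restrict_space1)
  then show ?thesis by (simp add: comp_def)
qed

lemma cubeD: "x \<in> cube P \<Longrightarrow> j \<in> {1..P} \<Longrightarrow> 0 \<le> x j \<and> x j \<le> 1"
  by (auto simp: cube_def PiE_iff)

lemma bmf_coord [simp]: "j \<in> {1..P} \<Longrightarrow> (\<lambda>x. x j) \<in> bmf P"
  by (rule bmfI[of _ _ 1]) (use cubeD in \<open>auto intro: coord_measurable\<close>)

lemma bmf_of_bool [simp]: "j \<in> {1..P} \<Longrightarrow> (\<lambda>x. of_bool (x j \<le> t)) \<in> bmf P"
  by (rule bmfI[of _ _ 1]) (use coord_measurable[of j P] in measurable)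

lemma bmf_add [simp]: "g \<in> bmf P \<Longrightarrow> h \<in> bmf P \<Longrightarrow> (\<lambda>x. g x + h x) \<in> bmf P"
  by (auto simp: bmf_def intro!: borel_measurable_add)
     (metis abs_triangle_ineq add_mono order_trans)

lemma bmf_mult [simp]:
  assumes "g \<in> bmf P" "h \<in> bmf P" shows "(\<lambda>x. g x * h x) \<in> bmf P"
proof -
  obtain B C where B: "B \<ge> 0" "\<And>x. x \<in> cube P \<Longrightarrow> \<bar>g x\<bar> \<le> B" "\<And>x. x \<in> cube P \<Longrightarrow> \<bar>h x\<bar> \<le> C"
    using assms bmf_bounded by metis
  show ?thesis
  proof (rule bmfI[of _ _ "B * C"])
    show "(\<lambda>x. g x * h x) \<in> borel_measurable (cubeM P)"
      using assms by (intro borel_measurable_times bmf_measurable)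
    show "\<bar>g x * h x\<bar> \<le> B * C" if "x \<in> cube P" for x
      using that B by (auto simp: abs_mult intro!: mult_mono)
  qed
qed

lemma bmf_cmult: "g \<in> bmf P \<Longrightarrow> (\<lambda>x. c * g x) \<in> bmf P"
  by simp

lemma bmf_diff [simp]: "g \<in> bmf P \<Longrightarrow> h \<in> bmf P \<Longrightarrow> (\<lambda>x. g x - h x) \<in> bmf P"
  using bmf_add[OF _ bmf_cmult[of h P "-1"], of g] by simp

lemma bmf_power [simp]: "g \<in> bmf P \<Longrightarrow> (\<lambda>x. (g x)\<^sup>2) \<in> bmf P"
  by (simp add: power2_eq_square)

lemma bmf_sum [simp]:
  "(\<And>i. i \<in> A \<Longrightarrow> g i \<in> bmf P) \<Longrightarrow> (\<lambda>x. \<Sum>i\<in>A. g i x) \<in> bmf P"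
  by (induction A rule: infinite_finite_induct) auto

lemma bmf_prod [simp]:
  "(\<And>i. i \<in> A \<Longrightarrow> g i \<in> bmf P) \<Longrightarrow> (\<lambda>x. \<Prod>i\<in>A. g i x) \<in> bmf P"
  by (induction A rule: infinite_finite_induct) auto

lemma cube_int_const [simp]: "cube_int P (\<lambda>x. c) = c"
proof -
  interpret prob_space "cubeM P" by (rule prob_space_cubeM)
  show ?thesis by (simp add: cube_int_def prob_space)
qed

lemma cube_int_add:
  "g \<in> bmf P \<Longrightarrow> h \<in> bmf P \<Longrightarrow> cube_int P (\<lambda>x. g x + h x) = cube_int P g + cube_int P h"
  by (simp add: cube_int_def bmf_integrable)

lemma cube_int_diff:
  "g \<in> bmf P \<Longrightarrow> h \<in> bmf P \<Longrightarrow> cube_int P (\<lambda>x. g x - h x) = cube_int P g - cube_int P h"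
  by (simp add: cube_int_def bmf_integrable)

lemma cube_int_cmult: "cube_int P (\<lambda>x. c * g x) = c * cube_int P g"
  by (simp add: cube_int_def)

lemma cube_int_sum:
  "(\<And>i. i \<in> A \<Longrightarrow> g i \<in> bmf P) \<Longrightarrow>
    cube_int P (\<lambda>x. \<Sum>i\<in>A. g i x) = (\<Sum>i\<in>A. cube_int P (g i))"
  by (simp add: cube_int_def bmf_integrable Bochner_Integration.integral_sum)

lemma cube_int_mono:
  "g \<in> bmf P \<Longrightarrow> h \<in> bmf P \<Longrightarrow> (\<And>x. x \<in> cube P \<Longrightarrow> g x \<le> h x) \<Longrightarrow> cube_int P g \<le> cube_int P h"
  unfolding cube_int_def by (rule integral_mono) (auto simp: bmf_integrable space_cubeM)

lemma cube_int_cong: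
  "(\<And>x. x \<in> cube P \<Longrightarrow> g x = h x) \<Longrightarrow> cube_int P g = cube_int P h"
  unfolding cube_int_def by (rule Bochner_Integration.integral_cong) (auto simp: space_cubeM)

lemma cube_int_abs_le:
  assumes "g \<in> bmf P" "\<And>x. x \<in> cube P \<Longrightarrow> \<bar>g x\<bar> \<le> B"
  shows "\<bar>cube_int P g\<bar> \<le> B"
proof -
  have "cube_int P g \<le> cube_int P (\<lambda>x. B)" "cube_int P (\<lambda>x. - B) \<le> cube_int P g"
    by (rule cube_int_mono; use assms in \<open>force simp: abs_le_iff\<close>)+
  then show ?thesis by (simp add: abs_le_iff)
qed

lemma bmf_cong:
  assumes "g \<in> bmf P" "\<And>x. x \<in> cube P \<Longrightarrow> g x = h x" shows "h \<in> bmf P"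
proof -
  have "h \<in> borel_measurable (cubeM P)"
    using bmf_measurable[OF assms(1)] assms(2) by (subst measurable_cong[of _ _ g]) (auto simp: space_cubeM)
  then show ?thesis using assms by (auto simp: bmf_def)
qed

section \<open>Integrals of boxes and of products of centred coordinates\<close>

lemma cube_int_box:
  assumes "A \<subseteq> {1..P}" "\<And>k. k \<in> A \<Longrightarrow> 0 \<le> t k \<and> t k \<le> 1"
  shows "cube_int P (\<lambda>x. of_bool (\<forall>k\<in>A. x k \<le> t k)) = (\<Prod>k\<in>A. t k)"
proof -
  have fin: "finite A" using assms(1) finite_subset by blast
  have eq: "(of_bool (\<forall>k\<in>A. x k \<le> t k) :: real) =
      (\<Prod>k\<in>{1..P}. (if k \<in> A then of_bool (x k \<le> t k) else 1))" for x :: "nat \<Rightarrow> real"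
  proof -
    have "(\<Prod>k\<in>{1..P}. (if k \<in> A then of_bool (x k \<le> t k) else 1)) = (\<Prod>k\<in>A. (of_bool (x k \<le> t k)::real))"
      using assms(1) by (subst prod.inter_restrict[symmetric]) (auto simp: Int_absorb1)
    also have "\<dots> = of_bool (\<forall>k\<in>A. x k \<le> t k)"
      using fin by (induction A) auto
    finally show ?thesis by (rule sym)
  qed
  have "cube_int P (\<lambda>x. of_bool (\<forall>k\<in>A. x k \<le> t k)) =
     (\<Prod>k\<in>{1..P}. integral\<^sup>L unitM (\<lambda>y. if k \<in> A then of_bool (y \<le> t k) else 1))"
    unfolding eq by (rule cube_int_prod) (auto intro!: integrable_unitM[of _ 1])
  also have "\<dots> = (\<Prod>k\<in>{1..P}. if k \<in> A then t k else 1)"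
  proof (rule prod.cong)
    fix k
    show "integral\<^sup>L unitM (\<lambda>y. if k \<in> A then of_bool (y \<le> t k) else 1) = (if k \<in> A then t k else 1)"
      using integral_unitM_le assms(2)[of k] by auto
  qed simp
  also have "\<dots> = (\<Prod>k\<in>A. t k)"
    using assms(1) by (subst prod.inter_restrict[symmetric]) (auto simp: Int_absorb1)
  finally show ?thesis .
qed

lemma cube_int_ctr_mult:
  assumes "j \<in> {1..P}" "k \<in> {1..P}"
  shows "cube_int P (\<lambda>x. (x j - 1/2) * (x k - 1/2)) = (if j = k then 1/12 else 0)"
proof -
  \<comment> \<open>Two separate conditional factors: at \<open>i = j = k\<close> their product is
    the square, so one formula serves both cases.\<close>
  let ?g = "\<lambda>i y. (if i = j then y - 1/2 else 1) * (if i = k then y - 1/2 else (1::real))"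
  have I1: "integral\<^sup>L unitM (\<lambda>y. y - 1/2) = 0"
    and I2: "integral\<^sup>L unitM (\<lambda>y. (y - 1/2) * (y - 1/2)) = 1/12"
  proof -
    have i: "integrable unitM (\<lambda>y. y ^ m)" for m
      by (rule integrable_unitM[of _ 1]) (auto simp: power_le_one)
    have i1: "integrable unitM (\<lambda>y. y)" using i[of 1] by simp
    have p1: "integral\<^sup>L unitM (\<lambda>y. y) = 1/2" using integral_unitM_power[of 1] by simp
    have p2: "integral\<^sup>L unitM (\<lambda>y. y\<^sup>2) = 1/3" using integral_unitM_power[of 2] by simp
    show "integral\<^sup>L unitM (\<lambda>y. y - 1/2) = 0"
      by (subst Bochner_Integration.integral_diff) (use i1 p1 in auto)
    have "integral\<^sup>L unitM (\<lambda>y. (y - 1/2) * (y - 1/2)) = integral\<^sup>L unitM (\<lambda>y. y\<^sup>2 - y + 1/4)"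
      by (rule Bochner_Integration.integral_cong) (auto simp: power2_eq_square algebra_simps)
    also have "\<dots> = 1/12"
      by (subst Bochner_Integration.integral_add Bochner_Integration.integral_diff;
          use i[of 2] i1 p1 p2 in \<open>auto\<close>)+
    finally show "integral\<^sup>L unitM (\<lambda>y. (y - 1/2) * (y - 1/2)) = 1/12" .
  qed
  have eq: "(x j - 1/2) * (x k - 1/2) = (\<Prod>i\<in>{1..P}. ?g i (x i))" for x :: "nat \<Rightarrow> real"
    unfolding prod.distrib using assms by (simp add: prod.delta')
  have "cube_int P (\<lambda>x. (x j - 1/2) * (x k - 1/2)) = (\<Prod>i\<in>{1..P}. integral\<^sup>L unitM (?g i))"
    unfolding eq
  proof (rule cube_int_prod, rule integrable_unitM[of _ 1])
    fix i and y :: real assume "y \<in> {0..1}"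
    then have "\<bar>if i = j then y - 1/2 else 1\<bar> \<le> 1" "\<bar>if i = k then y - 1/2 else 1\<bar> \<le> 1" by (auto simp: abs_le_iff)
    then show "\<bar>?g i y\<bar> \<le> 1" unfolding abs_mult by (metis abs_ge_zero mult_le_one)
  qed auto
  also have "\<dots> = (if j = k then 1/12 else 0)"
  proof (cases "j = k")
    case True
    have "(\<Prod>i\<in>{1..P}. integral\<^sup>L unitM (?g i)) = (\<Prod>i\<in>{1..P}. if i = j then 1/12 else 1)"
      by (rule prod.cong) (use True I2 in auto)
    then show ?thesis using True assms by (simp add: prod.delta)
  next
    case False
    then have "integral\<^sup>L unitM (?g j) = 0" using I1 by simp
    then have "\<exists>i\<in>{1..P}. integral\<^sup>L unitM (?g i) = 0" using assms(1) by blast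
    then have "(\<Prod>i\<in>{1..P}. integral\<^sup>L unitM (?g i)) = 0" by (rule prod_zero[rotated]) simp
    then show ?thesis using False by simp
  qed
  finally show ?thesis .
qed

text \<open>Fubini with coordinate \<open>j\<close> innermost: \<open>h\<close> is constant there
  and \<open>y - 1/2\<close> has mean zero. Applied to the approximating function, it leaves only
  the approximation error in the covariance of \<open>f\<close> with a coordinate outside
  \<open>A0\<close>.\<close>

lemma cube_int_indep_ctr:
  assumes j: "j \<in> {1..P}" and h: "h \<in> bmf P"
    and indep: "\<And>x y. h (x(j := y)) = h x"
  shows "cube_int P (\<lambda>x. h x * (x j - 1/2)) = 0"
proof -
  have ins: "{1..P} = insert j ({1..P} - {j})" using j by auto
  have "(\<lambda>x. h x * (x j - 1/2)) \<in> bmf P" using j h by simp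
  then have int: "integrable (PiM (insert j ({1..P} - {j})) (\<lambda>_. unitM)) (\<lambda>x. h x * (x j - 1/2))"
    using bmf_integrable ins unfolding cubeM_def by metis
  have I1: "integral\<^sup>L unitM (\<lambda>y. c * (y - 1/2)) = 0" for c :: real
  proof -
    have "integrable unitM (\<lambda>y. y)"
      by (rule integrable_unitM[of _ 1]) auto
    then have "integral\<^sup>L unitM (\<lambda>y. y - 1/2) = 0"
      using integral_unitM_power[of 1]
      by (subst Bochner_Integration.integral_diff) auto
    then show ?thesis by simp
  qed
  have "cube_int P (\<lambda>x. h x * (x j - 1/2)) =
      integral\<^sup>L (PiM ({1..P} - {j}) (\<lambda>_. unitM)) (\<lambda>x. \<integral>y. h (x(j := y)) * ((x(j := y)) j - 1/2) \<partial>unitM)"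
    unfolding cube_int_def cubeM_def
    by (subst ins, rule product_sigma_finite.product_integral_insert[OF product_sigma_finite_unitM]) (use int in auto)
  also have "\<dots> = 0" unfolding indep using I1 by simp
  finally show ?thesis .
qed

lemma cube_int_ctr:
  assumes "j \<in> {1..P}" shows "cube_int P (\<lambda>x. x j - 1/2) = 0"
  using cube_int_indep_ctr[OF assms, of "\<lambda>_. 1"] by simp

text \<open>Continuity refers to the product topology over all of \<open>nat\<close>, the measure
  only to \<open>{1..P}\<close>. The fixed value \<open>undefined\<close> elsewhere reconciles them:
  the cube is a product of compact intervals and singletons, hence compact, and the inclusion is
  measurable coordinate by coordinate.\<close>

lemma continuous_on_imp_bmf:
  assumes "continuous_on (cube P) g" shows "g \<in> bmf P"
proof -
  have "cube P = PiE UNIV (\<lambda>k. if k \<in> {1..P} then {0..1::real} else {undefined})"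
    by (auto simp: cube_def PiE_iff extensional_def split: if_splits)
  then have "compactin (product_topology (\<lambda>_. euclidean) UNIV) (cube P)"
    by (simp add: compactin_PiE)
  then have "compact (cube P)"
    by (simp add: euclidean_product_topology)
  then have "bounded (g ` cube P)"
    using assms compact_continuous_image compact_imp_bounded by blast
  then obtain B where B: "\<And>x. x \<in> cube P \<Longrightarrow> \<bar>g x\<bar> \<le> B"
    unfolding bounded_iff by auto
  have "(\<lambda>x. x) \<in> measurable (cubeM P) (borel :: (nat \<Rightarrow> real) measure)"
  proof (rule measurable_coordinatewise_then_product)
    fix k
    show "(\<lambda>x. x k) \<in> borel_measurable (cubeM P)"
    proof (cases "k \<in> {1..P}")
      case False
      have "x k = undefined" if "x \<in> space (cubeM P)" for x
        using that False by (auto simp: space_cubeM cube_def PiE_iff extensional_def)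
      then show ?thesis by (subst measurable_cong[of _ _ "\<lambda>_. undefined"]) auto
    qed (rule coord_measurable)
  qed
  then have "(\<lambda>x. x) \<in> measurable (cubeM P) (restrict_space borel (cube P))"
    by (intro measurable_restrict_space2) (auto simp: space_cubeM)
  from measurable_comp[OF this borel_measurable_continuous_on_restrict[OF assms]]
  show ?thesis using B by (auto simp: comp_def intro: bmfI)
qed

section \<open>Koksma--Hlawka by grid expansion\<close>

lemma delta_box_cong:
  assumes "\<And>k. k \<in> u \<Longrightarrow> a k = a' k" "\<And>k. k \<in> u \<Longrightarrow> b k = b' k"
  shows "delta_box I u g a b = delta_box I u g a' b'"
  unfolding delta_box_def
proof (rule sum.cong)
  fix S assume "S \<in> Pow u"
  then have "(\<lambda>k. if k \<in> S then b k else if k \<in> u then a k else if k \<in> I then 1 else undefined) =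
    (\<lambda>k. if k \<in> S then b' k else if k \<in> u then a' k else if k \<in> I then 1 else undefined)"
    using assms by fastforce
  then show "(- 1) ^ card (u - S) * g (\<lambda>k. if k \<in> S then b k else if k \<in> u then a k else if k \<in> I then 1 else undefined) =
    (- 1) ^ card (u - S) * g (\<lambda>k. if k \<in> S then b' k else if k \<in> u then a' k else if k \<in> I then 1 else undefined)"
    by simp
qed simp

lemma delta_box_empty: "delta_box I {} g a b = g (\<lambda>k. if k \<in> I then 1 else undefined)"
  by (simp add: delta_box_def)

lemma sum_Pow_insert:
  assumes "finite u" "k \<notin> u"
  shows "(\<Sum>S\<in>Pow (insert k u). F S) = (\<Sum>S\<in>Pow u. F S) + (\<Sum>S\<in>Pow u. F (insert k S))"
proof -
  have "inj_on (insert k) (Pow u)" using assms(2) by (auto simp: inj_on_def)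
  moreover have "Pow u \<inter> insert k ` Pow u = {}" using assms(2) by auto
  ultimately show ?thesis
    using assms(1) by (simp add: Pow_insert sum.union_disjoint sum.reindex comp_def)
qed

text \<open>A mixed difference is an iterated one-dimensional difference. This allows induction on
  \<open>u\<close>, with the difference in \<open>k\<close> absorbed into the function.\<close>

lemma delta_box_insert:
  assumes "finite u" "k \<notin> u"
  shows "delta_box I (insert k u) g a b =
    delta_box I u (\<lambda>y. g (y(k := b k))) a b - delta_box I u (\<lambda>y. g (y(k := a k))) a b"
proof -
  have 1: "card (insert k u - S) = Suc (card (u - S))" if "S \<in> Pow u" for S
  proof -
    have "insert k u - S = insert k (u - S)" "k \<notin> u - S" using that assms(2) by auto
    then show ?thesis using assms(1) by simp
  qed
  have 2: "insert k u - insert k S = u - S" if "S \<in> Pow u" for S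
    using that assms(2) by auto
  have 3: "(\<lambda>i. if i \<in> S then b i else if i \<in> insert k u then a i else if i \<in> I then 1 else undefined) =
     (\<lambda>i. if i \<in> S then b i else if i \<in> u then a i else if i \<in> I then 1 else undefined)(k := a k)"
    if "S \<in> Pow u" for S using that assms(2) by fastforce
  have 4: "(\<lambda>i. if i \<in> insert k S then b i else if i \<in> insert k u then a i else if i \<in> I then 1 else undefined) =
     (\<lambda>i. if i \<in> S then b i else if i \<in> u then a i else if i \<in> I then 1 else undefined)(k := b k)"
    for S by fastforce
  let ?p = "\<lambda>S i. if i \<in> S then b i else if i \<in> u then a i else if i \<in> I then 1 else undefined"
  have "delta_box I (insert k u) g a b =
      (\<Sum>S\<in>Pow u. (- 1) ^ Suc (card (u - S)) * g ((?p S)(k := a k))) +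
      (\<Sum>S\<in>Pow u. (- 1) ^ card (u - S) * g ((?p S)(k := b k)))"
    unfolding delta_box_def sum_Pow_insert[OF assms] 4
    by (intro arg_cong2[of _ _ _ _ "(+)"] sum.cong refl) (simp_all only: 1 2 3)
  then show ?thesis by (simp add: delta_box_def sum_negf)
qed

lemma delta_box_diff:
  "delta_box I u (\<lambda>y. g y - h y) a b = delta_box I u g a b - delta_box I u h a b"
  by (simp add: delta_box_def right_diff_distrib sum_subtractf)

text \<open>Rounding up rather than down matters: the relevant thresholds are then those with
  \<open>x \<le> i / N\<close>, a closed condition like the one in \<open>disc\<close>.\<close>

definition grid_up :: "nat \<Rightarrow> real \<Rightarrow> real" where
  "grid_up N x = real_of_int \<lceil>real N * x\<rceil> / real N"

text \<open>Telescoping runs down from 1, over the cells whose left end is at or above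
  \<open>x\<close>. The reference value is thus the one at 1, where the Hardy-Krause variation
  freezes absent coordinates.\<close>

lemma grid_up_telescope:
  fixes G :: "real \<Rightarrow> real"
  assumes "N > 0" "0 \<le> x" "x \<le> 1"
  shows "G (grid_up N x) = G 1 -
    (\<Sum>i<N. (G (real (i + 1) / N) - G (real i / N)) * of_bool (x \<le> real i / N))"
proof -
  define m where "m = nat \<lceil>real N * x\<rceil>"
  have "real N * x \<le> real N" using assms by (simp add: mult_left_le)
  then have "\<lceil>real N * x\<rceil> \<le> int N" by linarith
  moreover have c0: "0 \<le> \<lceil>real N * x\<rceil>"
    using mult_nonneg_nonneg[of "real N" x] assms by linarith
  ultimately have m: "m \<le> N" "real_of_int \<lceil>real N * x\<rceil> = real m"
    by (simp_all add: m_def of_nat_nat nat_le_iff)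
  have iff: "x \<le> real i / N \<longleftrightarrow> m \<le> i" for i
  proof -
    have "x \<le> real i / N \<longleftrightarrow> real N * x \<le> real i" using assms(1) by (simp add: field_simps)
    also have "\<dots> \<longleftrightarrow> \<lceil>real N * x\<rceil> \<le> int i" by (metis ceiling_le_iff of_int_of_nat_eq)
    also have "\<dots> \<longleftrightarrow> m \<le> i" by (simp only: m_def nat_le_iff)
    finally show ?thesis .
  qed
  have "(\<Sum>i<N. (G (real (i + 1) / N) - G (real i / N)) * of_bool (x \<le> real i / N))
     = (\<Sum>i\<in>{m..<N}. G (real (Suc i) / N) - G (real i / N))"
    unfolding iff
    by (rule sum.mono_neutral_cong_right) auto
  also have "\<dots> = G (real N / N) - G (real m / N)"
    using sum_Suc_diff'[OF m(1), of "\<lambda>i. G (real i / real N)"] by simp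
  finally show ?thesis using assms(1) by (simp add: grid_up_def m(2))
qed

definition grid_pt :: "nat \<Rightarrow> nat set \<Rightarrow> nat set \<Rightarrow> (nat \<Rightarrow> real) \<Rightarrow> nat \<Rightarrow> real" where
  "grid_pt N I W x = (\<lambda>k. if k \<in> W then grid_up N (x k) else if k \<in> I then 1 else undefined)"

definition cell_delta :: "nat \<Rightarrow> nat set \<Rightarrow> nat set \<Rightarrow> ((nat \<Rightarrow> real) \<Rightarrow> real) \<Rightarrow> (nat \<Rightarrow> nat) \<Rightarrow> real" where
  "cell_delta N I u g \<kappa> = delta_box I u g (\<lambda>k. real (\<kappa> k) / N) (\<lambda>k. real (\<kappa> k + 1) / N)"

lemma cell_delta_insert:
  assumes "finite u" "k \<notin> u"
  shows "cell_delta N I (insert k u) g (\<kappa>(k := i)) =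
    cell_delta N I u (\<lambda>y. g (y(k := real (i + 1) / N)) - g (y(k := real i / N))) \<kappa>"
  unfolding cell_delta_def delta_box_insert[OF assms] delta_box_diff
  by (intro arg_cong2[of _ _ _ _ "(-)"])
     (simp_all, (rule delta_box_cong; use assms(2) in auto)+)

lemma sum_PiE_insert:
  assumes "k \<notin> u"
  shows "(\<Sum>\<kappa>\<in>PiE (insert k u) (\<lambda>_. A). F \<kappa>) = (\<Sum>i\<in>A. \<Sum>\<kappa>\<in>PiE u (\<lambda>_. A). F (\<kappa>(k := i)))"
proof -
  have inj: "inj_on (\<lambda>(i, \<kappa>). \<kappa>(k := i)) (A \<times> PiE u (\<lambda>_. A))"
    using inj_combinator[OF assms, of "\<lambda>_. A"] by simp
  show ?thesis
    unfolding PiE_insert_eq sum.reindex[OF inj] sum.cartesian_product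
    by (simp add: case_prod_beta comp_def)
qed

text \<open>A discrete Hlawka-Zaremba identity, obtained by telescoping in each coordinate of
  \<open>W\<close>. It writes the rounded \<open>g\<close> as a combination of anchored box
  indicators whose coefficients are mixed differences over grid cells. The induction needs
  \<open>g\<close> arbitrary, since the step for \<open>k\<close> uses the hypothesis for the
  difference of \<open>g\<close> in \<open>k\<close>.\<close>

lemma grid_expansion:
  assumes "N > 0" "finite W" "W \<subseteq> I" "\<And>k. k \<in> W \<Longrightarrow> 0 \<le> x k \<and> x k \<le> 1"
  shows "g (grid_pt N I W x) = (\<Sum>u\<in>Pow W. \<Sum>\<kappa>\<in>PiE u (\<lambda>_. {..<N}).
     (-1) ^ card u * cell_delta N I u g \<kappa> * of_bool (\<forall>k\<in>u. x k \<le> real (\<kappa> k) / N))"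
  using assms(2-)
proof (induction W arbitrary: g)
  case empty
  show ?case by (simp add: grid_pt_def cell_delta_def delta_box_empty)
next
  case (insert k W)
  let ?T = "\<lambda>u g \<kappa>. (-1) ^ card u * cell_delta N I u g \<kappa> * of_bool (\<forall>k\<in>u. x k \<le> real (\<kappa> k) / N)"
  let ?h = "\<lambda>i y. g (y(k := real (i + 1) / N)) - g (y(k := real i / N))"
  let ?b = "\<lambda>i. of_bool (x k \<le> real i / N) :: real"
  have IH: "h (grid_pt N I W x) = (\<Sum>u\<in>Pow W. \<Sum>\<kappa>\<in>PiE u (\<lambda>_. {..<N}). ?T u h \<kappa>)" for h
    using insert by auto
  have upd: "grid_pt N I (insert k W) x = (grid_pt N I W x)(k := grid_up N (x k))"
    and one: "(grid_pt N I W x)(k := 1) = grid_pt N I W x"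
    using insert by (auto simp: grid_pt_def)
  \<comment> \<open>Telescoping in \<open>k\<close> brings one minus sign; over all of
    \<open>u\<close> these make up \<open>(-1) ^ card u\<close>.\<close>
  have T: "?T (insert k u) g (\<kappa>(k := i)) = - (?T u (?h i) \<kappa> * ?b i)" if "u \<in> Pow W" for u \<kappa> i
  proof -
    have u: "finite u" "k \<notin> u" using that insert(1,2) finite_subset by auto
    have "(\<forall>l\<in>insert k u. x l \<le> real ((\<kappa>(k := i)) l) / N) \<longleftrightarrow>
       (\<forall>l\<in>u. x l \<le> real (\<kappa> l) / N) \<and> x k \<le> real i / N"
      using u(2) by auto
    then show ?thesis
      unfolding cell_delta_insert[OF u] by (simp add: u of_bool_conj)
  qed
  have "g (grid_pt N I (insert k W) x) = g (grid_pt N I W x) - (\<Sum>i<N. ?h i (grid_pt N I W x) * ?b i)"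
    using grid_up_telescope[OF assms(1), of "x k" "\<lambda>v. g ((grid_pt N I W x)(k := v))"] insert.prems
    unfolding upd one by simp
  also have "(\<Sum>i<N. ?h i (grid_pt N I W x) * ?b i) =
      (\<Sum>i<N. \<Sum>u\<in>Pow W. \<Sum>\<kappa>\<in>PiE u (\<lambda>_. {..<N}). ?T u (?h i) \<kappa> * ?b i)"
    by (subst IH[of "?h _"]) (simp add: sum_distrib_right)
  also have "\<dots> = (\<Sum>u\<in>Pow W. \<Sum>i<N. \<Sum>\<kappa>\<in>PiE u (\<lambda>_. {..<N}). ?T u (?h i) \<kappa> * ?b i)"
    by (rule sum.swap)
  also have "g (grid_pt N I W x) - \<dots> = (\<Sum>u\<in>Pow W. \<Sum>\<kappa>\<in>PiE u (\<lambda>_. {..<N}). ?T u g \<kappa>)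
      + (\<Sum>u\<in>Pow W. \<Sum>i<N. \<Sum>\<kappa>\<in>PiE u (\<lambda>_. {..<N}). ?T (insert k u) g (\<kappa>(k := i)))"
    by (simp only: IH[of g] T sum_negf cong: sum.cong)
  also have "(\<Sum>u\<in>Pow W. \<Sum>i<N. \<Sum>\<kappa>\<in>PiE u (\<lambda>_. {..<N}). ?T (insert k u) g (\<kappa>(k := i))) =
      (\<Sum>u\<in>Pow W. \<Sum>\<kappa>\<in>PiE (insert k u) (\<lambda>_. {..<N}). ?T (insert k u) g \<kappa>)"
    by (rule sum.cong[OF refl], subst sum_PiE_insert) (use insert(2) in auto)
  also have "(\<Sum>u\<in>Pow W. \<Sum>\<kappa>\<in>PiE u (\<lambda>_. {..<N}). ?T u g \<kappa>) + \<dots> =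
      (\<Sum>u\<in>Pow (insert k W). \<Sum>\<kappa>\<in>PiE u (\<lambda>_. {..<N}). ?T u g \<kappa>)"
    using insert(1,2) by (rule sum_Pow_insert[symmetric])
  finally show ?case .
qed

section \<open>Grid sums of mixed differences and the Hardy-Krause variation\<close>

lemma grid_cells_partition:
  assumes "N > 0" and finu: "finite u"
  shows "is_rect_partition u ((\<lambda>\<kappa>. (\<lambda>k. real (\<kappa> k) / N, \<lambda>k. real (\<kappa> k + 1) / N)) ` PiE u (\<lambda>_. {..<N}))"
    (is "is_rect_partition u (?c ` ?K)")
proof -
  have fin: "finite (?c ` ?K)" using finu by (simp add: finite_PiE)
  have bounds: "\<forall>(a,b)\<in>?c ` ?K. \<forall>k\<in>u. 0 \<le> a k \<and> a k \<le> b k \<and> b k \<le> 1"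
  proof safe
    fix \<kappa> k assume \<kappa>: "\<kappa> \<in> ?K" "k \<in> u"
    then have "\<kappa> k < N" by auto
    then show "real (\<kappa> k + 1) / real N \<le> 1" using assms by (simp add: divide_le_eq_1)
    show "0 \<le> real (\<kappa> k) / real N" by simp
    show "real (\<kappa> k) / real N \<le> real (\<kappa> k + 1) / real N" by (simp add: divide_right_mono)
  qed
  have cover: "\<exists>(a,b)\<in>?c ` ?K. \<forall>k\<in>u. a k \<le> x k \<and> x k \<le> b k"
    if x: "\<forall>k\<in>u. 0 \<le> x k \<and> x k \<le> 1" for x :: "nat \<Rightarrow> real"
  proof -
    \<comment> \<open>At \<open>x k = 1\<close> the floor is \<open>N\<close>, one beyond the last
      cell; the minimum moves the point back into that cell.\<close>
    define \<kappa> where "\<kappa> = (\<lambda>k\<in>u. min (N - 1) (nat \<lfloor>real N * x k\<rfloor>))"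
    have "\<kappa> \<in> ?K" using assms by (auto simp: \<kappa>_def)
    moreover have "real (\<kappa> k) / N \<le> x k \<and> x k \<le> real (\<kappa> k + 1) / N" if k: "k \<in> u" for k
    proof -
      have x01: "0 \<le> x k" "x k \<le> 1" using x k by auto
      let ?m = "nat \<lfloor>real N * x k\<rfloor>"
      have m: "real ?m \<le> real N * x k" "real N * x k < real ?m + 1"
        using x01 by (auto simp: of_nat_nat)
      have \<kappa>k: "\<kappa> k = min (N - 1) ?m" using k by (simp add: \<kappa>_def)
      have "real (\<kappa> k) \<le> real N * x k" using m(1) unfolding \<kappa>k by linarith
      moreover have "real N * x k \<le> real (\<kappa> k + 1)"
      proof (cases "?m \<le> N - 1")
        case True then show ?thesis using m(2) unfolding \<kappa>k by simp
      next
        case False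
        then have "\<kappa> k + 1 = N" using assms unfolding \<kappa>k by simp
        then show ?thesis using x01 by (simp add: mult_left_le)
      qed
      ultimately show ?thesis using assms by (simp add: field_simps)
    qed
    ultimately show ?thesis by (intro bexI[of _ "?c \<kappa>"]) auto
  qed
  have disj: "\<not> (\<exists>x. \<forall>k\<in>u. max (fst (?c \<kappa>) k) (fst (?c \<kappa>') k) < x k \<and> x k < min (snd (?c \<kappa>) k) (snd (?c \<kappa>') k))"
    if K: "\<kappa> \<in> ?K" "\<kappa>' \<in> ?K" and ne: "?c \<kappa> \<noteq> ?c \<kappa>'" for \<kappa> \<kappa>'
  proof -
    obtain k where k: "k \<in> u" "\<kappa> k \<noteq> \<kappa>' k"
      using K ne PiE_ext by metis
    show ?thesis
    proof (safe, drule bspec[OF _ k(1)])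
      fix x :: "nat \<Rightarrow> real"
      assume "max (fst (?c \<kappa>) k) (fst (?c \<kappa>') k) < x k \<and> x k < min (snd (?c \<kappa>) k) (snd (?c \<kappa>') k)"
      then have "real (\<kappa> k) / N < real (\<kappa>' k + 1) / N" "real (\<kappa>' k) / N < real (\<kappa> k + 1) / N" by auto
      then have "real (\<kappa> k) < real (\<kappa>' k + 1)" "real (\<kappa>' k) < real (\<kappa> k + 1)"
        using assms by (simp_all only: divide_less_cancel)
      then show False using k(2) by linarith
    qed
  qed
  have nonoverlap: "\<forall>(a,b)\<in>?c ` ?K. \<forall>(a',b')\<in>?c ` ?K. (a,b) \<noteq> (a',b') \<longrightarrow>
        \<not> (\<exists>x. \<forall>k\<in>u. max (a k) (a' k) < x k \<and> x k < min (b k) (b' k))"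
  proof (intro ballI, unfold split_def, intro ballI)
    fix q q' assume "q \<in> ?c ` ?K" "q' \<in> ?c ` ?K"
    then obtain \<kappa> \<kappa>' where q: "\<kappa> \<in> ?K" "\<kappa>' \<in> ?K" "q = ?c \<kappa>" "q' = ?c \<kappa>'" by blast
    show "(fst q, snd q) \<noteq> (fst q', snd q') \<longrightarrow>
        \<not> (\<exists>x. \<forall>k\<in>u. max (fst q k) (fst q' k) < x k \<and> x k < min (snd q k) (snd q' k))"
      using disj[OF q(1,2)] unfolding q(3,4) fst_conv snd_conv by blast
  qed
  show ?thesis
    unfolding is_rect_partition_def
    by (intro conjI fin bounds nonoverlap allI impI cover)
qed

lemma grid_sum_le_vitali:
  assumes "N > 0" "finite u"
  shows "ereal (\<Sum>\<kappa>\<in>PiE u (\<lambda>_. {..<N}). \<bar>cell_delta N I u g \<kappa>\<bar>) \<le> vitali I u g"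
proof -
  let ?c = "\<lambda>\<kappa>. (\<lambda>k. real (\<kappa> k) / N, \<lambda>k. real (\<kappa> k + 1) / N)"
  \<comment> \<open>\<open>vitali\<close> sums over a set of corner pairs, so distinct cells must
    have distinct pairs for no term to be lost.\<close>
  have inj: "inj_on ?c (PiE u (\<lambda>_. {..<N}))"
    using assms(1) by (auto simp: inj_on_def fun_eq_iff)
  have "(\<Sum>(a,b)\<in>?c ` PiE u (\<lambda>_. {..<N}). \<bar>delta_box I u g a b\<bar>) =
     (\<Sum>\<kappa>\<in>PiE u (\<lambda>_. {..<N}). \<bar>cell_delta N I u g \<kappa>\<bar>)"
    by (subst sum.reindex[OF inj]) (simp add: cell_delta_def comp_def)
  then show ?thesis
    unfolding vitali_def using grid_cells_partition[OF assms]
    by (intro SUP_upper2[of "?c ` PiE u (\<lambda>_. {..<N})"]) auto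
qed

lemma vitali_nonneg: "finite u \<Longrightarrow> 0 \<le> vitali I u g"
  by (rule order_trans[OF _ grid_sum_le_vitali[of 1]]) (auto intro: sum_nonneg)

lemma VHK_nonneg:
  assumes "finite I" shows "0 \<le> VHK I g"
  unfolding VHK_def by (rule sum_nonneg) (use assms finite_subset in \<open>auto intro!: vitali_nonneg\<close>)

text \<open>The term of the empty set is a value of \<open>g\<close>, not a variation, and is kept
  apart. Finiteness matters because \<open>real_of_ereal\<close> sends an infinite variation to 0,
  for which the bound could fail.\<close>

lemma grid_sum_le_VHK:
  assumes "N > 0" "finite I" "W \<subseteq> I" "VHK I g < \<infinity>"
  shows "(\<Sum>u\<in>Pow W - {{}}. \<Sum>\<kappa>\<in>PiE u (\<lambda>_. {..<N}). \<bar>cell_delta N I u g \<kappa>\<bar>) \<le> real_of_ereal (VHK I g)"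
proof -
  have fin: "finite W" using assms(2,3) finite_subset by blast
  have "ereal (\<Sum>u\<in>Pow W - {{}}. \<Sum>\<kappa>\<in>PiE u (\<lambda>_. {..<N}). \<bar>cell_delta N I u g \<kappa>\<bar>) =
     (\<Sum>u\<in>Pow W - {{}}. ereal (\<Sum>\<kappa>\<in>PiE u (\<lambda>_. {..<N}). \<bar>cell_delta N I u g \<kappa>\<bar>))" by simp
  also have "\<dots> \<le> (\<Sum>u\<in>Pow W - {{}}. vitali I u g)"
    using assms fin by (intro sum_mono grid_sum_le_vitali) (auto intro: finite_subset[of _ W])
  also have "\<dots> \<le> VHK I g"
    unfolding VHK_def
    using assms by (intro sum_mono2) (auto intro!: vitali_nonneg intro: finite_subset[of _ I])
  finally have "ereal (\<Sum>u\<in>Pow W - {{}}. \<Sum>\<kappa>\<in>PiE u (\<lambda>_. {..<N}). \<bar>cell_delta N I u g \<kappa>\<bar>) \<le> VHK I g" .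
  moreover obtain V where "VHK I g = ereal V"
    using assms(4) VHK_nonneg[OF assms(2), of g] by (cases "VHK I g") auto
  ultimately show ?thesis by (simp only: ereal_less_eq(3) real_of_ereal.simps)
qed

text \<open>Dummy coordinates add no variation: for \<open>u\<close> inside \<open>W\<close> the
  mixed differences are those on \<open>W\<close>, and if \<open>u\<close> has a coordinate outside
  \<open>W\<close>, the difference in it vanishes.\<close>

lemma VHK_restrict_finite:
  assumes "finite I" "W \<subseteq> I" "BVHK W g"
  shows "VHK I (\<lambda>x. g (restrict x W)) < \<infinity>"
proof -
  have finW: "finite W" using assms finite_subset by blast
  have "vitali I u (\<lambda>x. g (restrict x W)) < \<infinity>" if u: "u \<subseteq> I" "u \<noteq> {}" for u
  proof (cases "u \<subseteq> W")
    case True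
    have "restrict (\<lambda>k. if k \<in> S then b k else if k \<in> u then a k else if k \<in> I then 1 else undefined) W =
       (\<lambda>k. if k \<in> S then b k else if k \<in> u then a k else if k \<in> W then 1 else undefined)"
      if "S \<subseteq> u" for S and a b :: "nat \<Rightarrow> real" using that True assms(2) by (fastforce simp: restrict_def)
    then have "delta_box I u (\<lambda>x. g (restrict x W)) a b = delta_box W u g a b" for a b
      unfolding delta_box_def by (intro sum.cong) auto
    then have "vitali I u (\<lambda>x. g (restrict x W)) = vitali W u g" by (simp add: vitali_def)
    also have "\<dots> = (\<Sum>v\<in>{u}. vitali W v g)" by simp
    also have "\<dots> \<le> VHK W g"
      unfolding VHK_def
    proof (rule sum_mono2)
      show "0 \<le> vitali W v g" if "v \<in> {u. u \<subseteq> W \<and> u \<noteq> {}} - {u}" for v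
        by (rule vitali_nonneg) (use that finW finite_subset[of v W] in simp)
    qed (use finW True u in auto)
    finally show ?thesis using assms(3) unfolding BVHK_def by (rule le_less_trans)
  next
    case False
    then obtain k where k: "k \<in> u" "k \<notin> W" by auto
    have fin: "finite (u - {k})" using u assms(1) finite_subset by blast
    have "delta_box I u (\<lambda>x. g (restrict x W)) a b = 0" for a b
    proof -
      have "restrict (y(k := v)) W = restrict y W" for y and v :: real
        using k(2) by (auto simp: restrict_def)
      then show ?thesis
        using delta_box_insert[OF fin, of k I "\<lambda>x. g (restrict x W)" a b] k(1) by (simp add: insert_absorb)
    qed
    then have "vitali I u (\<lambda>x. g (restrict x W)) \<le> 0"
      unfolding vitali_def by (auto intro!: SUP_least simp: case_prod_beta)
    then show ?thesis by auto
  qed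
  then show ?thesis by (auto simp: VHK_def sum_Pinfty)
qed

lemma tendsto_fun_coordinatewise:
  fixes F :: "nat \<Rightarrow> nat \<Rightarrow> real"
  assumes "\<And>k. (\<lambda>N. F N k) \<longlonglongrightarrow> l k"
  shows "F \<longlonglongrightarrow> l"
proof -
  have "limitin (product_topology (\<lambda>_. euclidean) UNIV) F l sequentially"
    using assms by (simp add: limitin_componentwise)
  then show ?thesis by (simp add: euclidean_product_topology)
qed

section \<open>Empirical means, quadrature errors and discrepancy\<close>

locale design =
  fixes n P :: nat and X :: "nat \<Rightarrow> nat \<Rightarrow> real"
  assumes n_pos: "n > 0" and P_ge_2: "P \<ge> 2"
    and X_unit: "\<And>i j. i \<in> {1..n} \<Longrightarrow> j \<in> {1..P} \<Longrightarrow> 0 \<le> X i j \<and> X i j \<le> 1"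
begin

definition pt :: "nat \<Rightarrow> nat \<Rightarrow> real" where
  "pt i = restrict (X i) {1..P}"

definition mean :: "((nat \<Rightarrow> real) \<Rightarrow> real) \<Rightarrow> real" where
  "mean g = (\<Sum>i=1..n. g (pt i)) / real n"

definition qerr :: "((nat \<Rightarrow> real) \<Rightarrow> real) \<Rightarrow> real" where
  "qerr g = mean g - cube_int P g"

lemma pt_cube: "i \<in> {1..n} \<Longrightarrow> pt i \<in> cube P"
  using X_unit by (auto simp: pt_def cube_def)

lemma mean_add: "mean (\<lambda>x. g x + h x) = mean g + mean h"
  by (simp add: mean_def sum.distrib add_divide_distrib)

lemma mean_diff: "mean (\<lambda>x. g x - h x) = mean g - mean h"
  by (simp add: mean_def sum_subtractf diff_divide_distrib)

lemma mean_cmult: "mean (\<lambda>x. c * g x) = c * mean g"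
  by (simp add: mean_def sum_distrib_left[symmetric])

lemma mean_const [simp]: "mean (\<lambda>x. c) = c"
  using n_pos by (simp add: mean_def)

lemma mean_sum: "mean (\<lambda>x. \<Sum>i\<in>A. g i x) = (\<Sum>i\<in>A. mean (g i))"
  by (simp add: mean_def sum_divide_distrib sum.swap[of _ A])

lemma mean_cong: "(\<And>x. x \<in> cube P \<Longrightarrow> g x = h x) \<Longrightarrow> mean g = mean h"
  unfolding mean_def using pt_cube by (intro arg_cong2[of _ _ _ _ "(/)"] sum.cong) auto

lemma mean_mono:
  assumes "\<And>x. x \<in> cube P \<Longrightarrow> g x \<le> h x" shows "mean g \<le> mean h"
  unfolding mean_def using assms pt_cube by (intro divide_right_mono sum_mono) auto

lemma mean_abs_le:
  assumes "\<And>x. x \<in> cube P \<Longrightarrow> \<bar>g x\<bar> \<le> B" shows "\<bar>mean g\<bar> \<le> B"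
  using mean_mono[of g "\<lambda>_. B"] mean_mono[of "\<lambda>_. - B" g] assms by (force simp: abs_le_iff)

lemma qerr_const [simp]: "qerr (\<lambda>x. c) = 0"
  by (simp add: qerr_def)

lemma qerr_add:
  "g \<in> bmf P \<Longrightarrow> h \<in> bmf P \<Longrightarrow> qerr (\<lambda>x. g x + h x) = qerr g + qerr h"
  by (simp add: qerr_def mean_add cube_int_add)

lemma qerr_diff:
  "g \<in> bmf P \<Longrightarrow> h \<in> bmf P \<Longrightarrow> qerr (\<lambda>x. g x - h x) = qerr g - qerr h"
  by (simp add: qerr_def mean_diff cube_int_diff)

lemma qerr_cmult: "qerr (\<lambda>x. c * g x) = c * qerr g"
  by (simp add: qerr_def mean_cmult cube_int_cmult right_diff_distrib)

lemma qerr_sum: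
  "(\<And>i. i \<in> A \<Longrightarrow> g i \<in> bmf P) \<Longrightarrow> qerr (\<lambda>x. \<Sum>i\<in>A. g i x) = (\<Sum>i\<in>A. qerr (g i))"
  by (simp add: qerr_def mean_sum cube_int_sum sum_subtractf)

lemma qerr_cong: "(\<And>x. x \<in> cube P \<Longrightarrow> g x = h x) \<Longrightarrow> qerr g = qerr h"
  unfolding qerr_def using mean_cong[of g h] cube_int_cong[of P g h] by simp

lemma qerr_abs_le:
  assumes "g \<in> bmf P" "\<And>x. x \<in> cube P \<Longrightarrow> \<bar>g x\<bar> \<le> B" shows "\<bar>qerr g\<bar> \<le> 2 * B"
proof -
  have "\<bar>mean g\<bar> \<le> B" "\<bar>cube_int P g\<bar> \<le> B"
    using assms by (auto intro: mean_abs_le cube_int_abs_le)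
  then show ?thesis unfolding qerr_def by linarith
qed

lemma disc_term_le_1:
  assumes "\<And>k. k \<in> A \<Longrightarrow> 0 \<le> x k \<and> x k \<le> 1"
  shows "\<bar>real (card {i\<in>{1..n}. \<forall>k\<in>A. X i k \<le> x k}) / real n - (\<Prod>k\<in>A. x k)\<bar> \<le> 1"
proof -
  have "card {i\<in>{1..n}. \<forall>k\<in>A. X i k \<le> x k} \<le> card {1..n}" by (rule card_mono) auto
  then have "real (card {i\<in>{1..n}. \<forall>k\<in>A. X i k \<le> x k}) / real n \<le> 1"
    using n_pos by (simp add: divide_le_eq_1)
  moreover have "0 \<le> (\<Prod>k\<in>A. x k)" "(\<Prod>k\<in>A. x k) \<le> 1"
    using assms by (auto intro: prod_nonneg prod_le_1)
  ultimately show ?thesis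
    using divide_nonneg_nonneg[of "real (card {i\<in>{1..n}. \<forall>k\<in>A. X i k \<le> x k})" "real n"] by linarith
qed

lemma disc_upper:
  assumes "\<And>k. k \<in> A \<Longrightarrow> 0 \<le> x k \<and> x k \<le> 1"
  shows "\<bar>real (card {i\<in>{1..n}. \<forall>k\<in>A. X i k \<le> x k}) / real n - (\<Prod>k\<in>A. x k)\<bar> \<le> disc n X A"
  unfolding disc_def
  by (rule cSUP_upper) (use assms disc_term_le_1 in \<open>auto intro!: bdd_aboveI2[of _ _ 1]\<close>)

lemma disc_nonneg: "0 \<le> disc n X A"
  using disc_upper[of A "\<lambda>_. 0"] by (force intro: order_trans[OF abs_ge_zero])

lemma bmf_box [simp]:
  assumes "A \<subseteq> {1..P}" shows "(\<lambda>x. of_bool (\<forall>k\<in>A. x k \<le> t k)) \<in> bmf P"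
proof -
  have "finite A" using assms finite_subset by blast
  then have "(\<lambda>x. \<Prod>k\<in>A. of_bool (x k \<le> t k)) = (\<lambda>x. of_bool (\<forall>k\<in>A. x k \<le> t k) :: real)"
    by (induction A) (auto simp: fun_eq_iff)
  moreover have "(\<lambda>x. \<Prod>k\<in>A. of_bool (x k \<le> t k)) \<in> bmf P"
    using assms by (intro bmf_prod bmf_of_bool) auto
  ultimately show ?thesis by simp
qed

text \<open>Coordinates of \<open>A\<close> outside \<open>u\<close> get threshold 1, which excludes
  no point of the cube, so a box in fewer coordinates is also a box in \<open>A\<close>.\<close>

lemma qerr_box_le:
  assumes "u \<subseteq> A" "A \<subseteq> {1..P}" "\<And>k. k \<in> u \<Longrightarrow> 0 \<le> t k \<and> t k \<le> 1"
  shows "\<bar>qerr (\<lambda>x. of_bool (\<forall>k\<in>u. x k \<le> t k))\<bar> \<le> disc n X A"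
proof -
  let ?t = "\<lambda>k. if k \<in> u then t k else 1"
  have t: "0 \<le> ?t k \<and> ?t k \<le> 1" for k using assms(3) by auto
  have "qerr (\<lambda>x. of_bool (\<forall>k\<in>u. x k \<le> t k)) = qerr (\<lambda>x. of_bool (\<forall>k\<in>A. x k \<le> ?t k))"
  proof (rule qerr_cong)
    fix x assume "x \<in> cube P"
    then have "x k \<le> 1" if "k \<in> A" for k using cubeD that assms(2) by blast
    then have "(\<forall>k\<in>u. x k \<le> t k) \<longleftrightarrow> (\<forall>k\<in>A. x k \<le> ?t k)" using assms(1) by auto
    then show "of_bool (\<forall>k\<in>u. x k \<le> t k) = (of_bool (\<forall>k\<in>A. x k \<le> ?t k) :: real)" by (rule arg_cong)
  qed
  also have "\<dots> = real (card {i\<in>{1..n}. \<forall>k\<in>A. X i k \<le> ?t k}) / real n - (\<Prod>k\<in>A. ?t k)"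
  proof -
    have "(\<Sum>i=1..n. of_bool (\<forall>k\<in>A. pt i k \<le> ?t k)) = (\<Sum>i\<in>{1..n}. (of_bool (\<forall>k\<in>A. X i k \<le> ?t k) :: real))"
      by (rule sum.cong) (use assms(2) in \<open>auto simp: pt_def subset_iff\<close>)
    also have "\<dots> = real (card {i\<in>{1..n}. \<forall>k\<in>A. X i k \<le> ?t k})"
      by (subst sum_of_bool_eq) (auto simp: Int_def)
    finally show ?thesis
      unfolding qerr_def mean_def by (simp only: cube_int_box[OF assms(2) t])
  qed
  finally show ?thesis using disc_upper[of A ?t] t by simp
qed

lemma qerr_halfspace_box_le:
  assumes "insert j u \<subseteq> A" "A \<subseteq> {1..P}" "\<And>k. k \<in> u \<Longrightarrow> 0 \<le> t k \<and> t k \<le> 1" "0 \<le> s" "s \<le> 1"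
  shows "\<bar>qerr (\<lambda>x. of_bool (x j \<le> s) * of_bool (\<forall>k\<in>u. x k \<le> t k))\<bar> \<le> disc n X A"
proof -
  \<comment> \<open>If \<open>j\<close> already lies in \<open>u\<close>, two thresholds bind the
    same coordinate and the smaller one counts.\<close>
  let ?t = "\<lambda>k. if k \<in> u then if k = j then min s (t k) else t k else s"
  have eq: "of_bool (x j \<le> s) * of_bool (\<forall>k\<in>u. x k \<le> t k) =
     (of_bool (\<forall>k\<in>insert j u. x k \<le> ?t k) :: real)" for x
  proof -
    have "(\<forall>k\<in>insert j u. x k \<le> ?t k) \<longleftrightarrow> x j \<le> s \<and> (\<forall>k\<in>u. x k \<le> t k)" by auto
    then show ?thesis by (simp add: of_bool_conj)
  qed
  show ?thesis
    unfolding eq by (rule qerr_box_le) (use assms in \<open>auto simp: min_def\<close>)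
qed

lemma qerr_mult_coord_le:
  assumes j: "j \<in> {1..P}" and \<phi>: "\<phi> \<in> bmf P" and B0: "\<bar>qerr \<phi>\<bar> \<le> B0"
    and B: "\<And>s. 0 \<le> s \<Longrightarrow> s \<le> 1 \<Longrightarrow> \<bar>qerr (\<lambda>x. of_bool (x j \<le> s) * \<phi> x)\<bar> \<le> B"
  shows "\<bar>qerr (\<lambda>x. x j * \<phi> x)\<bar> \<le> B0 + B"
proof -
  obtain C where C: "C \<ge> 0" "\<And>x. x \<in> cube P \<Longrightarrow> \<bar>\<phi> x\<bar> \<le> C" using bmf_bounded[OF \<phi>] by metis
  have bound: "\<bar>qerr (\<lambda>x. x j * \<phi> x)\<bar> \<le> B0 + B + 2 * (C / real N)" if N: "N > 0" for N
  proof -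
    \<comment> \<open>A finite average over thresholds instead of an integral over \<open>s\<close>,
      so no Fubini argument in \<open>s\<close> arises. It is exact for the rounded coordinate;
      rounding costs at most \<open>C / N\<close> uniformly, which vanishes in the limit.\<close>
    let ?s = "\<lambda>x. \<Sum>i<N. (1 / real N) * (of_bool (x j \<le> real i / N) * \<phi> x)"
    have s_bmf: "?s \<in> bmf P" by (intro bmf_sum bmf_cmult bmf_mult bmf_of_bool j \<phi>)
    have eq: "\<phi> x - ?s x = grid_up N (x j) * \<phi> x" if x: "x \<in> cube P" for x
    proof -
      have "grid_up N (x j) = 1 - (\<Sum>i<N. (1 / real N) * of_bool (x j \<le> real i / N))"
        using grid_up_telescope[OF N, of "x j" "\<lambda>y. y"] cubeD[OF x j]
        by (simp add: add_divide_distrib)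
      then show ?thesis by (simp add: left_diff_distrib sum_distrib_right mult.assoc)
    qed
    have close: "\<bar>x j * \<phi> x - (\<phi> x - ?s x)\<bar> \<le> C / real N" if x: "x \<in> cube P" for x
    proof -
      have "\<bar>real N * x j - real_of_int \<lceil>real N * x j\<rceil>\<bar> \<le> 1" by linarith
      moreover have "real N * (x j - grid_up N (x j)) = real N * x j - real_of_int \<lceil>real N * x j\<rceil>"
        using N by (simp add: grid_up_def field_simps)
      ultimately have "real N * \<bar>x j - grid_up N (x j)\<bar> \<le> 1"
        by (metis abs_mult abs_of_nat)
      then have d: "\<bar>x j - grid_up N (x j)\<bar> \<le> 1 / real N" using N by (simp add: field_simps)
      have "\<bar>x j * \<phi> x - (\<phi> x - ?s x)\<bar> = \<bar>x j - grid_up N (x j)\<bar> * \<bar>\<phi> x\<bar>"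
        unfolding eq[OF x] by (simp add: abs_mult[symmetric] left_diff_distrib)
      also have "\<dots> \<le> (1 / real N) * C" using d C x by (intro mult_mono) auto
      finally show ?thesis by simp
    qed
    have "\<bar>qerr (\<lambda>x. x j * \<phi> x) - qerr (\<lambda>x. \<phi> x - ?s x)\<bar> \<le> 2 * (C / real N)"
      using qerr_abs_le[of "\<lambda>x. x j * \<phi> x - (\<phi> x - ?s x)", OF _ close] j \<phi> s_bmf
      by (simp add: qerr_diff)
    moreover have "\<bar>qerr (\<lambda>x. \<phi> x - ?s x)\<bar> \<le> B0 + B"
    proof -
      have "qerr ?s = (\<Sum>i<N. (1 / real N) * qerr (\<lambda>x. of_bool (x j \<le> real i / N) * \<phi> x))"
        unfolding qerr_cmult[symmetric]
        by (rule qerr_sum) (intro bmf_cmult bmf_mult bmf_of_bool j \<phi>)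
      also have "\<bar>\<dots>\<bar> \<le> (\<Sum>i<N. (1 / real N) * B)"
        using N by (intro order_trans[OF sum_abs] sum_mono)
          (auto simp: abs_mult intro!: divide_right_mono B)
      also have "\<dots> = B" using N by simp
      finally have "\<bar>qerr ?s\<bar> \<le> B" .
      moreover have "qerr (\<lambda>x. \<phi> x - ?s x) = qerr \<phi> - qerr ?s" using \<phi> s_bmf by (rule qerr_diff)
      ultimately show ?thesis using B0 by linarith
    qed
    ultimately show ?thesis by linarith
  qed
  have "(\<lambda>N. B0 + B + 2 * (C / real N)) \<longlonglongrightarrow> B0 + B + 2 * 0"
    by (intro tendsto_intros lim_const_over_n)
  then show ?thesis
    using bound by (intro LIMSEQ_le_const[of _ "B0 + B"]) (auto intro!: exI[of _ 1])
qed

text \<open>The grid expansion is multiplied by the halfspace indicator and estimated term by term.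
  Nonempty index sets together cost variation times discrepancy, uniformly in \<open>N\<close>; the
  empty one leaves the corner value of \<open>g\<close> times the error of the halfspace itself.
  Continuity of \<open>g\<close> then removes the grid. Since \<open>g\<close> depends on
  \<open>W\<close> only, \<open>A\<close> has to contain no more than \<open>W\<close> and
  \<open>j\<close>.\<close>

lemma koksma_hlawka_halfspace:
  assumes A: "insert j W \<subseteq> A" "A \<subseteq> {1..P}" and g: "continuous_on (cube P) g"
    and dep: "\<And>x y. x \<in> cube P \<Longrightarrow> y \<in> cube P \<Longrightarrow> (\<forall>k\<in>W. x k = y k) \<Longrightarrow> g x = g y"
    and V: "VHK {1..P} g < \<infinity>" and s: "0 \<le> s" "s \<le> 1"
  shows "\<bar>qerr (\<lambda>x. of_bool (x j \<le> s) * g x)\<bar> \<le>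
    real_of_ereal (VHK {1..P} g) * disc n X A
      + \<bar>g (\<lambda>k. if k \<in> {1..P} then 1 else undefined)\<bar> * \<bar>qerr (\<lambda>x. of_bool (x j \<le> s))\<bar>"
    (is "_ \<le> ?V * ?D + ?g1 * ?q1")
proof -
  let ?gp = "\<lambda>N x. grid_pt N {1..P} W x"
  let ?b = "\<lambda>x. of_bool (x j \<le> s) :: real"
  have W: "W \<subseteq> {1..P}" and j: "j \<in> {1..P}" using A by auto
  have finW: "finite W" using W finite_subset by blast
  have g_bmf: "g \<in> bmf P" using g by (rule continuous_on_imp_bmf)
  obtain C where C: "C \<ge> 0" "\<And>x. x \<in> cube P \<Longrightarrow> \<bar>g x\<bar> \<le> C" using bmf_bounded[OF g_bmf] by metis
  let ?T = "\<lambda>N u \<kappa> x. (-1) ^ card u * cell_delta N {1..P} u g \<kappa> *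
      (?b x * of_bool (\<forall>k\<in>u. x k \<le> real (\<kappa> k) / N))"
  let ?S = "\<lambda>N x. \<Sum>u\<in>Pow W. \<Sum>\<kappa>\<in>PiE u (\<lambda>_. {..<N}). ?T N u \<kappa> x"
  have T_bmf: "?T N u \<kappa> \<in> bmf P" if "u \<in> Pow W" for N u \<kappa>
    using that W j by (intro bmf_cmult bmf_mult bmf_of_bool bmf_box) auto
  have S_bmf: "?S N \<in> bmf P" for N by (intro bmf_sum T_bmf)
  have expand: "?S N x = ?b x * g (?gp N x)" if N: "N > 0" and x: "x \<in> cube P" for N x
  proof -
    have "0 \<le> x k \<and> x k \<le> 1" if "k \<in> W" for k using cubeD[OF x] that W by blast
    then have "g (?gp N x) = (\<Sum>u\<in>Pow W. \<Sum>\<kappa>\<in>PiE u (\<lambda>_. {..<N}).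
        (-1) ^ card u * cell_delta N {1..P} u g \<kappa> * of_bool (\<forall>k\<in>u. x k \<le> real (\<kappa> k) / N))"
      by (rule grid_expansion[OF N finW W])
    then show ?thesis by (simp only: sum_distrib_left mult_ac)
  qed
  have step: "\<bar>qerr (?S N)\<bar> \<le> ?V * ?D + ?g1 * ?q1" if N: "N > 0" for N
  proof -
    let ?a = "\<lambda>u \<kappa>. \<bar>cell_delta N {1..P} u g \<kappa>\<bar>"
    let ?q = "\<lambda>u \<kappa>. \<bar>qerr (\<lambda>x. ?b x * of_bool (\<forall>k\<in>u. x k \<le> real (\<kappa> k) / N))\<bar>"
    let ?K = "\<lambda>u. PiE u (\<lambda>_. {..<N})"
    have sum_eq: "qerr (?S N) = (\<Sum>u\<in>Pow W. \<Sum>\<kappa>\<in>?K u. qerr (?T N u \<kappa>))"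
      by (subst qerr_sum, rule bmf_sum, erule T_bmf, rule sum.cong[OF refl], rule qerr_sum, erule T_bmf)
    have "\<bar>qerr (?S N)\<bar> \<le> (\<Sum>u\<in>Pow W. \<Sum>\<kappa>\<in>?K u. \<bar>qerr (?T N u \<kappa>)\<bar>)"
      unfolding sum_eq by (rule order_trans[OF sum_abs], rule sum_mono, rule sum_abs)
    also have "\<dots> = (\<Sum>u\<in>Pow W. \<Sum>\<kappa>\<in>?K u. ?a u \<kappa> * ?q u \<kappa>)"
    proof (intro sum.cong refl)
      fix u :: "nat set" and \<kappa> :: "nat \<Rightarrow> nat"
      have "\<bar>(-1) ^ card u\<bar> = (1::real)" by (simp add: power_abs)
      then show "\<bar>qerr (?T N u \<kappa>)\<bar> = ?a u \<kappa> * ?q u \<kappa>"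
        by (subst qerr_cmult) (simp only: abs_mult mult_1_left)
    qed
    also have "\<dots> = (\<Sum>\<kappa>\<in>?K {}. ?a {} \<kappa> * ?q {} \<kappa>)
         + (\<Sum>u\<in>Pow W - {{}}. \<Sum>\<kappa>\<in>?K u. ?a u \<kappa> * ?q u \<kappa>)"
      using finW by (intro sum.remove) auto
    finally have split: "\<bar>qerr (?S N)\<bar> \<le> \<dots>" .
    have empty: "(\<Sum>\<kappa>\<in>?K {}. ?a {} \<kappa> * ?q {} \<kappa>) = ?g1 * ?q1"
      by (simp add: cell_delta_def delta_box_empty)
    have "(\<Sum>u\<in>Pow W - {{}}. \<Sum>\<kappa>\<in>?K u. ?a u \<kappa> * ?q u \<kappa>) \<le>
        (\<Sum>u\<in>Pow W - {{}}. \<Sum>\<kappa>\<in>?K u. ?a u \<kappa> * ?D)"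
    proof (intro sum_mono mult_left_mono abs_ge_zero qerr_halfspace_box_le)
      fix u \<kappa> k assume "u \<in> Pow W - {{}}" "\<kappa> \<in> ?K u" "k \<in> u"
      then have "\<kappa> k < N" by auto
      then show "0 \<le> real (\<kappa> k) / N \<and> real (\<kappa> k) / N \<le> 1" by simp
    qed (use A s in auto)
    also have "\<dots> = (\<Sum>u\<in>Pow W - {{}}. \<Sum>\<kappa>\<in>?K u. ?a u \<kappa>) * ?D"
      by (simp add: sum_distrib_right)
    also have "\<dots> \<le> ?V * ?D"
      by (intro mult_right_mono disc_nonneg grid_sum_le_VHK) (use N W V in auto)
    finally show ?thesis using split unfolding empty by linarith
  qed
  have gp_cube: "?gp N x \<in> cube P" if "N > 0" "x \<in> cube P" for N x
  proof -
    have "0 \<le> grid_up N (x k) \<and> grid_up N (x k) \<le> 1" if "k \<in> W" for k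
    proof -
      have xk: "0 \<le> x k" "x k \<le> 1" using cubeD[OF \<open>x \<in> cube P\<close>] that W by auto
      have "real N * x k \<le> real N" using xk by (simp add: mult_left_le)
      then have "\<lceil>real N * x k\<rceil> \<le> int N" by linarith
      then have "real_of_int \<lceil>real N * x k\<rceil> \<le> real N" by linarith
      moreover have "0 \<le> real N * x k" using xk by simp
      then have "0 \<le> real_of_int \<lceil>real N * x k\<rceil>" by linarith
      ultimately have "0 \<le> real_of_int \<lceil>real N * x k\<rceil>" "real_of_int \<lceil>real N * x k\<rceil> \<le> real N" by auto
      then show ?thesis using \<open>N > 0\<close> by (simp add: grid_up_def divide_le_eq_1)
    qed
    then show ?thesis using W by (auto simp: cube_def grid_pt_def PiE_iff extensional_def subset_iff)
  qed
  have lim: "(\<lambda>N. g (?gp (Suc N) x)) \<longlonglongrightarrow> g x" if x: "x \<in> cube P" for x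
  proof -
    \<comment> \<open>Grid points have coordinate 1 outside \<open>W\<close>, so they converge to
      this \<open>y\<close> and not to \<open>x\<close>; \<open>dep\<close> identifies the two
      values of \<open>g\<close>.\<close>
    define y where "y = (\<lambda>k. if k \<in> W then x k else if k \<in> {1..P} then 1 else undefined)"
    have y: "y \<in> cube P"
      using W cubeD[OF x] by (auto simp: y_def cube_def PiE_iff extensional_def subset_iff)
    have "(\<lambda>N. ?gp (Suc N) x) \<longlonglongrightarrow> y"
    proof (rule tendsto_fun_coordinatewise)
      fix k
      show "(\<lambda>N. ?gp (Suc N) x k) \<longlonglongrightarrow> y k"
      proof (cases "k \<in> W")
        case True
        have "(\<lambda>N. grid_up (Suc N) (x k)) \<longlonglongrightarrow> x k"
        proof (rule real_tendsto_sandwich)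
          have up: "x k \<le> grid_up (Suc N) (x k) \<and> grid_up (Suc N) (x k) \<le> x k + 1 / real (Suc N)" for N
          proof -
            have "real (Suc N) * x k \<le> real_of_int \<lceil>real (Suc N) * x k\<rceil>"
              "real_of_int \<lceil>real (Suc N) * x k\<rceil> \<le> real (Suc N) * x k + 1" by linarith+
            then show ?thesis unfolding grid_up_def by (simp add: field_simps del: of_nat_Suc)
          qed
          show "\<forall>\<^sub>F N in sequentially. x k \<le> grid_up (Suc N) (x k)"
            "\<forall>\<^sub>F N in sequentially. grid_up (Suc N) (x k) \<le> x k + 1 / real (Suc N)"
            using up by auto
          show "(\<lambda>N. x k + 1 / real (Suc N)) \<longlonglongrightarrow> x k"
            using tendsto_add[OF tendsto_const LIMSEQ_inverse_real_of_nat, of "x k"]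
            by (simp add: inverse_eq_divide)
        qed simp
        then show ?thesis using True by (simp add: grid_pt_def y_def)
      qed (simp add: grid_pt_def y_def)
    qed
    then have "(\<lambda>N. g (?gp (Suc N) x)) \<longlonglongrightarrow> g y"
      by (rule continuous_on_tendsto_compose[OF g _ y]) (use gp_cube x in auto)
    also have "g y = g x" by (rule dep) (use x y in \<open>auto simp: y_def\<close>)
    finally show ?thesis .
  qed
  have lim': "(\<lambda>N. ?S (Suc N) x) \<longlonglongrightarrow> ?b x * g x" if x: "x \<in> cube P" for x
    unfolding expand[OF zero_less_Suc x] by (rule tendsto_mult[OF tendsto_const lim[OF x]])
  have "(\<lambda>N. mean (?S (Suc N))) \<longlonglongrightarrow> mean (\<lambda>x. ?b x * g x)"
    unfolding mean_def by (intro tendsto_divide tendsto_sum lim' pt_cube tendsto_const) (use n_pos in auto)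
  \<comment> \<open>The expansion equals the indicator times a value of \<open>g\<close> on the
    cube, so the bound of \<open>g\<close> dominates for every \<open>N\<close>.\<close>
  moreover have "(\<lambda>N. cube_int P (?S (Suc N))) \<longlonglongrightarrow> cube_int P (\<lambda>x. ?b x * g x)"
    unfolding cube_int_def
  proof (rule integral_dominated_convergence[where w = "\<lambda>_. C"])
    show "integrable (cubeM P) (\<lambda>_. C)" by (rule bmf_integrable) simp
    show "AE x in cubeM P. (\<lambda>N. ?S (Suc N) x) \<longlonglongrightarrow> ?b x * g x"
      by (rule AE_I2) (use lim' in \<open>simp add: space_cubeM\<close>)
    show "AE x in cubeM P. norm (?S (Suc N) x) \<le> C" for N
    proof (rule AE_I2)
      fix x assume "x \<in> space (cubeM P)"
      then have x: "x \<in> cube P" by (simp add: space_cubeM)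
      have "\<bar>?b x * g (?gp (Suc N) x)\<bar> \<le> C" using C(1) C(2)[OF gp_cube[OF _ x, of "Suc N"]] by auto
      then show "norm (?S (Suc N) x) \<le> C" unfolding expand[OF zero_less_Suc x] by simp
    qed
    show "(\<lambda>x. ?b x * g x) \<in> borel_measurable (cubeM P)"
      by (rule bmf_measurable) (use j g_bmf in simp)
    show "?S (Suc N) \<in> borel_measurable (cubeM P)" for N by (rule bmf_measurable) (rule S_bmf)
  qed
  ultimately have "(\<lambda>N. qerr (?S (Suc N))) \<longlonglongrightarrow> qerr (\<lambda>x. ?b x * g x)"
    unfolding qerr_def by (rule tendsto_diff)
  then have "(\<lambda>N. \<bar>qerr (?S (Suc N))\<bar>) \<longlonglongrightarrow> \<bar>qerr (\<lambda>x. ?b x * g x)\<bar>"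
    by (rule tendsto_rabs)
  then show ?thesis
    by (rule LIMSEQ_le_const2) (intro exI[of _ 0] allI impI step zero_less_Suc)
qed

end

section \<open>Linear approximation in centred coordinates\<close>

definition ctr :: "nat \<Rightarrow> (nat \<Rightarrow> real) \<Rightarrow> real" where
  "ctr j x = x j - 1/2"

definition lin :: "nat set \<Rightarrow> real \<Rightarrow> (nat \<Rightarrow> real) \<Rightarrow> (nat \<Rightarrow> real) \<Rightarrow> real" where
  "lin A b0 b x = b0 + (\<Sum>j\<in>A. b j * ctr j x)"

text \<open>Under the uniform distribution this is the covariance of \<open>f x\<close> with
  \<open>x j\<close>, the quantity that (A1) keeps away from 0; see
  \<open>cov_eq_moment_diff\<close>.\<close>

definition cov :: "nat \<Rightarrow> ((nat \<Rightarrow> real) \<Rightarrow> real) \<Rightarrow> nat \<Rightarrow> real" where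
  "cov P f j = cube_int P (\<lambda>x. f x * ctr j x)"

text \<open>Given by explicit coefficients rather than through \<open>blin\<close>, so that its
  orthogonality relations come first and then identify the minimiser.\<close>

definition res :: "nat \<Rightarrow> ((nat \<Rightarrow> real) \<Rightarrow> real) \<Rightarrow> nat set \<Rightarrow> (nat \<Rightarrow> real) \<Rightarrow> real" where
  "res P f A x = f x - lin A (cube_int P f) (\<lambda>j. 12 * cov P f j) x"

lemma bmf_ctr [simp]: "j \<in> {1..P} \<Longrightarrow> ctr j \<in> bmf P"
  unfolding ctr_def by (intro bmf_diff bmf_coord bmf_const)

lemma bmf_lin [simp]: "A \<subseteq> {1..P} \<Longrightarrow> lin A b0 b \<in> bmf P"
  unfolding lin_def by (intro bmf_add bmf_const bmf_sum bmf_cmult bmf_ctr) auto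

lemma bmf_res [simp]: "f \<in> bmf P \<Longrightarrow> A \<subseteq> {1..P} \<Longrightarrow> res P f A \<in> bmf P"
  unfolding res_def by (intro bmf_diff bmf_lin)

lemma ctr_abs_le: "x \<in> cube P \<Longrightarrow> j \<in> {1..P} \<Longrightarrow> \<bar>ctr j x\<bar> \<le> 1/2"
  using cubeD[of x P j] unfolding ctr_def by linarith

lemma cube_int_ctr_eq [simp]: "j \<in> {1..P} \<Longrightarrow> cube_int P (ctr j) = 0"
  using cube_int_ctr[of j P] by (simp add: ctr_def[abs_def])

lemma cube_int_ctr_ctr:
  "j \<in> {1..P} \<Longrightarrow> k \<in> {1..P} \<Longrightarrow> cube_int P (\<lambda>x. ctr j x * ctr k x) = (if j = k then 1/12 else 0)"
  unfolding ctr_def by (rule cube_int_ctr_mult)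

lemma cube_int_mult_lin:
  assumes "A \<subseteq> {1..P}" "g \<in> bmf P"
  shows "cube_int P (\<lambda>x. g x * lin A b0 b x) = b0 * cube_int P g + (\<Sum>j\<in>A. b j * cov P g j)"
proof -
  have "(\<lambda>x. g x * lin A b0 b x) = (\<lambda>x. b0 * g x + (\<Sum>j\<in>A. b j * (g x * ctr j x)))"
    by (simp add: lin_def algebra_simps sum_distrib_left fun_eq_iff)
  moreover have t: "(\<lambda>x. b j * (g x * ctr j x)) \<in> bmf P" if "j \<in> A" for j
    using that assms by (intro bmf_cmult bmf_mult bmf_ctr) auto
  ultimately show ?thesis
    by (simp only: cube_int_add[OF bmf_cmult[OF assms(2)] bmf_sum[OF t]] cube_int_sum[OF t])
      (simp only: cube_int_cmult cov_def)
qed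

lemma cov_lin:
  assumes "A \<subseteq> {1..P}" "k \<in> {1..P}"
  shows "cov P (lin A b0 b) k = (if k \<in> A then b k / 12 else 0)"
proof -
  have fin: "finite A" using assms(1) finite_subset by blast
  have "cov P (lin A b0 b) k = cube_int P (\<lambda>x. ctr k x * lin A b0 b x)"
    by (simp add: cov_def mult.commute)
  also have "\<dots> = (\<Sum>j\<in>A. b j * cov P (ctr k) j)"
    using assms by (simp add: cube_int_mult_lin)
  also have "\<dots> = (\<Sum>j\<in>A. if j = k then b k / 12 else 0)"
    using assms by (intro sum.cong) (auto simp: cov_def cube_int_ctr_ctr subset_iff)
  finally show ?thesis using fin by simp
qed

lemma cube_int_lin:
  assumes "A \<subseteq> {1..P}" shows "cube_int P (lin A b0 b) = b0"
proof -
  have "cov P (\<lambda>_. 1) j = 0" if "j \<in> A" for j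
    using that assms by (simp add: cov_def subset_iff)
  then show ?thesis using cube_int_mult_lin[OF assms, of "\<lambda>_. 1" b0 b] by simp
qed

lemma cube_int_lin_sq:
  assumes "A \<subseteq> {1..P}"
  shows "cube_int P (\<lambda>x. (lin A b0 b x)\<^sup>2) = b0\<^sup>2 + (\<Sum>j\<in>A. (b j)\<^sup>2) / 12"
proof -
  have "cube_int P (\<lambda>x. (lin A b0 b x)\<^sup>2) = b0 * b0 + (\<Sum>j\<in>A. b j * cov P (lin A b0 b) j)"
    unfolding power2_eq_square using assms by (simp add: cube_int_mult_lin cube_int_lin)
  also have "(\<Sum>j\<in>A. b j * cov P (lin A b0 b) j) = (\<Sum>j\<in>A. (b j)\<^sup>2 / 12)"
    using assms by (intro sum.cong) (auto simp: cov_lin subset_iff power2_eq_square)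
  finally show ?thesis by (simp add: power2_eq_square sum_divide_distrib)
qed

lemma cube_int_res:
  "f \<in> bmf P \<Longrightarrow> A \<subseteq> {1..P} \<Longrightarrow> cube_int P (res P f A) = 0"
  unfolding res_def by (simp add: cube_int_diff cube_int_lin)

lemma cov_res:
  assumes "f \<in> bmf P" "A \<subseteq> {1..P}" "k \<in> {1..P}"
  shows "cov P (res P f A) k = (if k \<in> A then 0 else cov P f k)"
proof -
  have "cov P (res P f A) k = cube_int P (\<lambda>x. f x * ctr k x - lin A (cube_int P f) (\<lambda>j. 12 * cov P f j) x * ctr k x)"
    by (simp add: cov_def res_def left_diff_distrib)
  also have "\<dots> = cov P f k - cov P (lin A (cube_int P f) (\<lambda>j. 12 * cov P f j)) k"
    unfolding cov_def using assms by (intro cube_int_diff bmf_mult bmf_ctr bmf_lin)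
  finally show ?thesis using assms by (simp add: cov_lin)
qed

lemma cube_int_res_lin:
  assumes "f \<in> bmf P" "A \<subseteq> {1..P}"
  shows "cube_int P (\<lambda>x. res P f A x * lin A b0 b x) = 0"
  using assms by (subst cube_int_mult_lin) (auto simp: cube_int_res cov_res subset_iff)

lemma diff_square_expand: "(u - v)\<^sup>2 = u\<^sup>2 - 2 * (u * v) + v\<^sup>2" for u v :: real
  by (simp add: power2_eq_square algebra_simps)

lemma cube_int_res_minus_lin_sq:
  assumes "f \<in> bmf P" "A \<subseteq> {1..P}"
  shows "cube_int P (\<lambda>x. (res P f A x - lin A b0 b x)\<^sup>2) =
    cube_int P (\<lambda>x. (res P f A x)\<^sup>2) + b0\<^sup>2 + (\<Sum>j\<in>A. (b j)\<^sup>2) / 12"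
proof -
  have "cube_int P (\<lambda>x. (res P f A x - lin A b0 b x)\<^sup>2) =
      cube_int P (\<lambda>x. (res P f A x)\<^sup>2) - cube_int P (\<lambda>x. 2 * (res P f A x * lin A b0 b x))
      + cube_int P (\<lambda>x. (lin A b0 b x)\<^sup>2)"
    unfolding diff_square_expand using assms
    by (simp only: cube_int_add cube_int_diff bmf_diff bmf_power bmf_cmult bmf_mult bmf_res bmf_lin)
  then show ?thesis
    by (simp only: cube_int_cmult cube_int_res_lin[OF assms] cube_int_lin_sq[OF assms(2)])
qed

text \<open>A one-to-one change of parameters: each competitor becomes the fixed residual minus a
  perturbation. The population and the sample minimisation are both treated in this form.\<close>

lemma raw_to_centred:
  assumes "finite A"
  shows "f x - c - (\<Sum>j\<in>A. \<phi> j * x j) =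
    res P f A x - lin A (c + (\<Sum>j\<in>A. \<phi> j) / 2 - cube_int P f) (\<lambda>j. \<phi> j - 12 * cov P f j) x"
proof -
  have "(\<Sum>j\<in>A. \<phi> j * x j) = (\<Sum>j\<in>A. \<phi> j * ctr j x) + (\<Sum>j\<in>A. \<phi> j) / 2"
    by (simp add: ctr_def right_diff_distrib sum_subtractf sum_divide_distrib)
  then show ?thesis
    by (simp add: res_def lin_def left_diff_distrib sum_subtractf)
qed

text \<open>By Pythagoras the excess error is a sum of squares. It vanishes only for the stated
  coefficients on \<open>A\<close>, and the convention of zeros outside \<open>A\<close> fixes the
  rest, which gives the uniqueness that \<open>THE\<close> demands.\<close>

lemma blin_eq:
  assumes f: "f \<in> bmf P" and A: "A \<subseteq> {1..P}"
  shows "blin P f A = (cube_int P f - (\<Sum>j\<in>A. 12 * cov P f j) / 2, \<lambda>j. if j \<in> A then 12 * cov P f j else 0)"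
    (is "_ = (?c, ?\<phi>)")
proof -
  have fin: "finite A" using A finite_subset by blast
  define E where "E = cube_int P (\<lambda>x. (res P f A x)\<^sup>2)"
  have err: "sq_err P f A c \<phi> = E + (c + (\<Sum>j\<in>A. \<phi> j) / 2 - cube_int P f)\<^sup>2
      + (\<Sum>j\<in>A. (\<phi> j - 12 * cov P f j)\<^sup>2) / 12" for c \<phi>
    unfolding sq_err_def E_def raw_to_centred[OF fin, where P = P] by (rule cube_int_res_minus_lin_sq[OF f A])
  have opt: "sq_err P f A ?c ?\<phi> = E" unfolding err by simp
  have ge: "E \<le> sq_err P f A c \<phi>" for c \<phi>
    unfolding err using sum_nonneg[of A "\<lambda>j. (\<phi> j - 12 * cov P f j)\<^sup>2"] by simp
  show ?thesis
    unfolding blin_def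
  proof (rule the_equality)
    show "is_blin P f A (fst (?c, ?\<phi>)) (snd (?c, ?\<phi>))"
      unfolding is_blin_def fst_conv snd_conv opt using ge by simp
  next
    fix cp assume "is_blin P f A (fst cp) (snd cp)"
    moreover obtain c \<phi> where cp: "cp = (c, \<phi>)" by (cases cp)
    ultimately have zero: "\<And>k. k \<notin> A \<Longrightarrow> \<phi> k = 0" and "sq_err P f A c \<phi> \<le> sq_err P f A ?c ?\<phi>"
      unfolding is_blin_def by auto
    then have "(c + (\<Sum>j\<in>A. \<phi> j) / 2 - cube_int P f)\<^sup>2 + (\<Sum>j\<in>A. (\<phi> j - 12 * cov P f j)\<^sup>2) / 12 \<le> 0"
      unfolding opt err by simp
    moreover have "0 \<le> (\<Sum>j\<in>A. (\<phi> j - 12 * cov P f j)\<^sup>2)" by (intro sum_nonneg) simp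
    ultimately have c0: "(c + (\<Sum>j\<in>A. \<phi> j) / 2 - cube_int P f)\<^sup>2 = 0"
      and s0: "(\<Sum>j\<in>A. (\<phi> j - 12 * cov P f j)\<^sup>2) = 0"
      using zero_le_power2[of "c + (\<Sum>j\<in>A. \<phi> j) / 2 - cube_int P f"] by linarith+
    have \<phi>: "\<phi> j = 12 * cov P f j" if "j \<in> A" for j
      using s0 fin that by (simp add: sum_nonneg_eq_0_iff)
    then have "\<phi> = ?\<phi>" using zero by auto
    moreover have "c = ?c" using c0 \<phi> by simp
    ultimately show "cp = (?c, ?\<phi>)" by (simp add: cp)
  qed
qed

text \<open>In \<open>lin_res\<close> the approximation belongs to \<open>f\<close> but is
  subtracted from \<open>ft\<close>. The correction turns the bound \<open>C4\<close> on
  \<open>lin_res\<close> into \<open>C4 + eta\<close> on the residual of \<open>f\<close>.\<close>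

lemma lin_res_eq:
  assumes "f \<in> bmf P" "A \<subseteq> {1..P}"
  shows "lin_res p0 P f ft A x = res P f A x - (f x - ft (restrict x {1..p0}))"
proof -
  have fin: "finite A" using assms(2) finite_subset by blast
  have "(\<Sum>j\<in>{1..P}. x j * betaZ P f A j) = (\<Sum>j\<in>A. x j * (12 * cov P f j))"
    unfolding betaZ_def blin_eq[OF assms] snd_conv
    by (rule sum.mono_neutral_cong_right) (use assms(2) in auto)
  also have "\<dots> = (\<Sum>j\<in>A. 12 * cov P f j * ctr j x) + (\<Sum>j\<in>A. 12 * cov P f j) / 2"
    by (simp add: ctr_def algebra_simps sum_subtractf sum_divide_distrib sum.distrib[symmetric])
  finally show ?thesis
    unfolding lin_res_def beta0_def blin_eq[OF assms] fst_conv res_def lin_def by simp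
qed

section \<open>Separation of the residual sums of squares\<close>

text \<open>Cauchy-Schwarz with weights 1 and 1/12, hence the factor \<open>1 + 12 * M\<close>. The
  last factor on the right is the exact mean square of \<open>lin A b0 b\<close>, while quadrature
  errors are naturally bounded by the l1 norm on the left.\<close>

lemma weighted_l1_le_l2:
  fixes b0 M :: real and b :: "nat \<Rightarrow> real"
  assumes "finite A" "real (card A) \<le> M" "1 \<le> M"
  shows "(\<bar>b0\<bar> + (\<Sum>j\<in>A. \<bar>b j\<bar>))\<^sup>2 \<le> (1 + 12 * M) * (b0\<^sup>2 + (\<Sum>j\<in>A. (b j)\<^sup>2) / 12)"
proof -
  define v s where "v = (\<Sum>j\<in>A. \<bar>b j\<bar>)" and "s = (\<Sum>j\<in>A. (b j)\<^sup>2)"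
  have s0: "0 \<le> s" unfolding s_def by (rule sum_nonneg) simp
  have "v\<^sup>2 \<le> (\<Sum>j\<in>A. 1\<^sup>2) * (\<Sum>j\<in>A. \<bar>b j\<bar>\<^sup>2)"
    using Cauchy_Schwarz_ineq_sum[of "\<lambda>_. 1" "\<lambda>j. \<bar>b j\<bar>" A] by (simp add: v_def)
  also have "\<dots> = real (card A) * s" by (simp add: s_def)
  also have "\<dots> \<le> M * s" using assms(2) s0 by (rule mult_right_mono)
  finally have v: "v\<^sup>2 \<le> M * s" .
  have "0 \<le> (12 * M * \<bar>b0\<bar> - v)\<^sup>2" by simp
  then have "24 * M * (\<bar>b0\<bar> * v) \<le> 144 * M\<^sup>2 * b0\<^sup>2 + v\<^sup>2"
    by (simp add: power2_eq_square algebra_simps)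
  also have "\<dots> \<le> 144 * M\<^sup>2 * b0\<^sup>2 + M * s" using v by simp
  also have "\<dots> = 12 * M * (12 * M * b0\<^sup>2 + s / 12)" by (simp add: power2_eq_square algebra_simps)
  finally have "12 * M * (2 * (\<bar>b0\<bar> * v)) \<le> 12 * M * (12 * M * b0\<^sup>2 + s / 12)" by simp
  then have "2 * (\<bar>b0\<bar> * v) \<le> 12 * M * b0\<^sup>2 + s / 12"
    by (rule mult_left_le_imp_le) (use assms(3) in simp)
  moreover have "(\<bar>b0\<bar> + v)\<^sup>2 = b0\<^sup>2 + 2 * (\<bar>b0\<bar> * v) + v\<^sup>2"
    by (simp add: power2_sum)
  ultimately have "(\<bar>b0\<bar> + v)\<^sup>2 \<le> b0\<^sup>2 + (12 * M * b0\<^sup>2 + s / 12) + M * s" using v by linarith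
  also have "\<dots> = (1 + 12 * M) * (b0\<^sup>2 + s / 12)" by (simp add: algebra_simps)
  finally show ?thesis by (simp add: v_def s_def)
qed

lemma cov_abs_le:
  assumes "f \<in> bmf P" "j \<in> {1..P}" "\<And>x. x \<in> cube P \<Longrightarrow> \<bar>f x\<bar> \<le> B"
  shows "\<bar>cov P f j\<bar> \<le> B / 2"
  unfolding cov_def
proof (rule cube_int_abs_le)
  show "(\<lambda>x. f x * ctr j x) \<in> bmf P" using assms by (intro bmf_mult bmf_ctr)
  fix x assume x: "x \<in> cube P"
  then have "\<bar>f x\<bar> * \<bar>ctr j x\<bar> \<le> B * (1/2)"
    using assms(3)[OF x] ctr_abs_le[OF x assms(2)] by (intro mult_mono) auto
  then show "\<bar>f x * ctr j x\<bar> \<le> B / 2" by (simp add: abs_mult)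
qed

lemma cov_diff:
  "f \<in> bmf P \<Longrightarrow> h \<in> bmf P \<Longrightarrow> j \<in> {1..P} \<Longrightarrow> cov P (\<lambda>x. f x - h x) j = cov P f j - cov P h j"
  unfolding cov_def left_diff_distrib by (intro cube_int_diff bmf_mult bmf_ctr)

context design
begin

section \<open>Quadrature errors of quadratic polynomials through pairwise discrepancies\<close>

lemma disc_le_D2:
  assumes "A \<in> U2 P" shows "disc n X A \<le> D2 P n X"
proof -
  have "finite (U2 P)" by (rule finite_subset[of _ "Pow {1..P}"]) (auto simp: U2_def)
  then show ?thesis unfolding D2_def maxz_def using assms by (intro Max_ge) auto
qed

text \<open>For \<open>j = k\<close> the pair is filled up with another coordinate, which exists
  since \<open>P \<ge> 2\<close>. Pairwise discrepancies thus also control single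
  coordinates.\<close>

lemma disc_pair_le_D2:
  assumes "j \<in> {1..P}" "k \<in> {1..P}"
  obtains A where "{j, k} \<subseteq> A" "A \<subseteq> {1..P}" "disc n X A \<le> D2 P n X"
proof -
  obtain l where l: "l \<in> {1..P}" "l \<noteq> j"
    using P_ge_2 by (metis atLeastAtMost_iff le_numeral_extra(4) nat_le_linear numeral_le_one_iff
        one_le_numeral order_trans semiring_norm(69))
  define A where "A = (if j = k then {j, l} else {j, k})"
  have "A \<in> U2 P" using assms l by (auto simp: A_def U2_def)
  then show thesis using that[of A] disc_le_D2 by (auto simp: A_def U2_def split: if_splits)
qed

lemma qerr_half_le:
  assumes "j \<in> {1..P}" "0 \<le> s" "s \<le> 1"
  shows "\<bar>qerr (\<lambda>x. of_bool (x j \<le> s))\<bar> \<le> D2 P n X"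
proof -
  obtain A where A: "{j, j} \<subseteq> A" "A \<subseteq> {1..P}" "disc n X A \<le> D2 P n X"
    using disc_pair_le_D2[OF assms(1,1)] .
  then show ?thesis using qerr_box_le[of "{j}" A "\<lambda>_. s"] assms by simp
qed

lemma qerr_half_half_le:
  assumes "j \<in> {1..P}" "k \<in> {1..P}" "0 \<le> s" "s \<le> 1" "0 \<le> t" "t \<le> 1"
  shows "\<bar>qerr (\<lambda>x. of_bool (x j \<le> s) * of_bool (x k \<le> t))\<bar> \<le> D2 P n X"
proof -
  obtain A where A: "{j, k} \<subseteq> A" "A \<subseteq> {1..P}" "disc n X A \<le> D2 P n X"
    using disc_pair_le_D2[OF assms(1,2)] .
  then show ?thesis using qerr_halfspace_box_le[of j "{k}" A "\<lambda>_. t" s] assms by simp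
qed

lemma qerr_coord_le:
  assumes j: "j \<in> {1..P}" shows "\<bar>qerr (\<lambda>x. x j)\<bar> \<le> D2 P n X"
  using qerr_mult_coord_le[OF j, of "\<lambda>_. 1" 0 "D2 P n X"] qerr_half_le[OF j] by simp

text \<open>Nested use of \<open>qerr_mult_coord_le\<close>: one \<open>D2\<close> for
  \<open>x k\<close> alone, one for the halfspace in \<open>j\<close>, one for the quadrants in
  \<open>j\<close> and \<open>k\<close>.\<close>

lemma qerr_coord_coord_le:
  assumes j: "j \<in> {1..P}" and k: "k \<in> {1..P}"
  shows "\<bar>qerr (\<lambda>x. x j * x k)\<bar> \<le> 3 * D2 P n X"
proof -
  have "\<bar>qerr (\<lambda>x. x j * x k)\<bar> \<le> D2 P n X + (D2 P n X + D2 P n X)"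
  proof (rule qerr_mult_coord_le[OF j bmf_coord[OF k] qerr_coord_le[OF k]])
    fix s :: real assume s: "0 \<le> s" "s \<le> 1"
    have "\<bar>qerr (\<lambda>x. x k * of_bool (x j \<le> s))\<bar> \<le> D2 P n X + D2 P n X"
      by (rule qerr_mult_coord_le[OF k bmf_of_bool[OF j] qerr_half_le[OF j s]])
        (rule qerr_half_half_le[OF k j _ _ s])
    then show "\<bar>qerr (\<lambda>x. of_bool (x j \<le> s) * x k)\<bar> \<le> D2 P n X + D2 P n X"
      by (simp only: mult.commute)
  qed
  then show ?thesis by simp
qed

lemma qerr_ctr_le:
  assumes "j \<in> {1..P}" shows "\<bar>qerr (ctr j)\<bar> \<le> D2 P n X"
proof -
  have "qerr (ctr j) = qerr (\<lambda>x. x j) - qerr (\<lambda>_. 1/2)"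
    unfolding ctr_def by (rule qerr_diff) (use assms in auto)
  then show ?thesis using qerr_coord_le[OF assms] by simp
qed

lemma D2_nonneg: "0 \<le> D2 P n X"
  using qerr_ctr_le[of 1] P_ge_2 by (force intro: order_trans[OF abs_ge_zero])

lemma qerr_mult_ctr:
  assumes "g \<in> bmf P" "j \<in> {1..P}"
  shows "qerr (\<lambda>x. g x * ctr j x) = qerr (\<lambda>x. x j * g x) - qerr g / 2"
proof -
  have "qerr (\<lambda>x. g x * ctr j x) = qerr (\<lambda>x. x j * g x - (1/2) * g x)"
    by (rule qerr_cong) (simp add: ctr_def algebra_simps)
  also have "\<dots> = qerr (\<lambda>x. x j * g x) - qerr (\<lambda>x. (1/2) * g x)"
    using assms by (intro qerr_diff bmf_mult bmf_coord bmf_const)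
  finally show ?thesis by (simp only: qerr_cmult)
qed

text \<open>The 4 is 3 from the product of raw coordinates plus 1/2 from each of the two
  centrings.\<close>

lemma qerr_ctr_ctr_le:
  assumes j: "j \<in> {1..P}" and k: "k \<in> {1..P}"
  shows "\<bar>qerr (\<lambda>x. ctr j x * ctr k x)\<bar> \<le> 4 * D2 P n X"
proof -
  have "qerr (\<lambda>x. ctr j x * ctr k x) = qerr (\<lambda>x. x k * ctr j x) - qerr (ctr j) / 2"
    using j k by (intro qerr_mult_ctr bmf_ctr)
  moreover have "qerr (\<lambda>x. x k * ctr j x) = qerr (\<lambda>x. x j * x k) - qerr (\<lambda>x. x k) / 2"
    using j k by (intro qerr_mult_ctr bmf_coord)
  ultimately show ?thesis
    using qerr_coord_coord_le[OF j k] qerr_coord_le[OF k] qerr_ctr_le[OF j] by linarith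
qed

lemma qerr_mult_lin:
  assumes "A \<subseteq> {1..P}" "g \<in> bmf P"
  shows "qerr (\<lambda>x. g x * lin A b0 b x) = b0 * qerr g + (\<Sum>j\<in>A. b j * qerr (\<lambda>x. g x * ctr j x))"
proof -
  have "qerr (\<lambda>x. g x * lin A b0 b x) = qerr (\<lambda>x. b0 * g x + (\<Sum>j\<in>A. b j * (g x * ctr j x)))"
    by (rule qerr_cong) (simp add: lin_def algebra_simps sum_distrib_left)
  moreover have t: "(\<lambda>x. b j * (g x * ctr j x)) \<in> bmf P" if "j \<in> A" for j
    using that assms by (intro bmf_cmult bmf_mult bmf_ctr) auto
  ultimately show ?thesis
    by (simp only: qerr_add[OF bmf_cmult[OF assms(2)] bmf_sum[OF t]] qerr_sum[OF t])
      (simp only: qerr_cmult)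
qed

lemma qerr_mult_lin_le:
  assumes "A \<subseteq> {1..P}" "g \<in> bmf P" "\<bar>qerr g\<bar> \<le> e0"
    "\<And>j. j \<in> A \<Longrightarrow> \<bar>qerr (\<lambda>x. g x * ctr j x)\<bar> \<le> e1"
  shows "\<bar>qerr (\<lambda>x. g x * lin A b0 b x)\<bar> \<le> \<bar>b0\<bar> * e0 + (\<Sum>j\<in>A. \<bar>b j\<bar>) * e1"
proof -
  have "\<bar>\<Sum>j\<in>A. b j * qerr (\<lambda>x. g x * ctr j x)\<bar> \<le> (\<Sum>j\<in>A. \<bar>b j\<bar> * e1)"
    by (rule order_trans[OF sum_abs], rule sum_mono)
      (use assms(4) in \<open>auto simp: abs_mult intro: mult_left_mono\<close>)
  moreover have "\<bar>b0 * qerr g\<bar> \<le> \<bar>b0\<bar> * e0" using assms(3) by (simp add: abs_mult mult_left_mono)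
  ultimately show ?thesis
    unfolding qerr_mult_lin[OF assms(1,2)] sum_distrib_right by linarith
qed

text \<open>The constant term is integrated exactly. The terms linear in the centred coordinates
  contribute at most \<open>2 * \<bar>b0\<bar> * ?S\<close> times \<open>?d\<close>, the quadratic
  ones \<open>4 * ?S\<^sup>2\<close> times \<open>?d\<close>, and the factor 4 covers both.\<close>

lemma qerr_lin_sq_le:
  assumes A: "A \<subseteq> {1..P}"
  shows "\<bar>qerr (\<lambda>x. (lin A b0 b x)\<^sup>2)\<bar> \<le> 4 * D2 P n X * (\<bar>b0\<bar> + (\<Sum>j\<in>A. \<bar>b j\<bar>))\<^sup>2"
proof -
  let ?d = "D2 P n X" and ?S = "\<Sum>j\<in>A. \<bar>b j\<bar>"
  have S0: "0 \<le> ?S" by (rule sum_nonneg) simp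
  have "\<bar>qerr (\<lambda>x. 1 * lin A b0 b x)\<bar> \<le> \<bar>b0\<bar> * 0 + ?S * ?d"
    by (rule qerr_mult_lin_le) (use A qerr_ctr_le in \<open>auto simp: subset_iff\<close>)
  then have 0: "\<bar>qerr (lin A b0 b)\<bar> \<le> ?S * ?d" by simp
  have 1: "\<bar>qerr (\<lambda>x. lin A b0 b x * ctr j x)\<bar> \<le> \<bar>b0\<bar> * ?d + ?S * (4 * ?d)" if "j \<in> A" for j
  proof -
    have j: "j \<in> {1..P}" using that A by blast
    have "\<bar>qerr (\<lambda>x. ctr j x * lin A b0 b x)\<bar> \<le> \<bar>b0\<bar> * ?d + ?S * (4 * ?d)"
      by (rule qerr_mult_lin_le) (use A j qerr_ctr_le qerr_ctr_ctr_le in auto)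
    then show ?thesis by (simp only: mult.commute)
  qed
  have "\<bar>qerr (\<lambda>x. lin A b0 b x * lin A b0 b x)\<bar> \<le> \<bar>b0\<bar> * (?S * ?d) + ?S * (\<bar>b0\<bar> * ?d + ?S * (4 * ?d))"
    by (rule qerr_mult_lin_le[OF A bmf_lin[OF A] 0 1])
  also have "\<dots> = ?d * (2 * \<bar>b0\<bar> * ?S + 4 * ?S\<^sup>2)" by (simp add: power2_eq_square algebra_simps)
  also have "\<dots> \<le> ?d * (4 * (\<bar>b0\<bar> + ?S)\<^sup>2)"
  proof (intro mult_left_mono D2_nonneg)
    have "0 \<le> \<bar>b0\<bar> * ?S" "0 \<le> b0\<^sup>2" using S0 by auto
    then show "2 * \<bar>b0\<bar> * ?S + 4 * ?S\<^sup>2 \<le> 4 * (\<bar>b0\<bar> + ?S)\<^sup>2"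
      by (simp add: power2_sum)
  qed
  finally show ?thesis by (simp only: power2_eq_square mult_ac)
qed

text \<open>Treats all competitors at once, hence also the least-squares fit. As \<open>g\<close> is
  orthogonal to linear functions, the term linear in the perturbation is a pure quadrature error of
  size \<open>e\<close>, while the quadratic term stays coercive. Optimising over the size of the
  perturbation leaves a loss of order \<open>e\<^sup>2\<close>.\<close>

lemma mean_lin_perturb_ge:
  assumes A: "A \<subseteq> {1..P}" and M: "real (card A) \<le> M" "1 \<le> M"
    and D2: "3 * (M + 1)\<^sup>2 * (9 * M + 1) * D2 P n X < 1"
    and g: "g \<in> bmf P" and orth: "\<And>b0 b. cube_int P (\<lambda>x. g x * lin A b0 b x) = 0"
    and e0: "\<bar>qerr g\<bar> \<le> e" and e1: "\<And>j. j \<in> A \<Longrightarrow> \<bar>qerr (\<lambda>x. g x * ctr j x)\<bar> \<le> e"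
  shows "mean (\<lambda>x. (g x)\<^sup>2) - 2 * e\<^sup>2 * (1 + 12 * M) \<le> mean (\<lambda>x. (g x - lin A b0 b x)\<^sup>2)"
proof -
  define B where "B = \<bar>b0\<bar> + (\<Sum>j\<in>A. \<bar>b j\<bar>)"
  define N where "N = b0\<^sup>2 + (\<Sum>j\<in>A. (b j)\<^sup>2) / 12"
  define Q where "Q = 1 + 12 * M"
  have fin: "finite A" using A finite_subset by blast
  have B0: "0 \<le> B" unfolding B_def by (intro add_nonneg_nonneg sum_nonneg) auto
  have N0: "0 \<le> N" unfolding N_def by (intro add_nonneg_nonneg divide_nonneg_nonneg sum_nonneg) auto
  have Q: "1 \<le> Q" using M by (simp add: Q_def)
  have BN: "B\<^sup>2 \<le> Q * N" unfolding B_def Q_def N_def by (rule weighted_l1_le_l2[OF fin M])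
  have "\<bar>qerr (\<lambda>x. g x * lin A b0 b x)\<bar> \<le> \<bar>b0\<bar> * e + (\<Sum>j\<in>A. \<bar>b j\<bar>) * e"
    by (rule qerr_mult_lin_le[OF A g e0 e1])
  then have cross: "mean (\<lambda>x. g x * lin A b0 b x) \<le> B * e"
    unfolding qerr_def orth B_def by (simp add: algebra_simps)
  have d0: "0 \<le> D2 P n X" by (rule D2_nonneg)
  \<comment> \<open>As \<open>M \<ge> 1\<close>, the square is at least 4, and
    \<open>12 * (9 * M + 1)\<close> exceeds \<open>8 * (1 + 12 * M)\<close>.\<close>
  have "8 * Q \<le> 3 * (M + 1)\<^sup>2 * (9 * M + 1)"
  proof -
    have "2\<^sup>2 \<le> (M + 1)\<^sup>2" using M by (intro power_mono) auto
    then have "3 * 4 * (9 * M + 1) \<le> 3 * (M + 1)\<^sup>2 * (9 * M + 1)" using M by (intro mult_right_mono) auto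
    then show ?thesis using M by (simp add: Q_def)
  qed
  then have "8 * Q * D2 P n X \<le> 3 * (M + 1)\<^sup>2 * (9 * M + 1) * D2 P n X"
    using d0 by (rule mult_right_mono)
  then have "8 * Q * D2 P n X \<le> 1" using D2 by linarith
  then have dQ: "4 * D2 P n X * Q \<le> 1/2" by (simp add: mult_ac)
  have "\<bar>qerr (\<lambda>x. (lin A b0 b x)\<^sup>2)\<bar> \<le> 4 * D2 P n X * B\<^sup>2"
    unfolding B_def by (rule qerr_lin_sq_le[OF A])
  also have "\<dots> \<le> 4 * D2 P n X * (Q * N)" using BN d0 by (intro mult_left_mono) auto
  also have "\<dots> = (4 * D2 P n X * Q) * N" by simp
  also have "\<dots> \<le> 1/2 * N" using dQ N0 by (rule mult_right_mono)
  \<comment> \<open>Coercivity: the empirical mean square of a linear function is at least half the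
    exact one. This takes the place of inverting the normal equations.\<close>
  finally have sq: "N / 2 \<le> mean (\<lambda>x. (lin A b0 b x)\<^sup>2)"
    unfolding qerr_def cube_int_lin_sq[OF A] N_def[symmetric] by linarith
  \<comment> \<open>Young's inequality, balanced so that \<open>N / 2\<close> pays for the linear
    term \<open>2 * B * e\<close>.\<close>
  have "0 \<le> (B - 2 * e * Q)\<^sup>2" by simp
  then have "4 * Q * (B * e) \<le> B\<^sup>2 + 4 * Q * (Q * e\<^sup>2)"
    by (simp add: power2_diff power2_eq_square algebra_simps)
  also have "\<dots> \<le> Q * N + 4 * Q * (Q * e\<^sup>2)" using BN by simp
  also have "\<dots> = Q * (N + 4 * (Q * e\<^sup>2))" by (simp add: algebra_simps)
  finally have "Q * (4 * (B * e)) \<le> Q * (N + 4 * (Q * e\<^sup>2))" by (simp add: mult_ac)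
  then have "4 * (B * e) \<le> N + 4 * (Q * e\<^sup>2)" by (rule mult_left_le_imp_le) (use Q in simp)
  moreover have "mean (\<lambda>x. (g x - lin A b0 b x)\<^sup>2) =
      mean (\<lambda>x. (g x)\<^sup>2) - 2 * mean (\<lambda>x. g x * lin A b0 b x) + mean (\<lambda>x. (lin A b0 b x)\<^sup>2)"
    unfolding diff_square_expand by (simp only: mean_add mean_diff mean_cmult)
  moreover have "2 * e\<^sup>2 * (1 + 12 * M) = 2 * (Q * e\<^sup>2)" by (simp add: Q_def)
  ultimately show ?thesis using cross sq by linarith
qed

section \<open>Residual sums of squares and the gap between two subsets\<close>

lemma RSS_sum_eq:
  assumes "A \<subseteq> {1..P}"
  shows "(\<Sum>i=1..n. (f (restrict (X i) {1..P}) - b0 - (\<Sum>j\<in>A. b j * X i j))\<^sup>2) =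
    real n * mean (\<lambda>x. (f x - b0 - (\<Sum>j\<in>A. b j * x j))\<^sup>2)"
proof -
  have "(\<Sum>j\<in>A. b j * X i j) = (\<Sum>j\<in>A. b j * pt i j)" for i
    using assms by (intro sum.cong) (auto simp: pt_def)
  then show ?thesis unfolding mean_def pt_def[symmetric] using n_pos by simp
qed

lemma RSS_le:
  assumes A: "A0 \<subseteq> A" "A \<subseteq> {1..P}"
  shows "RSS n P X f A \<le> real n * mean (\<lambda>x. (res P f A0 x)\<^sup>2)"
proof -
  have fin: "finite A" "finite A0" using finite_subset[OF A(2)] finite_subset[OF A(1)] by auto
  define b where "b = (\<lambda>j. if j \<in> A0 then 12 * cov P f j else 0)"
  define b0 where "b0 = cube_int P f - (\<Sum>j\<in>A0. b j) / 2"
  have "(\<Sum>j\<in>A. b j * x j) = (\<Sum>j\<in>A0. b j * x j)" for x :: "nat \<Rightarrow> real"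
    using A(1) fin by (intro sum.mono_neutral_right) (auto simp: b_def)
  moreover have "f x - b0 - (\<Sum>j\<in>A0. b j * x j) = res P f A0 x" for x
  proof -
    have "lin A0 0 (\<lambda>j. b j - 12 * cov P f j) x = 0" by (simp add: lin_def b_def)
    then show ?thesis
      using raw_to_centred[OF fin(2), of f x b0 b P] by (simp add: b0_def)
  qed
  ultimately have "real n * mean (\<lambda>x. (res P f A0 x)\<^sup>2) =
      (\<Sum>i=1..n. (f (restrict (X i) {1..P}) - b0 - (\<Sum>j\<in>A. b j * X i j))\<^sup>2)"
    unfolding RSS_sum_eq[OF A(2)] by simp
  then show ?thesis
    unfolding RSS_def by (intro cInf_lower) (auto intro!: bdd_belowI[of _ 0] sum_nonneg)
qed

lemma RSS_ge:
  assumes A: "A \<subseteq> {1..P}"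
    and ge: "\<And>b0 b. c \<le> mean (\<lambda>x. (res P f A x - lin A b0 b x)\<^sup>2)"
  shows "real n * c \<le> RSS n P X f A"
  unfolding RSS_def
proof (rule cInf_greatest)
  fix r assume "r \<in> {(\<Sum>i=1..n. (f (restrict (X i) {1..P}) - b0 - (\<Sum>j\<in>A. b j * X i j))\<^sup>2) | b0 b. True}"
  then obtain b0 b where r: "r = (\<Sum>i=1..n. (f (restrict (X i) {1..P}) - b0 - (\<Sum>j\<in>A. b j * X i j))\<^sup>2)" by blast
  have fin: "finite A" using A finite_subset by blast
  show "real n * c \<le> r"
    unfolding r RSS_sum_eq[OF A] raw_to_centred[OF fin, where P = P] using ge by (intro mult_left_mono) auto
qed auto

text \<open>Twice the integral of \<open>g1 * w\<close> minus that of \<open>w\<^sup>2\<close>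
  equals 12 times the sum of squared covariances over \<open>A0 - A1\<close> minus that over
  \<open>A1 - A0\<close>. The terms with \<open>e\<close> and \<open>D2\<close> are the quadrature
  errors of the two integrals: 24 is twice 12, and 576 is \<open>4 * 12\<^sup>2\<close>.\<close>

lemma mean_res_sq_gap:
  assumes f: "f \<in> bmf P" and h: "h \<in> bmf P" and A0: "A0 \<subseteq> {1..P}" and A1: "A1 \<subseteq> {1..P}"
    and fh: "\<And>x. x \<in> cube P \<Longrightarrow> \<bar>f x - h x\<bar> \<le> eta"
    and indep: "\<And>j x y. j \<in> {1..P} - A0 \<Longrightarrow> h (x(j := y)) = h x"
    and card: "card A0 \<le> card A1" and ne: "A0 - A1 \<noteq> {}"
    and tau: "\<And>j. j \<in> A0 \<Longrightarrow> tau \<le> \<bar>cov P f j\<bar>" "eta \<le> 2 * tau" "0 \<le> eta"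
    and C: "\<And>x. x \<in> cube P \<Longrightarrow> \<bar>f x\<bar> \<le> C"
    and K: "\<And>x. x \<in> cube P \<Longrightarrow> \<bar>res P f A1 x\<bar> \<le> K" "eta \<le> K"
    and e: "\<And>j. j \<in> {1..P} \<Longrightarrow> \<bar>qerr (\<lambda>x. res P f A1 x * ctr j x)\<bar> \<le> e" "0 \<le> e"
  defines "m \<equiv> real (card A1)"
  shows "mean (\<lambda>x. (res P f A0 x)\<^sup>2) + 12 * tau\<^sup>2 - 3 * (m - real (card A0) + 1) * eta\<^sup>2
      - 24 * m * K * e - 576 * m\<^sup>2 * K * C * D2 P n X \<le> mean (\<lambda>x. (res P f A1 x)\<^sup>2)"
proof -
  have fin: "finite A0" "finite A1" using finite_subset[OF A0] finite_subset[OF A1] by auto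
  let ?c = "cov P f" and ?g = "res P f A1"
  define S where "S = A0 \<union> A1"
  \<comment> \<open>Both approximations have the mean of \<open>f\<close>, so the intercepts cancel.
    By orthogonality a slope does not depend on the subset, so only the symmetric difference
    survives.\<close>
  define b where "b = (\<lambda>j. 12 * ?c j * (of_bool (j \<in> A0) - of_bool (j \<in> A1)))"
  have S: "S \<subseteq> {1..P}" "finite S" using A0 A1 fin by (auto simp: S_def)
  have g_bmf: "?g \<in> bmf P" using f A1 by simp
  have w: "res P f A0 x = ?g x - lin S 0 b x" for x
  proof -
    have "(\<Sum>j\<in>S. 12 * ?c j * of_bool (j \<in> A) * ctr j x) = (\<Sum>j\<in>A. 12 * ?c j * ctr j x)" if "A \<subseteq> S" for A
      using that S(2) by (intro sum.mono_neutral_cong_right) auto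
    from this[of A0] this[of A1] show ?thesis
      by (simp add: res_def lin_def b_def S_def right_diff_distrib left_diff_distrib sum_subtractf)
  qed
  have small: "\<bar>?c j\<bar> \<le> eta / 2" if "j \<in> {1..P} - A0" for j
  proof -
    have j: "j \<in> {1..P}" using that by simp
    have "cov P h j = 0"
      unfolding cov_def ctr_def by (rule cube_int_indep_ctr[OF j h indep[OF that]])
    then have "?c j = cov P (\<lambda>x. f x - h x) j" using f h j by (simp add: cov_diff)
    then show ?thesis using cov_abs_le[OF bmf_diff[OF f h] j fh] by simp
  qed
  \<comment> \<open>On \<open>A0 - A1\<close> the covariance of \<open>f\<close> is that of the
    residual on \<open>A1\<close>, whose projection leaves these coordinates untouched. On
    \<open>A1 - A0\<close> it is at most \<open>eta / 2\<close>, and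
    \<open>eta \<le> K\<close>.\<close>
  have b_K: "\<bar>b j\<bar> \<le> 6 * K" if jS: "j \<in> S" for j
  proof -
    have j: "j \<in> {1..P}" using that S(1) by blast
    consider "j \<in> A0" "j \<in> A1" | "j \<in> A0" "j \<notin> A1" | "j \<notin> A0" "j \<in> A1" using jS unfolding S_def by blast
    then show ?thesis
    proof cases
      case 1 then show ?thesis using K(2) tau(3) by (simp add: b_def)
    next
      case 2
      then have "?c j = cov P ?g j" using cov_res[OF f A1 j] by simp
      also have "\<bar>\<dots>\<bar> \<le> K / 2" by (rule cov_abs_le[OF g_bmf j K(1)])
      finally show ?thesis using 2 by (simp add: b_def abs_mult)
    next
      case 3 then show ?thesis using small[of j] j K(2) by (simp add: b_def abs_mult)
    qed
  qed
  have b_C: "\<bar>b j\<bar> \<le> 6 * C" if "j \<in> S" for j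
  proof -
    have j: "j \<in> {1..P}" using that S(1) by blast
    have "\<bar>?c j\<bar> \<le> C / 2" by (rule cov_abs_le[OF f j C])
    moreover have "\<bar>b j\<bar> \<le> 12 * \<bar>?c j\<bar>" by (auto simp: b_def abs_mult)
    ultimately show ?thesis by linarith
  qed
  define B where "B = (\<Sum>j\<in>S. \<bar>b j\<bar>)"
  have cS: "real (card S) \<le> 2 * m"
    using card_Un_le[of A0 A1] card unfolding S_def m_def by linarith
  have K0: "0 \<le> K" using K(2) tau(3) by simp
  have "1 \<in> {1..P}" using P_ge_2 by simp
  then have "0 \<le> C" using cov_abs_le[OF f _ C, of 1] by (force intro: order_trans[OF abs_ge_zero])
  have BK: "B \<le> 12 * m * K"
  proof -
    have "B \<le> real (card S) * (6 * K)" unfolding B_def by (rule sum_bounded_above) (rule b_K)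
    also have "\<dots> \<le> (2 * m) * (6 * K)" using cS K0 by (intro mult_right_mono) auto
    finally show ?thesis by simp
  qed
  have BC: "B \<le> 12 * m * C"
  proof -
    have "B \<le> real (card S) * (6 * C)" unfolding B_def by (rule sum_bounded_above) (rule b_C)
    also have "\<dots> \<le> (2 * m) * (6 * C)" using cS \<open>0 \<le> C\<close> by (intro mult_right_mono) auto
    finally show ?thesis by simp
  qed
  have B0: "0 \<le> B" unfolding B_def by (rule sum_nonneg) simp
  have "\<bar>qerr (\<lambda>x. ?g x * lin S 0 b x)\<bar> \<le> \<bar>0\<bar> * \<bar>qerr ?g\<bar> + B * e"
    unfolding B_def by (rule qerr_mult_lin_le[OF S(1) g_bmf order_refl e(1)]) (use S in auto)
  also have "\<dots> \<le> 12 * m * K * e" using mult_right_mono[OF BK e(2)] by simp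
  finally have q1: "\<bar>qerr (\<lambda>x. ?g x * lin S 0 b x)\<bar> \<le> 12 * m * K * e" .
  \<comment> \<open>One factor is bounded through \<open>K\<close>, the other through
    \<open>C\<close>: the product term of \<open>rho\<close> offers \<open>K\<close> times
    \<open>zeta\<close>, and \<open>zeta\<close> contains \<open>C\<close> times
    \<open>D2\<close>.\<close>
  have BB: "B * B \<le> (12 * m * K) * (12 * m * C)"
    by (rule mult_mono[OF BK BC _ B0]) (use B0 BK in linarith)
  have "\<bar>qerr (\<lambda>x. (lin S 0 b x)\<^sup>2)\<bar> \<le> 4 * D2 P n X * B\<^sup>2"
    using qerr_lin_sq_le[OF S(1), of 0 b] by (simp add: B_def)
  also have "\<dots> \<le> 4 * D2 P n X * ((12 * m * K) * (12 * m * C))"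
    unfolding power2_eq_square using D2_nonneg by (intro mult_left_mono BB) simp
  also have "\<dots> = 576 * m\<^sup>2 * K * C * D2 P n X" by (simp add: power2_eq_square)
  finally have q2: "\<bar>qerr (\<lambda>x. (lin S 0 b x)\<^sup>2)\<bar> \<le> 576 * m\<^sup>2 * K * C * D2 P n X" .
  have i1: "cube_int P (\<lambda>x. ?g x * lin S 0 b x) = 12 * (\<Sum>j\<in>A0 - A1. (?c j)\<^sup>2)"
  proof -
    have "cube_int P (\<lambda>x. ?g x * lin S 0 b x) = (\<Sum>j\<in>S. b j * cov P ?g j)"
      using cube_int_mult_lin[OF S(1) g_bmf, of 0 b] by simp
    also have "\<dots> = (\<Sum>j\<in>A0 - A1. 12 * (?c j)\<^sup>2)"
      using S cov_res[OF f A1]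
      by (intro sum.mono_neutral_cong_right) (auto simp: b_def S_def power2_eq_square)
    finally show ?thesis by (simp add: sum_distrib_left)
  qed
  have i2: "cube_int P (\<lambda>x. (lin S 0 b x)\<^sup>2) =
      12 * (\<Sum>j\<in>A0 - A1. (?c j)\<^sup>2) + 12 * (\<Sum>j\<in>A1 - A0. (?c j)\<^sup>2)"
  proof -
    have "(\<Sum>j\<in>S. (b j)\<^sup>2) = (\<Sum>j\<in>(A0 - A1) \<union> (A1 - A0). 144 * (?c j)\<^sup>2)"
      using S by (intro sum.mono_neutral_cong_right) (auto simp: b_def S_def power2_eq_square)
    also have "\<dots> = (\<Sum>j\<in>A0 - A1. 144 * (?c j)\<^sup>2) + (\<Sum>j\<in>A1 - A0. 144 * (?c j)\<^sup>2)"
      using fin by (intro sum.union_disjoint) auto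
    finally show ?thesis
      unfolding cube_int_lin_sq[OF S(1)] sum_distrib_left[symmetric] by simp
  qed
  define k where "k = real (card (A0 - A1))"
  have k1: "1 \<le> k" using ne fin by (simp add: k_def Suc_le_eq card_gt_0_iff)
  have k2: "real (card (A1 - A0)) = m - real (card A0) + k"
    using card_Int_Diff[OF fin(1), of A1] card_Int_Diff[OF fin(2), of A0]
    by (simp add: k_def m_def Int_commute)
  have s1: "k * tau\<^sup>2 \<le> (\<Sum>j\<in>A0 - A1. (?c j)\<^sup>2)"
    unfolding k_def
  proof (rule sum_bounded_below)
    fix j assume "j \<in> A0 - A1"
    then have "tau \<le> \<bar>?c j\<bar>" using tau(1) by simp
    then have "tau\<^sup>2 \<le> \<bar>?c j\<bar>\<^sup>2" using tau(2,3) by (intro power_mono) auto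
    then show "tau\<^sup>2 \<le> (?c j)\<^sup>2" by simp
  qed
  have s2: "(\<Sum>j\<in>A1 - A0. (?c j)\<^sup>2) \<le> (m - real (card A0) + k) * (eta\<^sup>2 / 4)"
    unfolding k2[symmetric]
  proof (rule sum_bounded_above)
    fix j assume "j \<in> A1 - A0"
    then have "\<bar>?c j\<bar>\<^sup>2 \<le> (eta / 2)\<^sup>2" using small A1 by (intro power_mono) auto
    then show "(?c j)\<^sup>2 \<le> eta\<^sup>2 / 4" by (simp add: power_divide)
  qed
  \<comment> \<open>Each further missed coordinate gains at least \<open>tau\<^sup>2\<close> and
    costs at most \<open>eta\<^sup>2 / 4\<close>, so \<open>k = 1\<close> is the least favourable
    case.\<close>
  have "(eta / 2)\<^sup>2 \<le> tau\<^sup>2" using tau(2,3) by (intro power_mono) auto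
  then have "1 * (tau\<^sup>2 - eta\<^sup>2 / 4) \<le> k * (tau\<^sup>2 - eta\<^sup>2 / 4)"
    using k1 by (intro mult_right_mono) (auto simp: power_divide)
  then have s30: "0 \<le> 12 * (k * (tau\<^sup>2 - eta\<^sup>2 / 4) - 1 * (tau\<^sup>2 - eta\<^sup>2 / 4))" by simp
  have s31: "12 * (k * tau\<^sup>2) - 12 * ((m - real (card A0) + k) * (eta\<^sup>2 / 4))
      - (12 * tau\<^sup>2 - 3 * (m - real (card A0) + 1) * eta\<^sup>2)
      = 12 * (k * (tau\<^sup>2 - eta\<^sup>2 / 4) - 1 * (tau\<^sup>2 - eta\<^sup>2 / 4))"
    by (simp add: field_simps)
  have s3: "12 * tau\<^sup>2 - 3 * (m - real (card A0) + 1) * eta\<^sup>2 \<le>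
      12 * (k * tau\<^sup>2) - 12 * ((m - real (card A0) + k) * (eta\<^sup>2 / 4))"
    using s30 unfolding s31[symmetric] by (simp only: diff_ge_0_iff_ge)
  have "mean (\<lambda>x. (res P f A0 x)\<^sup>2) =
      mean (\<lambda>x. (?g x)\<^sup>2) - 2 * mean (\<lambda>x. ?g x * lin S 0 b x) + mean (\<lambda>x. (lin S 0 b x)\<^sup>2)"
    unfolding w diff_square_expand by (simp only: mean_add mean_diff mean_cmult)
  moreover have "mean (\<lambda>x. ?g x * lin S 0 b x) = qerr (\<lambda>x. ?g x * lin S 0 b x) + 12 * (\<Sum>j\<in>A0 - A1. (?c j)\<^sup>2)"
    unfolding qerr_def i1 by simp
  moreover have "mean (\<lambda>x. (lin S 0 b x)\<^sup>2) = qerr (\<lambda>x. (lin S 0 b x)\<^sup>2)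
      + (12 * (\<Sum>j\<in>A0 - A1. (?c j)\<^sup>2) + 12 * (\<Sum>j\<in>A1 - A0. (?c j)\<^sup>2))"
    unfolding qerr_def i2 by simp
  ultimately show ?thesis using q1 q2 s1 s2 s3 by linarith
qed

end

section \<open>Suprema over the cube and absorption of the errors into \<open>zeta\<close> and
  \<open>rho\<close>\<close>

lemma maxz_nonneg: "finite S \<Longrightarrow> 0 \<le> maxz S"
  by (simp add: maxz_def)

lemma maxz_ge: "finite S \<Longrightarrow> s \<in> S \<Longrightarrow> s \<le> maxz S"
  by (simp add: maxz_def)

lemma cube_nonempty: "(\<lambda>k\<in>{1..P}. 0) \<in> cube P"
  by (simp add: cube_def)

lemma bmf_bdd_above:
  assumes "g \<in> bmf P" shows "bdd_above ((\<lambda>x. \<bar>g x\<bar>) ` cube P)"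
  using bmf_bounded[OF assms] by (metis bdd_aboveI2)

lemma bmf_le_SUP:
  "g \<in> bmf P \<Longrightarrow> x \<in> cube P \<Longrightarrow> \<bar>g x\<bar> \<le> (SUP x\<in>cube P. \<bar>g x\<bar>)"
  by (intro cSUP_upper bmf_bdd_above)

lemma SUP_abs_nonneg:
  "g \<in> bmf P \<Longrightarrow> 0 \<le> (SUP x\<in>cube P. \<bar>g x\<bar>)"
  using bmf_le_SUP[OF _ cube_nonempty] by (meson abs_ge_zero order_trans)

lemma continuous_on_restrict_coords:
  assumes "q \<le> P" "continuous_on (cube q) g"
  shows "continuous_on (cube P) (\<lambda>x. g (restrict x {1..q}))"
proof (rule continuous_on_compose2[OF assms(2)])
  show "continuous_on (cube P) (\<lambda>x. restrict x {1..q})"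
  proof (rule continuous_on_coordinatewise_then_product)
    fix k
    show "continuous_on (cube P) (\<lambda>x. restrict x {1..q} k)"
      by (cases "k \<in> {1..q}")
        (auto intro: continuous_on_subset[OF continuous_on_product_coordinates])
  qed
  show "(\<lambda>x. restrict x {1..q}) ` cube P \<subseteq> cube q"
    using assms(1) by (auto simp: cube_def)
qed

text \<open>All rests on \<open>T \<ge> 40 * m\<close>, from
  \<open>(m + 1)\<^sup>2 \<ge> 4 * m\<close> and \<open>9 * m + 1 \<ge> 10\<close>. Then
  \<open>16 * 5/2 = 40\<close> explains the first conclusion and
  \<open>3 * 40\<^sup>2 = 4800\<close> the second; the coefficient 26 lies well below
  \<open>15/2 * 40\<close>.\<close>

lemma zeta_dominates:
  fixes C D d :: real
  assumes m: "1 \<le> m" and \<alpha>: "0 < \<alpha>" "\<alpha> < 1"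
    and pos: "0 \<le> V" "0 \<le> eta" "0 \<le> C" "0 \<le> D" "0 \<le> d"
    and e: "e \<le> 5/2 * (V * D) + 2 * eta + 26 * real m * C * d"
  defines "z \<equiv> zeta m V eta C \<alpha> D d"
  shows "16 * real m * e \<le> z" "4800 * (real m)\<^sup>2 * (C * d) \<le> z"
proof -
  define \<mu> where "\<mu> = real m"
  define T where "T = (\<mu> + 1)\<^sup>2 * (9 * \<mu> + 1)"
  have \<mu>: "1 \<le> \<mu>" using m by (simp add: \<mu>_def)
  have "4 * \<mu> \<le> (\<mu> + 1)\<^sup>2" using zero_le_power2[of "\<mu> - 1"] by (simp add: power2_eq_square algebra_simps)
  then have "(4 * \<mu>) * 10 \<le> T" unfolding T_def using \<mu> by (intro mult_mono) auto
  then have T: "40 * \<mu> \<le> T" by simp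
  have nn: "0 \<le> V * D" "0 \<le> C * d" using pos by auto
  define s where "s = V * D + 2 * eta + 3 * T * (C * d)"
  have z: "z = T * (V * D) + T * (2 * eta) + 3 / (1 - \<alpha>) * (T\<^sup>2 * (C * d))"
    unfolding z_def zeta_def T_def \<mu>_def by (simp add: power2_eq_square power4_eq_xxxx algebra_simps)
  have "3 \<le> 3 / (1 - \<alpha>)" using \<alpha> by (simp add: le_divide_eq)
  then have "3 * (T\<^sup>2 * (C * d)) \<le> 3 / (1 - \<alpha>) * (T\<^sup>2 * (C * d))"
    using nn by (intro mult_right_mono) auto
  then have zs: "T * s \<le> z" unfolding z s_def by (simp add: power2_eq_square algebra_simps)
  have s0: "0 \<le> s" unfolding s_def using nn pos T \<mu> by auto
  have "26 * \<mu> * (C * d) \<le> (15/2 * T) * (C * d)" using T \<mu> nn by (intro mult_right_mono) auto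
  then have es: "e \<le> 5/2 * s" using e pos(2) unfolding s_def \<mu>_def by (simp add: mult_ac)
  have "16 * \<mu> * e \<le> 16 * \<mu> * (5/2 * s)" using es \<mu> by (intro mult_left_mono) auto
  also have "\<dots> = (40 * \<mu>) * s" by simp
  also have "\<dots> \<le> T * s" using T s0 by (rule mult_right_mono)
  finally show "16 * real m * e \<le> z" using zs by (simp add: \<mu>_def)
  have "4800 * \<mu>\<^sup>2 * (C * d) = 3 * ((40 * \<mu>) * (40 * \<mu>)) * (C * d)" by (simp add: power2_eq_square)
  also have "\<dots> \<le> 3 * (T * T) * (C * d)"
    using T \<mu> nn by (intro mult_right_mono mult_left_mono mult_mono) auto
  also have "\<dots> \<le> T * s" using nn pos T \<mu> by (simp add: s_def algebra_simps)
  finally show "4800 * (real m)\<^sup>2 * (C * d) \<le> z" using zs by (simp add: \<mu>_def)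
qed

text \<open>The square of \<open>z\<close> takes up the least-squares loss. The two errors linear in
  \<open>K\<close> need 24/16 and 576/4800 of \<open>K * z\<close>, together less than the 2
  available.\<close>

lemma rho_dominates:
  fixes C d e K :: real
  assumes m: "1 \<le> m" and "0 \<le> e" "0 \<le> c + eta"
    and z1: "16 * real m * e \<le> z" and z2: "4800 * (real m)\<^sup>2 * (C * d) \<le> z"
  defines "K \<equiv> c + eta"
  shows "2 * e\<^sup>2 * (1 + 12 * real m) + 24 * real m * K * e + 576 * (real m)\<^sup>2 * K * C * d \<le> rho m c z eta"
proof -
  define \<mu> where "\<mu> = real m"
  have \<mu>: "1 \<le> \<mu>" using m by (simp add: \<mu>_def)
  have K: "0 \<le> K" using assms by simp
  have z0: "0 \<le> z" using mult_nonneg_nonneg[of "16 * real m" e] assms(2) z1 by linarith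
  have "(16 * \<mu> * e)\<^sup>2 \<le> z\<^sup>2" using z1 \<mu> assms(2) unfolding \<mu>_def by (intro power_mono) auto
  then have "256 * \<mu>\<^sup>2 * e\<^sup>2 \<le> z\<^sup>2" by (simp add: power_mult_distrib)
  moreover have "2 * (1 + 12 * \<mu>) \<le> 256 * \<mu>\<^sup>2"
  proof -
    have "2 * (1 + 12 * \<mu>) \<le> 256 * \<mu>" using \<mu> by simp
    also have "\<dots> \<le> 256 * \<mu>\<^sup>2" using \<mu> by (simp add: power2_eq_square)
    finally show ?thesis .
  qed
  then have "2 * (1 + 12 * \<mu>) * e\<^sup>2 \<le> 256 * \<mu>\<^sup>2 * e\<^sup>2" by (rule mult_right_mono) simp
  moreover have "2 * e\<^sup>2 * (1 + 12 * \<mu>) = 2 * (1 + 12 * \<mu>) * e\<^sup>2" by simp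
  ultimately have t1: "2 * e\<^sup>2 * (1 + 12 * \<mu>) \<le> z\<^sup>2" by (metis order_trans)
  have "K * (16 * \<mu> * e) \<le> K * z" using z1 K unfolding \<mu>_def by (rule mult_left_mono)
  then have t2: "24 * \<mu> * K * e \<le> 3/2 * (K * z)" by (simp add: mult_ac)
  have "K * (4800 * \<mu>\<^sup>2 * (C * d)) \<le> K * z" using z2 K unfolding \<mu>_def by (rule mult_left_mono)
  then have t3: "576 * \<mu>\<^sup>2 * K * C * d \<le> 576 / 4800 * (K * z)" by (simp add: mult_ac)
  have "0 \<le> 2 * (1 / sqrt (\<mu> + 1)) * z\<^sup>2" using \<mu> by simp
  moreover have "0 \<le> K * z" using K z0 by simp
  moreover have "rho m c z eta = z\<^sup>2 + 2 * (K * z) + 2 * (1 / sqrt (\<mu> + 1)) * z\<^sup>2"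
    by (simp add: rho_def K_def \<mu>_def mult_ac)
  ultimately show ?thesis using t1 t2 t3 unfolding \<mu>_def by linarith
qed

section \<open>Error bounds for the moments of the residuals\<close>

context design
begin

text \<open>Multiplying by \<open>x j\<close> may add a coordinate to \<open>W\<close>, which is why
  the discrepancy over \<open>U3\<close> enters. In \<open>5/2\<close>, one \<open>V * D\<close>
  comes from \<open>h\<close>, one from its halfspace truncations, and a half from centring;
  \<open>H * D2\<close> is the corner term.\<close>

lemma koksma_hlawka_moments:
  assumes A: "\<And>j. j \<in> {1..P} \<Longrightarrow> \<exists>A. insert j W \<subseteq> A \<and> A \<subseteq> {1..P} \<and> disc n X A \<le> D"
    and h: "continuous_on (cube P) h"
    and dep: "\<And>x y. x \<in> cube P \<Longrightarrow> y \<in> cube P \<Longrightarrow> (\<forall>k\<in>W. x k = y k) \<Longrightarrow> h x = h y"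
    and V: "VHK {1..P} h < \<infinity>" "real_of_ereal (VHK {1..P} h) \<le> V"
    and H: "\<And>x. x \<in> cube P \<Longrightarrow> \<bar>h x\<bar> \<le> H"
  shows "\<bar>qerr h\<bar> \<le> V * D"
    and "j \<in> {1..P} \<Longrightarrow> \<bar>qerr (\<lambda>x. h x * ctr j x)\<bar> \<le> 5/2 * (V * D) + H * D2 P n X"
proof -
  let ?q1 = "\<lambda>j s. \<bar>qerr (\<lambda>x. of_bool (x j \<le> s))\<bar>"
  have one: "(\<lambda>k. if k \<in> {1..P} then 1 else undefined) \<in> cube P"
    by (auto simp: cube_def PiE_iff extensional_def)
  have "0 \<le> real_of_ereal (VHK {1..P} h)" by (intro real_of_ereal_pos VHK_nonneg) simp
  then have half: "\<bar>qerr (\<lambda>x. of_bool (x j \<le> s) * h x)\<bar> \<le> V * D + H * ?q1 j s"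
    if "j \<in> {1..P}" "0 \<le> s" "s \<le> 1" for j s
  proof -
    obtain A where A': "insert j W \<subseteq> A" "A \<subseteq> {1..P}" "disc n X A \<le> D" using A[OF \<open>j \<in> {1..P}\<close>] by blast
    have "\<bar>qerr (\<lambda>x. of_bool (x j \<le> s) * h x)\<bar> \<le> real_of_ereal (VHK {1..P} h) * disc n X A
        + \<bar>h (\<lambda>k. if k \<in> {1..P} then 1 else undefined)\<bar> * ?q1 j s"
      by (rule koksma_hlawka_halfspace[OF A'(1,2) h dep V(1) that(2,3)])
    also have "\<dots> \<le> V * D + H * ?q1 j s"
      using V(2) A'(3) disc_nonneg[of A] H[OF one] \<open>0 \<le> real_of_ereal _\<close>
      by (intro add_mono mult_mono) auto
    finally show ?thesis .
  qed
  \<comment> \<open>At threshold 1 the halfspace is the whole cube: its own error is 0 and only the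
    variation term remains.\<close>
  show 0: "\<bar>qerr h\<bar> \<le> V * D"
  proof -
    have 1: "1 \<in> {1..P}" using P_ge_2 by simp
    have b: "of_bool (x 1 \<le> 1) = (1::real)" if "x \<in> cube P" for x using cubeD[OF that 1] by simp
    have "qerr (\<lambda>x. of_bool (x 1 \<le> 1) * h x) = qerr h" by (rule qerr_cong) (simp only: b mult_1_left)
    moreover have "qerr (\<lambda>x. of_bool (x 1 \<le> 1)) = qerr (\<lambda>_. 1)" by (rule qerr_cong) (simp only: b)
    ultimately show ?thesis using half[OF 1, of 1] by simp
  qed
  show "\<bar>qerr (\<lambda>x. h x * ctr j x)\<bar> \<le> 5/2 * (V * D) + H * D2 P n X" if j: "j \<in> {1..P}"
  proof -
    have h_bmf: "h \<in> bmf P" by (rule continuous_on_imp_bmf[OF h])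
    have H0: "0 \<le> H" using H[OF one] by linarith
    have "\<bar>qerr (\<lambda>x. x j * h x)\<bar> \<le> V * D + (V * D + H * D2 P n X)"
    proof (rule qerr_mult_coord_le[OF j h_bmf 0])
      fix s :: real assume s: "0 \<le> s" "s \<le> 1"
      show "\<bar>qerr (\<lambda>x. of_bool (x j \<le> s) * h x)\<bar> \<le> V * D + H * D2 P n X"
        using half[OF j s] mult_left_mono[OF qerr_half_le[OF j s] H0] by linarith
    qed
    then show ?thesis using 0 unfolding qerr_mult_ctr[OF h_bmf j] by linarith
  qed
qed

text \<open>Only \<open>h\<close> has controlled variation, so \<open>f - h\<close> is bounded
  crudely by \<open>eta\<close>. The coefficient 26 collects 24 from slopes of size at most
  \<open>6 * C\<close> times the 4 of \<open>qerr_ctr_ctr_le\<close>, one from the intercept and one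
  from the corner term of \<open>h\<close>.\<close>

lemma qerr_res_le:
  assumes f: "f \<in> bmf P" and h: "h \<in> bmf P" and A: "A \<subseteq> {1..P}" "1 \<le> card A"
    and fh: "\<And>x. x \<in> cube P \<Longrightarrow> \<bar>f x - h x\<bar> \<le> eta" and C: "\<And>x. x \<in> cube P \<Longrightarrow> \<bar>f x\<bar> \<le> C"
    and d1: "D2 P n X \<le> 1" and E0: "0 \<le> E" "\<bar>qerr h\<bar> \<le> E"
    and E: "\<And>j. j \<in> {1..P} \<Longrightarrow> \<bar>qerr (\<lambda>x. h x * ctr j x)\<bar> \<le> 5/2 * E + (C + eta) * D2 P n X"
  shows "\<bar>qerr (res P f A)\<bar> \<le> 5/2 * E + 2 * eta + 26 * real (card A) * C * D2 P n X"
    and "j \<in> {1..P} \<Longrightarrow>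
      \<bar>qerr (\<lambda>x. res P f A x * ctr j x)\<bar> \<le> 5/2 * E + 2 * eta + 26 * real (card A) * C * D2 P n X"
proof -
  let ?d = "D2 P n X" and ?m = "real (card A)" and ?b = "\<lambda>j. 12 * cov P f j"
  let ?l = "lin A (cube_int P f) ?b"
  have m: "1 \<le> ?m" using A(2) by simp
  have d0: "0 \<le> ?d" by (rule D2_nonneg)
  have C0: "0 \<le> C" using C[OF cube_nonempty] by linarith
  have eta0: "0 \<le> eta" using fh[OF cube_nonempty] by linarith
  have Cd: "0 \<le> C * ?d" using C0 d0 by simp
  have mCd: "C * ?d \<le> ?m * (C * ?d)" using mult_right_mono[OF m Cd] by simp
  have mu: "\<bar>cube_int P f\<bar> \<le> C" using f C by (rule cube_int_abs_le)
  have bsum: "(\<Sum>j\<in>A. \<bar>?b j\<bar>) \<le> ?m * (6 * C)"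
  proof (rule sum_bounded_above)
    fix j assume "j \<in> A"
    then have "\<bar>cov P f j\<bar> \<le> C / 2" using f C A(1) by (intro cov_abs_le) auto
    then show "\<bar>?b j\<bar> \<le> 6 * C" by (simp add: abs_mult)
  qed
  show "\<bar>qerr (res P f A)\<bar> \<le> 5/2 * E + 2 * eta + 26 * ?m * C * ?d"
  proof -
    have "\<bar>qerr (\<lambda>x. 1 * ?l x)\<bar> \<le> \<bar>cube_int P f\<bar> * 0 + (\<Sum>j\<in>A. \<bar>?b j\<bar>) * ?d"
      by (rule qerr_mult_lin_le) (use A qerr_ctr_le in \<open>auto simp: subset_iff\<close>)
    also have "\<dots> \<le> ?m * (6 * C) * ?d" using mult_right_mono[OF bsum d0] by simp
    finally have "\<bar>qerr ?l\<bar> \<le> 6 * (?m * (C * ?d))" by (simp add: mult_ac)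
    moreover have "\<bar>qerr (\<lambda>x. f x - h x)\<bar> \<le> 2 * eta" using f h fh by (intro qerr_abs_le bmf_diff)
    moreover have "qerr (\<lambda>x. f x - h x) = qerr f - qerr h" using f h by (rule qerr_diff)
    moreover have "qerr (res P f A) = qerr f - qerr ?l"
      unfolding res_def[abs_def] using f A(1) by (intro qerr_diff bmf_lin)
    moreover have "26 * ?m * C * ?d = 26 * (?m * (C * ?d))" by simp
    ultimately show ?thesis using E0 mCd Cd by linarith
  qed
  show "\<bar>qerr (\<lambda>x. res P f A x * ctr j x)\<bar> \<le> 5/2 * E + 2 * eta + 26 * ?m * C * ?d" if j: "j \<in> {1..P}"
  proof -
    have "\<bar>qerr (\<lambda>x. ctr j x * ?l x)\<bar> \<le> \<bar>cube_int P f\<bar> * ?d + (\<Sum>j\<in>A. \<bar>?b j\<bar>) * (4 * ?d)"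
      by (rule qerr_mult_lin_le) (use A j qerr_ctr_le qerr_ctr_ctr_le in auto)
    also have "\<dots> \<le> C * ?d + ?m * (6 * C) * (4 * ?d)"
      using mu bsum d0 by (intro add_mono mult_right_mono) auto
    finally have l: "\<bar>qerr (\<lambda>x. ?l x * ctr j x)\<bar> \<le> C * ?d + 24 * (?m * (C * ?d))"
      by (simp add: mult_ac)
    have "\<bar>qerr (\<lambda>x. (f x - h x) * ctr j x)\<bar> \<le> 2 * (eta * (1/2))"
    proof (rule qerr_abs_le)
      show "(\<lambda>x. (f x - h x) * ctr j x) \<in> bmf P" using f h j by (intro bmf_mult bmf_diff bmf_ctr)
      fix x assume "x \<in> cube P"
      then show "\<bar>(f x - h x) * ctr j x\<bar> \<le> eta * (1/2)"
        unfolding abs_mult using fh ctr_abs_le j eta0 by (intro mult_mono) auto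
    qed
    moreover have "qerr (\<lambda>x. (f x - h x) * ctr j x) = qerr (\<lambda>x. f x * ctr j x) - qerr (\<lambda>x. h x * ctr j x)"
      unfolding left_diff_distrib using f h j by (intro qerr_diff bmf_mult bmf_ctr)
    moreover have "qerr (\<lambda>x. res P f A x * ctr j x) = qerr (\<lambda>x. f x * ctr j x) - qerr (\<lambda>x. ?l x * ctr j x)"
      unfolding res_def[abs_def] left_diff_distrib using f A(1) j by (intro qerr_diff bmf_mult bmf_ctr bmf_lin)
    moreover have "(C + eta) * ?d \<le> C * ?d + eta"
      using mult_left_mono[OF d1 eta0] by (simp add: distrib_right)
    moreover have "26 * ?m * C * ?d = 26 * (?m * (C * ?d))" by simp
    ultimately show ?thesis using E[OF j] l mCd by linarith
  qed
qed

text \<open>Adds the least-squares loss to the quadrature losses, all expressed through one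
  first-moment bound \<open>e\<close>. The quantities \<open>V\<close>, \<open>D\<close>,
  \<open>C\<close> and \<open>c\<close> enter as upper bounds, which keeps the maxima over families
  of subsets out of the argument.\<close>

lemma RSS_gap:
  assumes A1: "A1 \<subseteq> {1..P}" "1 \<le> card A1"
    and f: "continuous_on (cube P) f" and h: "continuous_on (cube P) h"
    and A0: "card A0 \<le> card A1" "A0 - A1 \<noteq> {}"
    and indep: "\<And>x y. (\<forall>k\<in>A0. x k = y k) \<Longrightarrow> h x = h y"
    and V: "VHK {1..P} h < \<infinity>" "real_of_ereal (VHK {1..P} h) \<le> V"
    and D: "\<And>j. j \<in> {1..P} \<Longrightarrow> \<exists>A. insert j A0 \<subseteq> A \<and> A \<subseteq> {1..P} \<and> disc n X A \<le> D"
    and fh: "\<And>x. x \<in> cube P \<Longrightarrow> \<bar>f x - h x\<bar> \<le> eta" and C: "\<And>x. x \<in> cube P \<Longrightarrow> \<bar>f x\<bar> \<le> C"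
    and c: "\<And>x. x \<in> cube P \<Longrightarrow> \<bar>res P f A1 x - (f x - h x)\<bar> \<le> c"
    and tau: "\<And>j. j \<in> A0 \<Longrightarrow> tau \<le> \<bar>cov P f j\<bar>" "eta \<le> 2 * tau"
    and \<alpha>: "0 < \<alpha>" "\<alpha> < 1"
    and D2: "3 * (real (card A1) + 1)\<^sup>2 * (9 * real (card A1) + 1) * D2 P n X < 1"
  shows "real n * (mean (\<lambda>x. (res P f A0 x)\<^sup>2)
      + 12 * tau\<^sup>2 - 3 * (real (card A1) - real (card A0) + 1) * eta\<^sup>2
      - rho (card A1) c (zeta (card A1) V eta C \<alpha> D (D2 P n X)) eta) \<le> RSS n P X f A1"
proof -
  let ?m = "real (card A1)" and ?d = "D2 P n X" and ?g = "res P f A1"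
  have fb: "f \<in> bmf P" and hb: "h \<in> bmf P" using f h by (auto intro: continuous_on_imp_bmf)
  have gb: "?g \<in> bmf P" using fb A1(1) by simp
  have 1: "1 \<in> {1..P}" using P_ge_2 by simp
  have A0P: "A0 \<subseteq> {1..P}" using D[OF 1] by blast
  have m: "1 \<le> ?m" using A1(2) by simp
  have d0: "0 \<le> ?d" by (rule D2_nonneg)
  have C0: "0 \<le> C" using C[OF cube_nonempty] by linarith
  have eta0: "0 \<le> eta" using fh[OF cube_nonempty] by linarith
  have c0: "0 \<le> c" using c[OF cube_nonempty] by linarith
  have V0: "0 \<le> V"
    using V(2) real_of_ereal_pos[OF VHK_nonneg[of "{1..P}" h]] by simp
  have D0: "0 \<le> D" using D[OF 1] disc_nonneg order_trans by blast
  \<comment> \<open>The factor of \<open>?d\<close> in the hypothesis is at least 1, so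
    \<open>?d \<le> 1\<close>; this lets \<open>eta\<close> absorb the product of \<open>eta\<close>
    and \<open>?d\<close>.\<close>
  have "1 * 1 \<le> (?m + 1)\<^sup>2 * (9 * ?m + 1)" using m by (intro mult_mono) (auto simp: one_le_power)
  then have "1 * ?d \<le> 3 * (?m + 1)\<^sup>2 * (9 * ?m + 1) * ?d"
    using d0 by (intro mult_right_mono) auto
  then have d1: "?d \<le> 1" using D2 by linarith
  define e where "e = 5/2 * (V * D) + 2 * eta + 26 * ?m * C * ?d"
  have e0: "0 \<le> e" unfolding e_def using V0 D0 eta0 m C0 d0 by (intro add_nonneg_nonneg mult_nonneg_nonneg) auto
  have h_abs: "\<bar>h x\<bar> \<le> C + eta" if "x \<in> cube P" for x using C[OF that] fh[OF that] by linarith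
  note kh = koksma_hlawka_moments[OF D h indep V h_abs]
  have q0: "\<bar>qerr ?g\<bar> \<le> e" and q1: "\<And>j. j \<in> {1..P} \<Longrightarrow> \<bar>qerr (\<lambda>x. ?g x * ctr j x)\<bar> \<le> e"
    unfolding e_def
    using qerr_res_le[OF fb hb A1 fh C d1 mult_nonneg_nonneg[OF V0 D0] kh(1,2)] by blast+
  define K where "K = c + eta"
  have K: "\<bar>?g x\<bar> \<le> K" if "x \<in> cube P" for x
    using c[OF that] fh[OF that] unfolding K_def by linarith
  have gap: "mean (\<lambda>x. (res P f A0 x)\<^sup>2) + 12 * tau\<^sup>2 - 3 * (?m - real (card A0) + 1) * eta\<^sup>2
      - 24 * ?m * K * e - 576 * ?m\<^sup>2 * K * C * ?d \<le> mean (\<lambda>x. (?g x)\<^sup>2)"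
  proof (rule mean_res_sq_gap[OF fb hb A0P A1(1) fh _ A0 tau eta0 C K _ q1 e0])
    show "h (x(j := y)) = h x" if "j \<in> {1..P} - A0" for j x y using that by (intro indep) auto
    show "eta \<le> K" using c0 by (simp add: K_def)
  qed
  have "16 * ?m * e \<le> zeta (card A1) V eta C \<alpha> D ?d"
    and "4800 * ?m\<^sup>2 * (C * ?d) \<le> zeta (card A1) V eta C \<alpha> D ?d"
    by (rule zeta_dominates[OF A1(2) \<alpha> V0 eta0 C0 D0 d0, of e]; simp add: e_def)+
  from rho_dominates[OF A1(2) e0 _ this, of c eta]
  have rho: "2 * e\<^sup>2 * (1 + 12 * ?m) + 24 * ?m * K * e + 576 * ?m\<^sup>2 * K * C * ?d
      \<le> rho (card A1) c (zeta (card A1) V eta C \<alpha> D ?d) eta"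
    using c0 eta0 by (simp add: K_def)
  show ?thesis
  proof (rule RSS_ge[OF A1(1)])
    fix b0 b
    have "mean (\<lambda>x. (?g x)\<^sup>2) - 2 * e\<^sup>2 * (1 + 12 * ?m) \<le> mean (\<lambda>x. (?g x - lin A1 b0 b x)\<^sup>2)"
      by (rule mean_lin_perturb_ge[OF A1(1) order_refl m D2 gb cube_int_res_lin[OF fb A1(1)] q0 q1])
        (use A1(1) in auto)
    then show "mean (\<lambda>x. (res P f A0 x)\<^sup>2) + 12 * tau\<^sup>2 - 3 * (?m - real (card A0) + 1) * eta\<^sup>2
        - rho (card A1) c (zeta (card A1) V eta C \<alpha> D ?d) eta \<le> mean (\<lambda>x. (?g x - lin A1 b0 b x)\<^sup>2)"
      using gap rho by linarith
  qed
qed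

end

section \<open>The moment condition and the final comparison\<close>

lemma cov_eq_moment_diff:
  assumes "f \<in> bmf P" "j \<in> {1..P}"
  shows "cov P f j = cube_int P (\<lambda>x. x j * f x) - 1/2 * cube_int P f"
proof -
  have "cov P f j = cube_int P (\<lambda>x. x j * f x - (1/2) * f x)"
    unfolding cov_def ctr_def by (simp add: algebra_simps)
  also have "\<dots> = cube_int P (\<lambda>x. x j * f x) - cube_int P (\<lambda>x. (1/2) * f x)"
    using assms by (intro cube_int_diff bmf_mult bmf_coord bmf_const)
  finally show ?thesis by (simp only: cube_int_cmult)
qed

theorem theorem2:
  fixes p :: "nat \<Rightarrow> nat" and p0 M :: nat
    and f :: "nat \<Rightarrow> (nat \<Rightarrow> real) \<Rightarrow> real"
    and X :: "nat \<Rightarrow> nat \<Rightarrow> nat \<Rightarrow> real"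
    and ft :: "nat \<Rightarrow> (nat \<Rightarrow> real) \<Rightarrow> real"
    and eta :: "nat \<Rightarrow> real" and tau alpha :: real
  assumes p0_pos: "1 \<le> p0" and p0_M: "p0 \<le> M" and p0_p: "\<And>n. p0 < p n"
    and f_cont: "\<And>n. continuous_on (cube (p n)) (f n)"
    and X_range: "\<And>n i j. i \<in> {1..n} \<Longrightarrow> j \<in> {1..p n} \<Longrightarrow> 0 \<le> X n i j \<and> X n i j < 1"
    and A1_cont: "\<And>n. continuous_on (cube p0) (ft n)"
    and A1_eta_pos: "\<And>n. eta n > 0"
    and A1_approx: "\<And>n. (SUP x\<in>cube (p n). \<bar>f n x - ft n (restrict x {1..p0})\<bar>) < eta n"
    and A1_tau_pos: "tau > 0"
    and A1_tau: "\<And>n j. j \<in> {1..p0} \<Longrightarrow>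
        \<bar>cube_int (p n) (\<lambda>x. x j * f n x) - 1/2 * cube_int (p n) (f n)\<bar> > tau"
    and A2: "\<And>n. BVHK {1..p0} (ft n)"
    and A3_alpha: "0 < alpha" "alpha < 1"
    and A3: "eventually (\<lambda>n. 3 * (real M + 1)^2 * (9 * real M + 1) * D2 (p n) n (X n) < alpha) sequentially"
    and A4: "\<exists>D>0. eventually (\<lambda>n.
        12 * tau^2 - 12 * (real M - real p0 + 1) * (eta n)^2 - 4 * (eta n)^2
        - 4 * eta n * (C4 p0 M (p n) (f n) (ft n) + C3 p0 (p n) (f n) (ft n))
        - Dp0 p0 n (X n) * V1 p0 (p n) (f n) (ft n)
        - Dp0M p0 M (p n) n (X n) * V2 p0 M (p n) (f n) (ft n)
        - rho p0 (C3 p0 (p n) (f n) (ft n))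
              (zeta p0 (C1 p0 (p n) (ft n)) (eta n) (C2 (p n) (f n)) alpha
                    (Dp0 p0 n (X n)) (D2 (p n) n (X n))) (eta n)
        - rho M (C4 p0 M (p n) (f n) (ft n))
              (zeta M (C1 p0 (p n) (ft n)) (eta n) (C2 (p n) (f n)) alpha
                    (Dp01 p0 (p n) n (X n)) (D2 (p n) n (X n))) (eta n)
        > D) sequentially"
  shows "eventually (\<lambda>n.
     (SUP A\<in>U0 p0 M (p n). ereal (RSS n (p n) (X n) (f n) A))
       < (INF A\<in>U1 p0 M (p n). ereal (RSS n (p n) (X n) (f n) A))) sequentially"
proof -
  obtain D where D: "D > 0" and A4': "eventually (\<lambda>n.
        12 * tau^2 - 12 * (real M - real p0 + 1) * (eta n)^2 - 4 * (eta n)^2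
        - 4 * eta n * (C4 p0 M (p n) (f n) (ft n) + C3 p0 (p n) (f n) (ft n))
        - Dp0 p0 n (X n) * V1 p0 (p n) (f n) (ft n)
        - Dp0M p0 M (p n) n (X n) * V2 p0 M (p n) (f n) (ft n)
        - rho p0 (C3 p0 (p n) (f n) (ft n))
              (zeta p0 (C1 p0 (p n) (ft n)) (eta n) (C2 (p n) (f n)) alpha
                    (Dp0 p0 n (X n)) (D2 (p n) n (X n))) (eta n)
        - rho M (C4 p0 M (p n) (f n) (ft n))
              (zeta M (C1 p0 (p n) (ft n)) (eta n) (C2 (p n) (f n)) alpha
                    (Dp01 p0 (p n) n (X n)) (D2 (p n) n (X n))) (eta n)
        > D) sequentially"
    using A4 by blast
  show ?thesis
    using A3 A4' eventually_gt_at_top[of 0]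
  proof eventually_elim
    case (elim n)
    define P where "P = p n"
    interpret design n P "X n"
    proof
      show "n > 0" by (rule elim(3))
      show "P \<ge> 2" using p0_pos p0_p[of n] by (simp add: P_def)
      show "0 \<le> X n i j \<and> X n i j \<le> 1" if "i \<in> {1..n}" "j \<in> {1..P}" for i j
        using X_range[OF that(1), of j] that(2) by (simp add: P_def less_imp_le)
    qed
    let ?f = "f n" and ?h = "\<lambda>x. ft n (restrict x {1..p0})" and ?eta = "eta n" and ?A0 = "{1..p0}"
    let ?d = "D2 P n (X n)" and ?lr = "lin_res p0 P (f n) (ft n)"
    define c1 where "c1 = C1 p0 P (ft n)"
    define c2 where "c2 = C2 P ?f"
    define c3 where "c3 = C3 p0 P ?f (ft n)"
    define c4 where "c4 = C4 p0 M P ?f (ft n)"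
    define d0 where "d0 = Dp0 p0 n (X n)"
    define d1 where "d1 = Dp01 p0 P n (X n)"
    define z1 where "z1 = zeta p0 c1 ?eta c2 alpha d0 ?d"
    define r2 where "r2 = rho M c4 (zeta M c1 ?eta c2 alpha d1 ?d) ?eta"
    note elim' = elim(1,2)[folded P_def, folded c1_def c2_def c3_def c4_def d0_def d1_def, folded z1_def r2_def]
    have p0P: "p0 < P" using p0_p by (simp add: P_def)
    have A0P: "?A0 \<subseteq> {1..P}" using p0P by auto
    have eta_pos: "0 < ?eta" by (rule A1_eta_pos)
    have f_cont': "continuous_on (cube P) ?f" using f_cont by (simp add: P_def)
    have h_cont: "continuous_on (cube P) ?h"
      using p0P A1_cont by (intro continuous_on_restrict_coords) auto
    have fb: "?f \<in> bmf P" and hb: "?h \<in> bmf P"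
      using f_cont' h_cont by (auto intro: continuous_on_imp_bmf)
    have lrb: "?lr A \<in> bmf P" if "A \<subseteq> {1..P}" for A
    proof (rule bmf_cong)
      show "(\<lambda>x. res P ?f A x - (?f x - ?h x)) \<in> bmf P" using fb hb that by (intro bmf_diff bmf_res)
    qed (simp add: lin_res_eq[OF fb that])
    have finU: "finite (U1 p0 M P)" "finite (U3 p0 P)" "finite (U4 p0 M P)"
      by (rule finite_subset[of _ "Pow {1..P}"]; use A0P in \<open>force simp: U1_def U3_def U4_def\<close>)+
    have c1_V: "real_of_ereal (VHK {1..P} ?h) \<le> c1"
    proof -
      have "real_of_ereal (VHK {1..P} ?h) \<le>
          max (real_of_ereal (VHK {1..P} ?h)) (real_of_ereal (VHK {1..P} (\<lambda>x. x 1 * ?h x)))" by simp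
      also have "\<dots> \<le> c1" unfolding c1_def C1_def using P_ge_2 by (intro Max_ge) auto
      finally show ?thesis .
    qed
    have V_fin: "VHK {1..P} ?h < \<infinity>" using A0P A2 by (intro VHK_restrict_finite) auto
    have VHK0: "0 \<le> real_of_ereal (VHK {1..P} g)" for g by (intro real_of_ereal_pos VHK_nonneg) simp
    have c1_0: "0 \<le> c1" using c1_V VHK0[of ?h] by linarith
    have c2: "\<bar>?f x\<bar> \<le> c2" if "x \<in> cube P" for x
      unfolding c2_def C2_def by (rule bmf_le_SUP[OF fb that])
    have c2_0: "0 \<le> c2" unfolding c2_def C2_def by (rule SUP_abs_nonneg[OF fb])
    have c3_0: "0 \<le> c3" unfolding c3_def C3_def by (rule SUP_abs_nonneg[OF lrb[OF A0P]])
    have c4: "\<bar>?lr A x\<bar> \<le> c4" if A: "A \<in> U1 p0 M P" and x: "x \<in> cube P" for A x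
    proof -
      have "A \<subseteq> {1..P}" using A by (auto simp: U1_def)
      then have "\<bar>?lr A x\<bar> \<le> (SUP x\<in>cube P. \<bar>?lr A x\<bar>)" by (rule bmf_le_SUP[OF lrb x])
      also have "\<dots> \<le> c4" unfolding c4_def C4_def using finU A by (intro maxz_ge) auto
      finally show ?thesis .
    qed
    have c4_0: "0 \<le> c4" unfolding c4_def C4_def using finU by (intro maxz_nonneg) simp
    have d0_0: "0 \<le> d0" unfolding d0_def Dp0_def by (rule disc_nonneg)
    have prod1: "0 \<le> d0 * V1 p0 P ?f (ft n)"
      unfolding V1_def using d0_0 VHK0 by (rule mult_nonneg_nonneg)
    have prod2: "0 \<le> Dp0M p0 M P n (X n) * V2 p0 M P ?f (ft n)"
      unfolding Dp0M_def V2_def using finU by (intro mult_nonneg_nonneg maxz_nonneg) auto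
    have z1_0: "0 \<le> z1"
      unfolding z1_def zeta_def using c1_0 c2_0 d0_0 eta_pos D2_nonneg A3_alpha
      by (intro add_nonneg_nonneg mult_nonneg_nonneg) auto
    have rho1_0: "0 \<le> rho p0 c3 z1 ?eta"
      unfolding rho_def using z1_0 c3_0 eta_pos by (intro add_nonneg_nonneg mult_nonneg_nonneg) auto
    have eta4: "0 \<le> 4 * ?eta * (c4 + c3)" using eta_pos c3_0 c4_0 by simp
    have M_eta: "3 * (real M - real p0 + 1) * ?eta\<^sup>2 \<le> 12 * (real M - real p0 + 1) * ?eta\<^sup>2"
      "12 * ?eta\<^sup>2 \<le> 12 * (real M - real p0 + 1) * ?eta\<^sup>2"
      using p0_M by (auto intro: mult_right_mono)
    have M1: "1 \<le> M" using p0_pos p0_M by simp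
    have d1: "\<exists>A. insert j ?A0 \<subseteq> A \<and> A \<subseteq> {1..P} \<and> disc n (X n) A \<le> d1" if j: "j \<in> {1..P}" for j
    proof -
      \<comment> \<open>For \<open>j\<close> already in \<open>A0\<close> any further coordinate
        will do, and \<open>p0 < P\<close> supplies \<open>p0 + 1\<close>.\<close>
      define l where "l = (if j \<in> ?A0 then p0 + 1 else j)"
      have l: "l \<in> {1..P} - ?A0" using j p0P by (auto simp: l_def)
      have "?A0 \<union> {l} \<in> U3 p0 P" unfolding U3_def using l by (intro CollectI exI[of _ "{l}"]) auto
      then have "disc n (X n) (?A0 \<union> {l}) \<le> d1" unfolding d1_def Dp01_def using finU by (intro maxz_ge) auto
      moreover have "insert j ?A0 \<subseteq> ?A0 \<union> {l}" using j by (auto simp: l_def)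
      ultimately show ?thesis using A0P l by (intro exI[of _ "?A0 \<union> {l}"]) auto
    qed
    have "d1 \<ge> 0" unfolding d1_def Dp01_def using finU by (intro maxz_nonneg) simp
    then have "0 \<le> r2"
      unfolding r2_def rho_def zeta_def using c1_0 c2_0 c4_0 eta_pos D2_nonneg A3_alpha
      by (intro add_nonneg_nonneg mult_nonneg_nonneg) auto
    \<comment> \<open>(A4) also limits \<open>eta\<close>: its left side is positive and every
      subtracted term nonnegative, while \<open>M - p0 + 1 \<ge> 1\<close>.\<close>
    then have "12 * ?eta\<^sup>2 \<le> 12 * tau\<^sup>2"
      using elim'(2) D prod1 prod2 rho1_0 eta4 M_eta(2) zero_le_power2[of ?eta] by linarith
    then have "?eta \<le> tau" using A1_tau_pos by (intro power2_le_imp_le[of ?eta tau]) auto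
    then have eta_tau: "?eta \<le> 2 * tau" using A1_tau_pos by simp
    have fh: "\<bar>?f x - ?h x\<bar> \<le> ?eta" if "x \<in> cube P" for x
      using bmf_le_SUP[OF bmf_diff[OF fb hb] that] A1_approx[of n] by (simp add: P_def)
    have tau: "tau \<le> \<bar>cov P ?f j\<bar>" if "j \<in> ?A0" for j
    proof -
      have "j \<in> {1..P}" using that A0P by blast
      then show ?thesis
        using A1_tau[OF that, of n] by (simp only: cov_eq_moment_diff[OF fb] P_def[symmetric])
    qed
    \<comment> \<open>The separating value: all of \<open>U0\<close> stays at or below
      \<open>s\<close>, all of \<open>U1\<close> at or above \<open>s + n * D\<close>.\<close>
    define s where "s = real n * mean (\<lambda>x. (res P ?f ?A0 x)\<^sup>2)"
    have upper: "RSS n P (X n) ?f A \<le> s" if "A \<in> U0 p0 M P" for A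
      unfolding s_def by (rule RSS_le) (use that in \<open>auto simp: U0_def\<close>)
    have lower: "s + real n * D \<le> RSS n P (X n) ?f A" if A: "A \<in> U1 p0 M P" for A
    proof -
      have AP: "A \<subseteq> {1..P}" "card A = M" "?A0 - A \<noteq> {}" using A by (auto simp: U1_def)
      have "real n * (mean (\<lambda>x. (res P ?f ?A0 x)\<^sup>2) + 12 * tau\<^sup>2
          - 3 * (real (card A) - real (card ?A0) + 1) * ?eta\<^sup>2
          - rho (card A) c4 (zeta (card A) c1 ?eta c2 alpha d1 ?d) ?eta) \<le> RSS n P (X n) ?f A"
      proof (rule RSS_gap[OF AP(1) _ f_cont' h_cont _ AP(3) _ V_fin c1_V d1 fh c2 _ tau eta_tau A3_alpha])
        show "1 \<le> card A" "card ?A0 \<le> card A" using AP(2) M1 p0_M by auto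
        show "?h x = ?h y" if "\<forall>k\<in>?A0. x k = y k" for x y
          using that by (intro arg_cong[of _ _ "ft n"]) (auto simp: restrict_def)
        show "\<bar>res P ?f A x - (?f x - ?h x)\<bar> \<le> c4" if "x \<in> cube P" for x
          using c4[OF A that] by (simp only: lin_res_eq[OF fb AP(1)])
        show "3 * (real (card A) + 1)\<^sup>2 * (9 * real (card A) + 1) * ?d < 1"
          using elim'(1) A3_alpha AP(2) by simp
      qed
      then have "real n * (mean (\<lambda>x. (res P ?f ?A0 x)\<^sup>2) + 12 * tau\<^sup>2
          - 3 * (real M - real p0 + 1) * ?eta\<^sup>2 - r2) \<le> RSS n P (X n) ?f A"
        by (simp add: AP(2) r2_def)
      moreover have "D \<le> 12 * tau\<^sup>2 - 3 * (real M - real p0 + 1) * ?eta\<^sup>2 - r2"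
        using elim'(2) prod1 prod2 rho1_0 eta4 M_eta(1) zero_le_power2[of ?eta] by linarith
      then have "real n * (mean (\<lambda>x. (res P ?f ?A0 x)\<^sup>2) + D) \<le> real n * (mean (\<lambda>x. (res P ?f ?A0 x)\<^sup>2) + 12 * tau\<^sup>2
          - 3 * (real M - real p0 + 1) * ?eta\<^sup>2 - r2)"
        by (intro mult_left_mono) auto
      ultimately show ?thesis by (simp add: s_def distrib_left)
    qed
    \<comment> \<open>In \<open>ereal\<close> the comparison through the real number
      \<open>s\<close> also covers an empty family, whose supremum is minus infinity or infimum plus
      infinity.\<close>
    have "(SUP A\<in>U0 p0 M P. ereal (RSS n P (X n) ?f A)) \<le> ereal s"
      using upper by (intro SUP_least) simp
    also have "\<dots> < ereal (s + real n * D)" using D n_pos by simp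
    also have "\<dots> \<le> (INF A\<in>U1 p0 M P. ereal (RSS n P (X n) ?f A))"
      using lower by (intro INF_greatest) simp
    finally show ?case by (simp only: P_def)
  qed
qed

end
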